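(* Let $E$ be a product system over a unital $C^*$-algebra $\mathcal B$, $\omega$ a continuous unit on $E$, and $\mathcal U=\mathcal U_\omega$ the maximal continuous set of units containing $\omega$, with its left-right $\mathcal B$-$\mathcal B$ module structure having $\omega$ as neutral element. For every positive $b\in\mathcal B$ define $\langle\cdot,\cdot\rangle_b:\mathcal U\times\mathcal U\to\mathcal B$ by $$\langle x,y\rangle_b=(\mathcal L^{x,y}-\mathcal L^{x,\omega}-\mathcal L^{\omega,y}+\mathcal L^{\omega,\omega})(b).$$ Then, for every positive $b\in\mathcal B$ (except where $b$ is further specified): (a) for all $x,y,z\in\mathcal U$ and $\alpha,\beta\in\mathbb C$: $\langle x,\alpha y+\beta z\rangle_b=\alpha\langle x,y\rangle_b+\beta\langle x,z\rangle_b$; (b) for all $x,y\in\mathcal U$, $a\in\mathcal B$: $\langle x,y\cdot a\rangle_b=\langle x,y\rangle_b\,a$; (c) for all $x,y\in\mathcal U$: $\langle x,y\rangle_b=\langle y,x\rangle_b^*$; (d) for all $x\in\mathcal U$: $\langle x,x\rangle_b\ge0$; (e) if $x\approx x'$ and $y\approx y'$ then $\langle x,y\rangle_b=\langle x',y'\rangle_b$; (f) for all $x,y\in\mathcal U$ and $0\le a\in\mathcal B$: $\langle x,a\cdot y\rangle_1=\langle x,y\rangle_a$; (g) if $b\in\mathcal B$ and $0\le b\le1$, then $\langle x,x\rangle_b\le\langle x,x\rangle_1$ for all $x\in\mathcal U$; (h) for all $x,y\in\mathcal U$: $\displaystyle\langle x-y,x-y\rangle_1=\lim_{t\to0+}\frac{\langle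 x_t-y_t,x_t-y_t\rangle}{t}$, where on the left $x-y$ is the difference in the module $\mathcal U$ and on the right $x_t-y_t\in E_t$.
   Context: $\mathcal B$ is a unital $C^*$-algebra with unit $1$. A Hilbert $\mathcal B$-$\mathcal B$ module is a right Hilbert $\mathcal B$-module (inner product $\mathcal B$-valued, linear in the second variable) with a unital left action of $\mathcal B$ by adjointable operators. A product system over $\mathcal B$ is a family $E=(E_t)_{t\ge0}$ of Hilbert $\mathcal B$-$\mathcal B$ modules with $E_0\cong\mathcal B$ and (associative) bilinear unitary isomorphisms $\varphi_{t,s}:E_t\otimes E_s\to E_{t+s}$, where $\otimes$ is the inner tensor product over $\mathcal B$ with $\langle u\otimes v,u_1\otimes v_1\rangle=\langle v,\langle u,u_1\rangle v_1\rangle$; one identifies $E_t\otimes E_s$ with $E_{t+s}$. A unit on $E$ is a family $u=(u_t)_{t\ge0}$, $u_t\in E_t$, with $u_0=1$ and $u_t\otimes u_s=u_{t+s}$. For units $u,v$ put $\mathcal K^{u,v}_t(b)=\langle u_t,bv_t\rangle$; these are bounded linear operators on $\mathcal B$ forming a semigroup in $t$. A set $S$ of units is continuous if for all $\xi,\eta\in S$ the semigroup $\mathcal K_t^{\xi,\eta}$ is uniformly continuous (continuous in the norm of $L(\mathcal B)$); then $\mathcal L^{\xi,\eta}=\frac{d}{dt}\mathcal K^{\xi,\eta}_t|_{t=0}\in L(\mathcal B)$ and $\mathcal K^{\xi,\eta}_t=\exp(t\mathcal L^{\xi,\eta})$. A unit $u$ is continuous if $\{u\}$ is continuous. For a continuous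 unit $\omega$, $\mathcal U_\omega$ is the set of all continuous units $x$ such that $\{x,\omega\}$ is a continuous set; it is the maximal continuous set of units containing $\omega$. For $x^1,\dots,x^n\in\mathcal U_\omega$ and $\varkappa_1,\dots,\varkappa_n\in\mathcal B$ with $\sum_j\varkappa_j=1$, $\varkappa_1x^1\boxplus\dots\boxplus\varkappa_nx^n$ denotes the unit $\zeta$ with $\zeta_t=\lim_{m\to\infty}\big(\sum_j\varkappa_jx^j_{t/m}\big)^{\otimes m}$ (norm limit), and $x^1\varkappa_1\boxplus\dots\boxplus x^n\varkappa_n$ the unit obtained from $\sum_jx^j_{t/m}\varkappa_j$ in the same way. For $x\in\mathcal U_\omega$, $\beta\in\mathcal B$, $x^\beta$ is the unit with $x^\beta_t=\lim_{m\to\infty}\big(x_{t/m}e^{\beta t/m}\big)^{\otimes m}$. It is known that these limits exist and the units belong to $\mathcal U_\omega$. The module operations on $\mathcal U_\omega$ are $x+y=x\boxplus y\boxplus(-\omega)$, $b\cdot x=bx\boxplus(1-b)\omega$, $x\cdot b=xb\boxplus\omega(1-b)$; the neutral element is $\omega$, the inverse of $x$ is $2\omega\boxplus(-x)$, and a complex scalar $\alpha$ acts as $\alpha1\in\mathcal B$. One writes $x\approx y$ if $x=y^\beta$ for some $\beta\in\mathcal B$. For all $\xi\in\mathcal U_\omega$, $a,c\in\mathcal B$, the kernels are $\mathcal L^{x+y,\xi}=\mathcal L^{x,\xi}+\mathcal L^{y,\xi}-\mathcal L^{\omega,\xi}$, $\mathcal L^{x\cdot a,\xi}(c)=a^*\mathcal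 L^{x,\xi}(c)+(1-a)^*\mathcal L^{\omega,\xi}(c)$, $\mathcal L^{a\cdot x,\xi}(c)=\mathcal L^{x,\xi}(a^*c)+\mathcal L^{\omega,\xi}((1-a^* )c)$, $\mathcal L^{x^\beta,\xi}(c)=\mathcal L^{x,\xi}(c)+\beta^*c$, $\mathcal L^{x^\beta,x^\beta}(c)=\mathcal L^{x,x}(c)+\beta^*c+c\beta$. *)

theory Defs
  imports "HOL-Analysis.Analysis"
begin

section \<open>Unital C*-algebras\<close>

text \<open>The superclasses already provide a real Banach algebra with \<open>norm 1 = 1\<close> (so the zero
  algebra is excluded); the class adds the complex scalars and the involution.\<close>

class unital_cstar_algebra = real_normed_algebra_1 + banach +
  fixes scaleC :: "complex \<Rightarrow> 'a \<Rightarrow> 'a"  (infixr \<open>*\<^sub>C\<close> 75)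
    and star :: "'a \<Rightarrow> 'a"
  assumes scaleC_add_right: "\<alpha> *\<^sub>C (a + b) = \<alpha> *\<^sub>C a + \<alpha> *\<^sub>C b"
    and scaleC_add_left: "(\<alpha> + \<beta>) *\<^sub>C a = \<alpha> *\<^sub>C a + \<beta> *\<^sub>C a"
    and scaleC_scaleC: "\<alpha> *\<^sub>C (\<beta> *\<^sub>C a) = (\<alpha> * \<beta>) *\<^sub>C a"
    and scaleC_of_real: "complex_of_real r *\<^sub>C a = r *\<^sub>R a"
    and mult_scaleC_left: "(\<alpha> *\<^sub>C a) * b = \<alpha> *\<^sub>C (a * b)"
    and mult_scaleC_right: "a * (\<alpha> *\<^sub>C b) = \<alpha> *\<^sub>C (a * b)"
    and norm_scaleC: "norm (\<alpha> *\<^sub>C a) = cmod \<alpha> * norm a"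
    and star_add: "star (a + b) = star a + star b"
    and star_scaleC: "star (\<alpha> *\<^sub>C a) = cnj \<alpha> *\<^sub>C star a"
    and star_mult: "star (a * b) = star b * star a"
    and star_star: "star (star a) = a"
    and cstar_identity: "norm (star a * a) = (norm a)\<^sup>2"

definition cstar_positive :: "'b::unital_cstar_algebra \<Rightarrow> bool"
  where "cstar_positive a \<longleftrightarrow> (\<exists>c. a = star c * c)"

definition cstar_le :: "'b::unital_cstar_algebra \<Rightarrow> 'b \<Rightarrow> bool"  (infix \<open>\<le>\<^sub>C\<close> 50)
  where "a \<le>\<^sub>C b \<longleftrightarrow> cstar_positive (b - a)"


section \<open>Hilbert bimodules and their inner tensor product\<close>

text \<open>The underlying additive group of a module is a subgroup of an ambient abelian group, given by
  its type. For a family of modules this is no restriction: take the direct sum as ambient group.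
  Complex scalars act on a module as multiples of the unit.\<close>

record ('b, 'e) bimodule =
  car :: "'e set"
  lact :: "'b \<Rightarrow> 'e \<Rightarrow> 'e"
  ract :: "'e \<Rightarrow> 'b \<Rightarrow> 'e"
  ip :: "'e \<Rightarrow> 'e \<Rightarrow> 'b"

definition hnorm :: "('b::unital_cstar_algebra, 'e) bimodule \<Rightarrow> 'e \<Rightarrow> real"
  where "hnorm M x = sqrt (norm (ip M x x))"

locale hilbert_bimodule =
  fixes M :: "('b::unital_cstar_algebra, 'e::ab_group_add) bimodule"
  assumes zero_closed: "0 \<in> car M"
    and add_closed: "\<lbrakk>x \<in> car M; y \<in> car M\<rbrakk> \<Longrightarrow> x + y \<in> car M"
    and uminus_closed: "x \<in> car M \<Longrightarrow> - x \<in> car M"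
    and ract_closed: "x \<in> car M \<Longrightarrow> ract M x b \<in> car M"
    and ract_add_left: "\<lbrakk>x \<in> car M; y \<in> car M\<rbrakk> \<Longrightarrow> ract M (x + y) b = ract M x b + ract M y b"
    and ract_add_right: "x \<in> car M \<Longrightarrow> ract M x (a + b) = ract M x a + ract M x b"
    and ract_mult: "x \<in> car M \<Longrightarrow> ract M x (a * b) = ract M (ract M x a) b"
    and ract_one: "x \<in> car M \<Longrightarrow> ract M x 1 = x"
    and ip_add: "\<lbrakk>x \<in> car M; y \<in> car M; z \<in> car M\<rbrakk> \<Longrightarrow> ip M x (y + z) = ip M x y + ip M x z"
    and ip_ract: "\<lbrakk>x \<in> car M; y \<in> car M\<rbrakk> \<Longrightarrow> ip M x (ract M y b) = ip M x y * b"
    and ip_star: "\<lbrakk>x \<in> car M; y \<in> car M\<rbrakk> \<Longrightarrow> ip M x y = star (ip M y x)"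
    and ip_positive: "x \<in> car M \<Longrightarrow> cstar_positive (ip M x x)"
    and ip_definite: "\<lbrakk>x \<in> car M; ip M x x = 0\<rbrakk> \<Longrightarrow> x = 0"
    and complete: "\<lbrakk>\<And>n. X n \<in> car M; \<And>e. e > 0 \<Longrightarrow> \<exists>N. \<forall>m\<ge>N. \<forall>n\<ge>N. hnorm M (X m - X n) < e\<rbrakk>
      \<Longrightarrow> \<exists>x\<in>car M. (\<lambda>n. hnorm M (X n - x)) \<longlonglongrightarrow> 0"
    and lact_closed: "x \<in> car M \<Longrightarrow> lact M a x \<in> car M"
    and lact_add_right: "\<lbrakk>x \<in> car M; y \<in> car M\<rbrakk> \<Longrightarrow> lact M a (x + y) = lact M a x + lact M a y"
    and lact_ract: "x \<in> car M \<Longrightarrow> lact M a (ract M x b) = ract M (lact M a x) b"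
    and lact_add_left: "x \<in> car M \<Longrightarrow> lact M (a + b) x = lact M a x + lact M b x"
    and lact_scaleC: "x \<in> car M \<Longrightarrow> lact M (\<alpha> *\<^sub>C a) x = ract M (lact M a x) (\<alpha> *\<^sub>C 1)"
    and lact_mult: "x \<in> car M \<Longrightarrow> lact M (a * b) x = lact M a (lact M b x)"
    and lact_one: "x \<in> car M \<Longrightarrow> lact M 1 x = x"
    and lact_adjoint: "\<lbrakk>x \<in> car M; y \<in> car M\<rbrakk> \<Longrightarrow> ip M (lact M a x) y = ip M x (lact M (star a) y)"

text \<open>\<open>\<tau>\<close> exhibits \<open>T\<close> as the inner tensor product of \<open>M\<close> and \<open>N\<close>: it sends \<open>(u, v)\<close> to the
  elementary tensor. The inner product formula and the density of the sums of elementary tensors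
  make such a \<open>T\<close> unique up to a bilinear unitary, so giving \<open>\<tau>\<close> is the same as giving a bilinear
  unitary from the inner tensor product of \<open>M\<close> and \<open>N\<close> onto \<open>T\<close>.\<close>

locale inner_tensor_product =
  fixes M :: "('b::unital_cstar_algebra, 'e::ab_group_add) bimodule"
    and N :: "('b, 'f::ab_group_add) bimodule"
    and T :: "('b, 'g::ab_group_add) bimodule"
    and \<tau> :: "'e \<Rightarrow> 'f \<Rightarrow> 'g"
  assumes tensor_closed: "\<lbrakk>u \<in> car M; v \<in> car N\<rbrakk> \<Longrightarrow> \<tau> u v \<in> car T"
    and tensor_add_left: "\<lbrakk>u \<in> car M; u' \<in> car M; v \<in> car N\<rbrakk> \<Longrightarrow> \<tau> (u + u') v = \<tau> u v + \<tau> u' v"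
    and tensor_add_right: "\<lbrakk>u \<in> car M; v \<in> car N; v' \<in> car N\<rbrakk> \<Longrightarrow> \<tau> u (v + v') = \<tau> u v + \<tau> u v'"
    and tensor_balanced: "\<lbrakk>u \<in> car M; v \<in> car N\<rbrakk> \<Longrightarrow> \<tau> (ract M u b) v = \<tau> u (lact N b v)"
    and tensor_lact: "\<lbrakk>u \<in> car M; v \<in> car N\<rbrakk> \<Longrightarrow> lact T a (\<tau> u v) = \<tau> (lact M a u) v"
    and tensor_ract: "\<lbrakk>u \<in> car M; v \<in> car N\<rbrakk> \<Longrightarrow> ract T (\<tau> u v) b = \<tau> u (ract N v b)"
    and tensor_ip: "\<lbrakk>u \<in> car M; v \<in> car N; u' \<in> car M; v' \<in> car N\<rbrakk>
      \<Longrightarrow> ip T (\<tau> u v) (\<tau> u' v') = ip N v (lact N (ip M u u') v')"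
    and tensor_dense: "\<lbrakk>z \<in> car T; e > 0\<rbrakk>
      \<Longrightarrow> \<exists>ps. set ps \<subseteq> car M \<times> car N \<and> hnorm T (z - (\<Sum>(u, v)\<leftarrow>ps. \<tau> u v)) < e"


section \<open>Product systems and units\<close>

text \<open>\<open>tens P t s u v\<close> is the image of \<open>u \<otimes> v\<close> in the fibre at \<open>t + s\<close>, and \<open>emb P\<close> identifies the
  algebra with the fibre at \<open>0\<close>. Only nonnegative times matter.\<close>

record ('b, 'e) prodsys =
  fib :: "real \<Rightarrow> ('b, 'e) bimodule"
  tens :: "real \<Rightarrow> real \<Rightarrow> 'e \<Rightarrow> 'e \<Rightarrow> 'e"
  emb :: "'b \<Rightarrow> 'e"

locale product_system =
  fixes P :: "('b::unital_cstar_algebra, 'e::ab_group_add) prodsys"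
  assumes fib_hilbert: "t \<ge> 0 \<Longrightarrow> hilbert_bimodule (fib P t)"
    and emb_bij: "bij_betw (emb P) UNIV (car (fib P 0))"
    and emb_add: "emb P (a + b) = emb P a + emb P b"
    and emb_lact: "emb P (a * b) = lact (fib P 0) a (emb P b)"
    and emb_ract: "emb P (a * b) = ract (fib P 0) (emb P a) b"
    and emb_ip: "ip (fib P 0) (emb P a) (emb P b) = star a * b"
    and tens_tensor: "\<lbrakk>t \<ge> 0; s \<ge> 0\<rbrakk>
      \<Longrightarrow> inner_tensor_product (fib P t) (fib P s) (fib P (t + s)) (tens P t s)"
    and tens_assoc: "\<lbrakk>r \<ge> 0; s \<ge> 0; t \<ge> 0; u \<in> car (fib P r); v \<in> car (fib P s); w \<in> car (fib P t)\<rbrakk>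
      \<Longrightarrow> tens P (r + s) t (tens P r s u v) w = tens P r (s + t) u (tens P s t v w)"

text \<open>No compatibility of \<open>tens P 0 t\<close> and \<open>tens P t 0\<close> with the module actions is required. If the
  system has a unit \<open>u\<close>, then \<open>u 0 \<otimes> u 0 = u 0\<close> together with bilinearity and associativity
  forces these maps to be the canonical identifications.\<close>

text \<open>Units are extensional functions on \<open>{0..}\<close>, so that equality of units ignores negative times.\<close>

definition units :: "('b::unital_cstar_algebra, 'e) prodsys \<Rightarrow> (real \<Rightarrow> 'e) set"
  where "units P = {u \<in> (\<Pi>\<^sub>E t\<in>{0..}. car (fib P t)).
    u 0 = emb P 1 \<and> (\<forall>t\<ge>0. \<forall>s\<ge>0. tens P t s (u t) (u s) = u (t + s))}"

text \<open>Cauchy-Schwarz and contractivity of the left action make the argument of \<open>Blinfun\<close> bounded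
  and linear when \<open>u t\<close> and \<open>v t\<close> lie in the fibre. It is even complex linear; bounded complex linear
  operators have the same norm in \<open>'b \<Rightarrow>\<^sub>L 'b\<close>, the library's space of bounded real linear operators.\<close>

definition kernel :: "('b::unital_cstar_algebra, 'e) prodsys \<Rightarrow> (real \<Rightarrow> 'e) \<Rightarrow> (real \<Rightarrow> 'e) \<Rightarrow> real \<Rightarrow> 'b \<Rightarrow>\<^sub>L 'b"
  where "kernel P u v t = Blinfun (\<lambda>b. ip (fib P t) (u t) (lact (fib P t) b (v t)))"

definition continuous_unit_set :: "('b::unital_cstar_algebra, 'e) prodsys \<Rightarrow> (real \<Rightarrow> 'e) set \<Rightarrow> bool"
  where "continuous_unit_set P S \<longleftrightarrow>
    S \<subseteq> units P \<and> (\<forall>\<xi>\<in>S. \<forall>\<eta>\<in>S. continuous_on {0..} (kernel P \<xi> \<eta>))"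

definition continuous_unit :: "('b::unital_cstar_algebra, 'e) prodsys \<Rightarrow> (real \<Rightarrow> 'e) \<Rightarrow> bool"
  where "continuous_unit P u \<longleftrightarrow> continuous_unit_set P {u}"

definition gen :: "('b::unital_cstar_algebra, 'e) prodsys \<Rightarrow> (real \<Rightarrow> 'e) \<Rightarrow> (real \<Rightarrow> 'e) \<Rightarrow> 'b \<Rightarrow>\<^sub>L 'b"
  where "gen P u v = vector_derivative (kernel P u v) (at 0 within {0..})"

definition max_units :: "('b::unital_cstar_algebra, 'e) prodsys \<Rightarrow> (real \<Rightarrow> 'e) \<Rightarrow> (real \<Rightarrow> 'e) set"
  where "max_units P \<omega> = {x. continuous_unit P x \<and> continuous_unit_set P {x, \<omega>}}"


section \<open>The bimodule of units\<close>

definition hlim :: "('b::unital_cstar_algebra, 'e::ab_group_add) bimodule \<Rightarrow> (nat \<Rightarrow> 'e) \<Rightarrow> 'e"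
  where "hlim M X = (THE z. z \<in> car M \<and> (\<lambda>n. hnorm M (X n - z)) \<longlonglongrightarrow> 0)"

text \<open>For \<open>y\<close> in the fibre at \<open>s\<close>, \<open>tpow P s y m\<close> is the \<open>m\<close>-fold tensor power of \<open>y\<close> in the fibre
  at \<open>real m * s\<close>.\<close>

primrec tpow :: "('b::unital_cstar_algebra, 'e) prodsys \<Rightarrow> real \<Rightarrow> 'e \<Rightarrow> nat \<Rightarrow> 'e"
  where
    "tpow P s y 0 = emb P 1"
  | "tpow P s y (Suc m) = tens P (real m * s) s (tpow P s y m) y"

definition limit_unit :: "('b::unital_cstar_algebra, 'e::ab_group_add) prodsys \<Rightarrow> (real \<Rightarrow> 'e) \<Rightarrow> real \<Rightarrow> 'e"
  where "limit_unit P y =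
    (\<lambda>t\<in>{0..}. hlim (fib P t) (\<lambda>m. tpow P (t / real m) (y (t / real m)) m))"

text \<open>\<open>lbox P [(\<kappa>\<^sub>1, x\<^sub>1), \<dots>, (\<kappa>\<^sub>n, x\<^sub>n)]\<close> is \<open>\<kappa>\<^sub>1 x\<^sub>1 \<boxplus> \<dots> \<boxplus> \<kappa>\<^sub>n x\<^sub>n\<close>, and \<open>rbox\<close> is the version with
  the coefficients on the right; both are meant for coefficients with sum \<open>1\<close>.\<close>

definition lbox :: "('b::unital_cstar_algebra, 'e::ab_group_add) prodsys \<Rightarrow> ('b \<times> (real \<Rightarrow> 'e)) list \<Rightarrow> real \<Rightarrow> 'e"
  where "lbox P ps = limit_unit P (\<lambda>s. \<Sum>(\<kappa>, x)\<leftarrow>ps. lact (fib P s) \<kappa> (x s))"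

definition rbox :: "('b::unital_cstar_algebra, 'e::ab_group_add) prodsys \<Rightarrow> ((real \<Rightarrow> 'e) \<times> 'b) list \<Rightarrow> real \<Rightarrow> 'e"
  where "rbox P ps = limit_unit P (\<lambda>s. \<Sum>(x, \<kappa>)\<leftarrow>ps. ract (fib P s) (x s) \<kappa>)"

definition unit_exp :: "('b::unital_cstar_algebra, 'e::ab_group_add) prodsys \<Rightarrow> (real \<Rightarrow> 'e) \<Rightarrow> 'b \<Rightarrow> real \<Rightarrow> 'e"
  where "unit_exp P x \<beta> = limit_unit P (\<lambda>s. ract (fib P s) (x s) (exp (s *\<^sub>R \<beta>)))"

definition unit_approx :: "('b::unital_cstar_algebra, 'e::ab_group_add) prodsys \<Rightarrow> (real \<Rightarrow> 'e) \<Rightarrow> (real \<Rightarrow> 'e) \<Rightarrow> bool"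
  where "unit_approx P x y \<longleftrightarrow> (\<exists>\<beta>. x = unit_exp P y \<beta>)"

definition uadd :: "('b::unital_cstar_algebra, 'e::ab_group_add) prodsys \<Rightarrow> (real \<Rightarrow> 'e) \<Rightarrow> (real \<Rightarrow> 'e) \<Rightarrow> (real \<Rightarrow> 'e) \<Rightarrow> real \<Rightarrow> 'e"
  where "uadd P \<omega> x y = lbox P [(1, x), (1, y), (-1, \<omega>)]"

definition uneg :: "('b::unital_cstar_algebra, 'e::ab_group_add) prodsys \<Rightarrow> (real \<Rightarrow> 'e) \<Rightarrow> (real \<Rightarrow> 'e) \<Rightarrow> real \<Rightarrow> 'e"
  where "uneg P \<omega> x = lbox P [(2, \<omega>), (-1, x)]"

definition udiff :: "('b::unital_cstar_algebra, 'e::ab_group_add) prodsys \<Rightarrow> (real \<Rightarrow> 'e) \<Rightarrow> (real \<Rightarrow> 'e) \<Rightarrow> (real \<Rightarrow> 'e) \<Rightarrow> real \<Rightarrow> 'e"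
  where "udiff P \<omega> x y = uadd P \<omega> x (uneg P \<omega> y)"

definition ulact :: "('b::unital_cstar_algebra, 'e::ab_group_add) prodsys \<Rightarrow> (real \<Rightarrow> 'e) \<Rightarrow> 'b \<Rightarrow> (real \<Rightarrow> 'e) \<Rightarrow> real \<Rightarrow> 'e"
  where "ulact P \<omega> b x = lbox P [(b, x), (1 - b, \<omega>)]"

definition uract :: "('b::unital_cstar_algebra, 'e::ab_group_add) prodsys \<Rightarrow> (real \<Rightarrow> 'e) \<Rightarrow> (real \<Rightarrow> 'e) \<Rightarrow> 'b \<Rightarrow> real \<Rightarrow> 'e"
  where "uract P \<omega> x b = rbox P [(x, b), (\<omega>, 1 - b)]"

definition uscale :: "('b::unital_cstar_algebra, 'e::ab_group_add) prodsys \<Rightarrow> (real \<Rightarrow> 'e) \<Rightarrow> complex \<Rightarrow> (real \<Rightarrow> 'e) \<Rightarrow> real \<Rightarrow> 'e"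
  where "uscale P \<omega> \<alpha> x = ulact P \<omega> (\<alpha> *\<^sub>C 1) x"

definition unit_form :: "('b::unital_cstar_algebra, 'e) prodsys \<Rightarrow> (real \<Rightarrow> 'e) \<Rightarrow> 'b \<Rightarrow> (real \<Rightarrow> 'e) \<Rightarrow> (real \<Rightarrow> 'e) \<Rightarrow> 'b"
  where "unit_form P \<omega> b x y = blinfun_apply (gen P x y - gen P x \<omega> - gen P \<omega> y + gen P \<omega> \<omega>) b"

end

theory Submission
  imports Defs
begin

text \<open>All properties are read off from the generators, since
  \<open>(gen P x x - gen P x \<omega> - gen P \<omega> x + gen P \<omega> \<omega>) b\<close> is the limit of
  \<open>ip (x t - \<omega> t) (b (x t - \<omega> t)) / t\<close> as \<open>t\<close> tends to \<open>0\<close>; positivity survives this limit because the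
  positive cone of a C*-algebra is closed. What remains is that the module operations lead back into
  \<open>max_units P \<omega>\<close> and act on generators by the expected formulas. Let \<open>y s\<close> be a combination of units.
  For a unit \<open>x\<close>, the operator \<open>b \<mapsto> ip (x t) (b (y s\<^sub>1 \<otimes> \<dots> \<otimes> y s\<^sub>n))\<close> with \<open>t = s\<^sub>1 + \<dots> + s\<^sub>n\<close> is a product
  of operators close to the identity, hence agrees with \<open>b \<mapsto> ip (x t) (b (y t))\<close> up to \<open>o(t)\<close>. As \<open>y t\<close> is
  a combination of such \<open>x t\<close>, it is close enough to \<open>y s\<^sub>1 \<otimes> \<dots> \<otimes> y s\<^sub>n\<close> for the products of \<open>y\<close> along
  partitions to form a Cauchy net under refinement. Working with arbitrary partitions instead of
  uniform ones makes the multiplicativity of the limit evident.\<close>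

section \<open>Positivity in C*-algebras\<close>

text \<open>The obstacle is the passage from kernels to norms. If two kernels agree up to o(t), the
  vectors behind them are only within o(sqrt t) of each other, and such errors do not stay small
  when added over many short blocks. Hence nothing is compared vector by vector. The kernel of a
  tensor product is the composition of the kernels of its factors, so o(t) errors add up to o(1)
  along a partition, and the square root is taken once, for the whole product.

  The order of the algebra is defined by the elements \<open>star c * c\<close>, and that sums of
  such elements are again of this form, which Cauchy-Schwarz already uses, rests on Kaplansky's
  theorem. The cone is therefore studied first as the set of hermitian squares, with roots from a
  power series.

  Generators are computed in the second argument only. The first one follows by taking adjoints,
  since a positive \<open>b\<close> is hermitian. As \<open>gen\<close> is a
  \<open>vector_derivative\<close>, differentiability of norm continuous semigroups has to be shown
  before any formula for it makes sense.\<close>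

lemma star_zero [simp]: "star (0::'b::unital_cstar_algebra) = 0"
  using star_add[of "0::'b" 0] by simp

lemma star_minus: "star (- a :: 'b::unital_cstar_algebra) = - star a"
  using star_add[of a "- a"] by (simp add: eq_neg_iff_add_eq_0 add.commute)

lemma star_diff: "star (a - b :: 'b::unital_cstar_algebra) = star a - star b"
  using star_add[of a "- b"] by (simp add: star_minus)

lemma star_scaleR: "star (r *\<^sub>R a :: 'b::unital_cstar_algebra) = r *\<^sub>R star a"
  by (metis complex_cnj_complex_of_real scaleC_of_real star_scaleC)

lemma star_one [simp]: "star (1::'b::unital_cstar_algebra) = 1"
  by (metis mult.right_neutral star_mult star_star)

lemma norm_star [simp]: "norm (star a) = norm (a::'b::unital_cstar_algebra)"
proof -
  have *: "norm a \<le> norm (star a)" for a :: 'b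
  proof (cases "a = 0")
    case False
    have "norm a * norm a \<le> norm (star a) * norm a"
      using norm_mult_ineq[of "star a" a] by (simp add: cstar_identity power2_eq_square)
    with False show ?thesis by simp
  qed simp
  show ?thesis using *[of a] *[of "star a"] by (simp add: star_star)
qed

lemma bounded_linear_star: "bounded_linear (star :: 'b::unital_cstar_algebra \<Rightarrow> 'b)"
  by (rule bounded_linear_intro[of _ 1]) (simp_all add: star_add star_scaleR)

lemma star_power: "star (a ^ n) = star (a::'b::unital_cstar_algebra) ^ n"
  by (induction n) (simp_all add: star_mult power_commutes)

lemma scaleC_minus_left: "(- \<alpha>) *\<^sub>C (a::'b::unital_cstar_algebra) = - (\<alpha> *\<^sub>C a)"
  by (metis (no_types, opaque_lifting) add.right_inverse add_eq_0_iff2 mult_zero_left norm_eq_zero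
      norm_scaleC norm_zero scaleC_add_left)

lemma scaleC_one [simp]: "1 *\<^sub>C (a::'b::unital_cstar_algebra) = a"
  using scaleC_of_real[of 1 a] by simp

lemma scaleC_minus_right: "\<alpha> *\<^sub>C (- a::'b::unital_cstar_algebra) = - (\<alpha> *\<^sub>C a)"
  by (metis (no_types, opaque_lifting) mult.commute mult_minus1 scaleC_minus_left scaleC_one scaleC_scaleC)

lemma scaleC_diff_right: "\<alpha> *\<^sub>C (a - b::'b::unital_cstar_algebra) = \<alpha> *\<^sub>C a - \<alpha> *\<^sub>C b"
  by (metis diff_conv_add_uminus scaleC_add_right scaleC_minus_right)

lemma norm_hermitian_square:
  "star u = u \<Longrightarrow> norm (u * u) = (norm (u::'b::unital_cstar_algebra))\<^sup>2"
  using cstar_identity[of u] by simp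

text \<open>In the recursion for the coefficients of exponent -1/2 every factor
  \<open>- 1/2 - real k\<close> is negative, so the signs alternate; absorption carries this over to
  exponent 1/2.\<close>

lemma gbinomial_half_alternating:
  "(- 1) ^ Suc k * ((1/2 :: real) gchoose Suc k) \<le> 0" "(- 1) ^ k * ((- 1/2 :: real) gchoose k) \<ge> 0"
proof -
  show *: "(- 1) ^ k * ((- 1/2 :: real) gchoose k) \<ge> 0" for k
  proof (induction k)
    case (Suc k)
    have "real (Suc k) * ((- 1/2 :: real) gchoose Suc k) = (- 1/2 - real k) * ((- 1/2) gchoose k)"
      using gbinomial_mult_1[of "-1/2::real" k] by (simp add: algebra_simps)
    then have eq: "((- 1/2 :: real) gchoose Suc k) = (- 1/2 - real k) / real (Suc k) * ((- 1/2) gchoose k)"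
      by (simp add: field_simps)
    have "(- 1) ^ Suc k * ((- 1/2 :: real) gchoose Suc k)
        = (1/2 + real k) / real (Suc k) * ((- 1) ^ k * ((- 1/2 :: real) gchoose k))"
      unfolding eq by (simp add: field_simps)
    with Suc show ?case by simp
  qed simp
  have "((1/2 :: real) gchoose Suc k) = (1/2) / real (Suc k) * ((- 1/2) gchoose k)"
    using gbinomial_absorption'[of "Suc k" "1/2::real"] by simp
  then have "(- 1) ^ Suc k * ((1/2 :: real) gchoose Suc k)
      = - ((1/2) / real (Suc k) * ((- 1) ^ k * ((- 1/2) gchoose k)))"
    by simp
  with *[of k] show "(- 1) ^ Suc k * ((1/2 :: real) gchoose Suc k) \<le> 0" by simp
qed

text \<open>All terms but the constant one in the series of sqrt (1 - x) are nonpositive. The sum of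
  absolute values is thus 2 minus a partial sum at x = 1, which has the closed form
  \<open>(- 1) ^ n * ((- 1/2) gchoose n)\<close> and is nonnegative.\<close>

lemma sum_abs_gbinomial_half_le: "(\<Sum>k<n. \<bar>(1/2 :: real) gchoose k\<bar>) \<le> 2"
proof -
  \<comment> \<open>At k = 0 the signed coefficient is 1, and 2 - 1 restores its absolute
    value.\<close>
  have abs: "\<bar>(1/2 :: real) gchoose k\<bar> = (if k = 0 then 2 else 0) - ((1/2) gchoose k) * (- 1) ^ k" for k
  proof (cases k)
    case (Suc j)
    then show ?thesis using gbinomial_half_alternating(1)[of j]
      by (cases "even j") (auto simp: mult.commute)
  qed simp
  have "(\<Sum>k<n. \<bar>(1/2 :: real) gchoose k\<bar>) \<le> (\<Sum>k\<le>n. \<bar>(1/2 :: real) gchoose k\<bar>)"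
    by (rule sum_mono2) auto
  also have "\<dots> = 2 - (- 1) ^ n * ((- 1/2) gchoose n)"
    using gbinomial_sum_lower_neg[of "1/2::real" n]
    unfolding abs sum_subtractf by (simp add: sum.delta)
  also have "\<dots> \<le> 2" using gbinomial_half_alternating(2)[of n] by simp
  finally show ?thesis .
qed

lemma summable_abs_gbinomial_half: "summable (\<lambda>k. \<bar>(1/2 :: real) gchoose k\<bar>)"
  by (rule summableI_nonneg_bounded[OF _ sum_abs_gbinomial_half_le]) simp

lemma suminf_abs_gbinomial_half_le: "(\<Sum>k. \<bar>(1/2 :: real) gchoose k\<bar>) \<le> 2"
  by (rule suminf_le_const[OF summable_abs_gbinomial_half sum_abs_gbinomial_half_le])

text \<open>The binomial series for the square root converges absolutely on the closed unit ball.\<close>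

lemma hermitian_sqrt_one_plus:
  fixes x :: "'b::unital_cstar_algebra"
  assumes "star x = x" "norm x \<le> 1"
  shows "\<exists>s. star s = s \<and> norm (1 - s) \<le> 1 \<and> s * s = 1 + x \<and> (\<forall>y. y * x = x * y \<longrightarrow> y * s = s * y)"
proof -
  define c where "c n = ((1/2 :: real) gchoose n) *\<^sub>R x ^ n" for n
  have nc: "norm (c n) \<le> \<bar>(1/2 :: real) gchoose n\<bar>" for n
  proof -
    have "norm (x ^ n) \<le> 1"
      by (rule order_trans[OF norm_power_ineq]) (simp add: assms(2) power_le_one)
    then show ?thesis unfolding c_def by (simp add: mult_left_le)
  qed
  then have ns: "summable (\<lambda>n. norm (c n))"
    by (intro summable_comparison_test'[OF summable_abs_gbinomial_half]) simp
  then have s: "summable c" by (rule summable_norm_cancel)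
  define S where "S = suminf c"
  have "norm (1 - S) \<le> 1"
  proof -
    have "1 - S = - (\<Sum>n. c (Suc n))"
      using suminf_split_head[OF s] by (simp add: S_def c_def)
    then have "norm (1 - S) \<le> (\<Sum>n. norm (c (Suc n)))"
      using summable_norm[of "\<lambda>n. c (Suc n)"] ns summable_Suc_iff[of "\<lambda>n. norm (c n)"] by simp
    also have "\<dots> \<le> (\<Sum>n. \<bar>(1/2 :: real) gchoose Suc n\<bar>)"
      by (intro suminf_le nc) (use ns summable_abs_gbinomial_half
          summable_Suc_iff[of "\<lambda>n. norm (c n)"] summable_Suc_iff[of "\<lambda>k. \<bar>(1/2 :: real) gchoose k\<bar>"] in simp_all)
    \<comment> \<open>The whole series of absolute values is at most 2, and its constant term is
      1.\<close>
    also have "\<dots> \<le> 1"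
      using suminf_split_head[OF summable_abs_gbinomial_half] suminf_abs_gbinomial_half_le by simp
    finally show ?thesis .
  qed
  moreover
  have "star S = S"
    unfolding S_def bounded_linear.suminf[OF bounded_linear_star s]
    by (simp add: c_def[abs_def] star_scaleR star_power assms(1))
  moreover have "S * S = 1 + x"
  proof -
    have "(\<Sum>i\<le>n. c i * c (n - i)) = ((1::real) gchoose n) *\<^sub>R x ^ n" for n
    proof -
      have "(\<Sum>i\<le>n. c i * c (n - i))
          = (\<Sum>i\<le>n. ((1/2 gchoose i) * (1/2 gchoose (n - i)) :: real) *\<^sub>R x ^ n)"
        by (rule sum.cong) (simp_all add: c_def power_add[symmetric])
      also have "\<dots> = (\<Sum>i\<in>{0..n}. (1/2 gchoose i) * (1/2 gchoose (n - i)) :: real) *\<^sub>R x ^ n"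
        by (simp add: scaleR_sum_left atLeast0AtMost)
      finally show ?thesis
        using gbinomial_Vandermonde[of "1/2::real" "1/2" n] by simp
    qed
    then have "S * S = (\<Sum>n. ((1::real) gchoose n) *\<^sub>R x ^ n)"
      using Cauchy_product[OF ns ns] by (simp add: S_def)
    also have "\<dots> = (\<Sum>n\<in>{0,1}. ((1::real) gchoose n) *\<^sub>R x ^ n)"
    proof (rule suminf_finite)
      fix n :: nat assume "n \<notin> {0, 1}"
      then have "(1::nat) choose n = 0" by simp
      then have "(1::real) gchoose n = 0" using binomial_gbinomial[of 1 n, where ?'a=real]
        by (metis of_nat_0 of_nat_1)
      then show "((1::real) gchoose n) *\<^sub>R x ^ n = 0" by simp
    qed simp
    finally show ?thesis by simp
  qed
  moreover have "y * S = S * y" if "y * x = x * y" for y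
  proof -
    have "y * x ^ n = x ^ n * y" for n
      by (induction n) (simp_all, metis mult.assoc that)
    then show ?thesis unfolding S_def suminf_mult[OF s, symmetric] suminf_mult2[OF s]
      by (simp add: c_def)
  qed
  ultimately show ?thesis by blast
qed

text \<open>That this cone consists of all elements \<open>star c * c\<close> is Kaplansky's theorem; no spectral theory
  is needed for it.\<close>

definition hpos :: "'b::unital_cstar_algebra \<Rightarrow> bool"
  where "hpos a \<longleftrightarrow> (\<exists>u. star u = u \<and> a = u * u)"

section \<open>Square roots and the norm test for positivity\<close>

lemma hpos_square: "star u = u \<Longrightarrow> hpos (u * u)"
  by (auto simp: hpos_def)

lemma hpos_star: "hpos a \<Longrightarrow> star a = a"
  by (auto simp: hpos_def star_mult)

text \<open>Writing \<open>a = R *\<^sub>R (1 + x)\<close> reduces this to the unit ball. The norm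
  condition is a test for positivity that avoids the spectrum: for hermitian \<open>a\<close> it
  says that the spectrum lies between 0 and 2 R.\<close>

lemma sqrt_of_norm_le:
  fixes a :: "'b::unital_cstar_algebra"
  assumes "star a = a" "norm (R *\<^sub>R 1 - a) \<le> R"
  shows "\<exists>s. star s = s \<and> norm (sqrt R *\<^sub>R 1 - s) \<le> sqrt R \<and> s * s = a \<and> (\<forall>y. y * a = a * y \<longrightarrow> y * s = s * y)"
proof (cases "R = 0")
  case True
  with assms have "a = 0" by simp
  then show ?thesis using True by (intro exI[of _ 0]) simp
next
  case False
  with assms(2) have R: "R > 0" using norm_ge_zero[of "R *\<^sub>R 1 - a"] by linarith
  define x where "x = (1 / R) *\<^sub>R a - 1"
  have "star x = x" by (simp add: x_def star_diff star_scaleR assms(1))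
  moreover have "x = (- 1 / R) *\<^sub>R (R *\<^sub>R 1 - a)"
    using R by (simp add: x_def algebra_simps)
  then have "norm x \<le> 1" using assms(2) R by (simp add: divide_le_eq)
  ultimately obtain s where s: "star s = s" "norm (1 - s) \<le> 1" "s * s = 1 + x"
      "\<And>y. y * x = x * y \<Longrightarrow> y * s = s * y"
    using hermitian_sqrt_one_plus by blast
  have "sqrt R *\<^sub>R 1 - sqrt R *\<^sub>R s = sqrt R *\<^sub>R (1 - s)" by (simp add: algebra_simps)
  then have "norm (sqrt R *\<^sub>R 1 - sqrt R *\<^sub>R s) \<le> sqrt R"
    using s(2) R by (simp add: mult_left_le)
  moreover have comm: "y * s = s * y" if "y * a = a * y" for y
    using s(4)[of y] that by (simp add: x_def algebra_simps)
  moreover have "R *\<^sub>R (1 + x) = a" using R by (simp add: x_def)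
  moreover have "(sqrt R *\<^sub>R s) * (sqrt R *\<^sub>R s) = R *\<^sub>R (s * s)" using R by simp
  then have "(sqrt R *\<^sub>R s) * (sqrt R *\<^sub>R s) = R *\<^sub>R (1 + x)" unfolding s(3) .
  moreover have "star (sqrt R *\<^sub>R s) = sqrt R *\<^sub>R s" by (simp add: star_scaleR s(1))
  moreover have "\<forall>y. y * a = a * y \<longrightarrow> y * (sqrt R *\<^sub>R s) = sqrt R *\<^sub>R s * y"
    using comm by simp
  ultimately show ?thesis by (intro exI[of _ "sqrt R *\<^sub>R s"]) metis
qed

lemma hposI_norm: "star a = a \<Longrightarrow> norm (R *\<^sub>R 1 - a) \<le> R \<Longrightarrow> hpos a"
  using sqrt_of_norm_le unfolding hpos_def by metis

lemma i_scaleC_i_scaleC: "\<i> *\<^sub>C \<i> *\<^sub>C (a::'b::unital_cstar_algebra) = - a"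
  by (simp add: scaleC_scaleC scaleC_minus_left)

text \<open>With \<open>w = s + \<i> *\<^sub>C t\<close> the sum of squares is
  \<open>star w * w\<close>, since commutation removes the cross terms, and \<open>s\<close> is the
  average of \<open>w\<close> and \<open>star w\<close>, which have equal norms. This stands in for
  monotonicity of the norm, which comes only later.\<close>

lemma norm_le_add_i:
  fixes s t :: "'b::unital_cstar_algebra"
  assumes "star s = s" "star t = t" "s * t = t * s"
  shows "(norm s)\<^sup>2 \<le> norm (s * s + t * t)" "(norm t)\<^sup>2 \<le> norm (s * s + t * t)"
proof -
  have *: "(norm s)\<^sup>2 \<le> norm (s * s + t * t)"
    if "star s = s" "star t = t" "s * t = t * s" for s t :: 'b
  proof -
    define w where "w = s + \<i> *\<^sub>C t"
    have w': "star w = s - \<i> *\<^sub>C t"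
      by (simp add: w_def star_add star_scaleC that scaleC_minus_left)
    have "star w * w = s * s + t * t"
      unfolding w' by (simp add: w_def algebra_simps mult_scaleC_left mult_scaleC_right that
          scaleC_diff_right i_scaleC_i_scaleC)
    then have nw: "(norm w)\<^sup>2 = norm (s * s + t * t)" using cstar_identity[of w] by simp
    have "w + star w = 2 *\<^sub>R s" unfolding w' by (simp add: w_def scaleR_2)
    then have "2 * norm s = norm (w + star w)" by simp
    also have "\<dots> \<le> 2 * norm w" using norm_triangle_ineq[of w "star w"] by simp
    finally have "norm s \<le> norm w" by simp
    then show ?thesis using nw by (metis norm_ge_zero power_mono)
  qed
  show "(norm s)\<^sup>2 \<le> norm (s * s + t * t)" using *[of s t] assms by simp
  show "(norm t)\<^sup>2 \<le> norm (s * s + t * t)" using *[of t s] assms by (simp add: add.commute)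
qed

text \<open>Converse of \<open>hposI_norm\<close>. After division by \<open>R\<close>, both
  \<open>a\<close> and its difference from 1 are squares of commuting hermitian elements
  \<open>s\<close> and \<open>t\<close>. These squares add up to 1, so \<open>norm_le_add_i\<close>
  bounds the second one by 1.\<close>

lemma norm_diff_hpos_le:
  fixes a :: "'b::unital_cstar_algebra"
  assumes "hpos a" "norm a \<le> R"
  shows "norm (R *\<^sub>R 1 - a) \<le> R"
proof (cases "R = 0")
  case True
  with assms show ?thesis by simp
next
  case False
  with assms have R: "R > 0" using norm_ge_zero[of a] by linarith
  obtain u where u: "star u = u" "a = u * u" using assms(1) by (auto simp: hpos_def)
  define x where "x = (- 1 / R) *\<^sub>R a"
  have "star x = x" using u by (simp add: x_def star_minus star_scaleR star_mult)
  moreover have "norm x \<le> 1" using R assms(2) by (simp add: x_def divide_le_eq)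
  ultimately obtain t where t: "star t = t" "t * t = 1 + x" "\<And>y. y * x = x * y \<Longrightarrow> y * t = t * y"
    using hermitian_sqrt_one_plus by blast
  define s where "s = (1 / sqrt R) *\<^sub>R u"
  have s: "star s = s" "s * s = - x" using R by (simp_all add: s_def star_scaleR u x_def)
  have "s * x = x * s" using R by (simp add: s_def x_def u mult.assoc)
  then have "s * t = t * s" by (rule t(3))
  then have "(norm t)\<^sup>2 \<le> norm (s * s + t * t)" using s(1) t(1) norm_le_add_i by blast
  also have "s * s + t * t = 1" by (simp add: s(2) t(2))
  finally have "norm (1 + x) \<le> 1" using norm_hermitian_square[OF t(1)] t(2) by simp
  moreover have "R *\<^sub>R 1 - a = R *\<^sub>R (1 + x)" using R by (simp add: x_def algebra_simps)
  ultimately show ?thesis using R by simp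
qed

text \<open>The root that witnesses \<open>hpos a\<close> is an arbitrary hermitian one. The root
  from the power series is itself positive and commutes with everything that commutes with
  \<open>a\<close>; the arguments about products below rely on this.\<close>

lemma hpos_sqrt:
  assumes "hpos (a::'b::unital_cstar_algebra)"
  shows "\<exists>s. star s = s \<and> hpos s \<and> s * s = a \<and> (\<forall>y. y * a = a * y \<longrightarrow> y * s = s * y)"
  using sqrt_of_norm_le[OF hpos_star[OF assms] norm_diff_hpos_le[OF assms order_refl]] hposI_norm
  by metis

text \<open>In the norm test the radii add, whereas a sum of two squares is not visibly a
  square.\<close>

lemma hpos_add: assumes "hpos (a::'b::unital_cstar_algebra)" "hpos b" shows "hpos (a + b)"
proof (rule hposI_norm)
  show "star (a + b) = a + b" using assms by (simp add: star_add hpos_star)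
  have "norm ((norm a *\<^sub>R 1 - a) + (norm b *\<^sub>R 1 - b)) \<le> norm a + norm b"
    by (rule norm_triangle_le) (intro add_mono norm_diff_hpos_le assms order_refl)
  then show "norm ((norm a + norm b) *\<^sub>R 1 - (a + b)) \<le> norm a + norm b"
    by (simp add: algebra_simps)
qed

lemma hpos_scaleR: assumes "hpos (a::'b::unital_cstar_algebra)" "r \<ge> 0" shows "hpos (r *\<^sub>R a)"
proof -
  obtain u where u: "star u = u" "a = u * u" using assms(1) by (auto simp: hpos_def)
  then have "hpos ((sqrt r *\<^sub>R u) * (sqrt r *\<^sub>R u))" by (intro hpos_square) (simp add: star_scaleR)
  with assms(2) u show ?thesis by simp
qed

lemma hpos_scaleR_one: "r \<ge> 0 \<Longrightarrow> hpos (r *\<^sub>R (1::'b::unital_cstar_algebra))"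
  using hpos_square[of 1] by (intro hpos_scaleR) simp_all

lemma hpos_norm_diff:
  assumes "star (a::'b::unital_cstar_algebra) = a" "norm a \<le> R" shows "hpos (R *\<^sub>R 1 - a)"
  by (rule hposI_norm[of _ R]) (simp_all add: star_diff star_scaleR assms)

lemma hpos_mult:
  assumes "hpos (a::'b::unital_cstar_algebra)" "hpos b" "a * b = b * a" shows "hpos (a * b)"
proof -
  obtain s where s: "star s = s" "s * s = a" "\<And>y. y * a = a * y \<Longrightarrow> y * s = s * y"
    using hpos_sqrt[OF assms(1)] by blast
  obtain t where t: "star t = t" "t * t = b" "\<And>y. y * b = b * y \<Longrightarrow> y * t = t * y"
    using hpos_sqrt[OF assms(2)] by blast
  have "b * s = s * b" using s(3)[of b] assms(3) by simp
  then have c: "s * t = t * s" using t(3)[of s] by simp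
  have "a * b = (s * t) * (s * t)" by (metis c mult.assoc s(2) t(2))
  moreover have "star (s * t) = s * t" by (simp add: star_mult s t c)
  ultimately show ?thesis using hpos_square by metis
qed

text \<open>A convergent sequence is bounded, so one radius \<open>R\<close> serves all its members,
  and the norm test with a fixed radius is a closed condition.\<close>

lemma hpos_closed: "closed (Collect (hpos :: 'b::unital_cstar_algebra \<Rightarrow> bool))"
proof (clarsimp simp: closed_sequential_limits)
  fix X :: "nat \<Rightarrow> 'b" and a
  assume X: "\<forall>n. hpos (X n)" "X \<longlonglongrightarrow> a"
  obtain R where R: "\<And>n. norm (X n) \<le> R"
    using convergent_imp_Bseq[of X] X(2) by (auto simp: convergent_def Bseq_def)
  show "hpos a"
  proof (rule hposI_norm)
    have "(\<lambda>n. star (X n)) \<longlonglongrightarrow> star a"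
      using X(2) bounded_linear.tendsto[OF bounded_linear_star] by blast
    then have "X \<longlonglongrightarrow> star a" using X(1) by (simp add: hpos_star)
    then show "star a = a" using X(2) LIMSEQ_unique by blast
    have "(\<lambda>n. norm (R *\<^sub>R 1 - X n)) \<longlonglongrightarrow> norm (R *\<^sub>R 1 - a)"
      by (intro tendsto_intros X)
    then show "norm (R *\<^sub>R 1 - a) \<le> R"
      by (rule LIMSEQ_le_const2) (use norm_diff_hpos_le X(1) R in blast)
  qed
qed

text \<open>The roots of \<open>p\<close> and of \<open>c *\<^sub>R 1 - p\<close> commute, and their
  squares add up to \<open>c *\<^sub>R 1\<close>, so that \<open>norm_le_add_i\<close>
  applies.\<close>

lemma hpos_norm_le:
  fixes p :: "'b::unital_cstar_algebra"
  assumes "hpos p" "hpos (c *\<^sub>R 1 - p)" "c \<ge> 0"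
  shows "norm p \<le> c"
proof -
  obtain s where s: "star s = s" "s * s = p" "\<And>y. y * p = p * y \<Longrightarrow> y * s = s * y"
    using hpos_sqrt[OF assms(1)] by blast
  obtain t where t: "star t = t" "t * t = c *\<^sub>R 1 - p"
      "\<And>y. y * (c *\<^sub>R 1 - p) = (c *\<^sub>R 1 - p) * y \<Longrightarrow> y * t = t * y"
    using hpos_sqrt[OF assms(2)] by blast
  have "s * p = p * s" by (metis s(2) mult.assoc)
  then have "s * t = t * s" by (intro t(3)) (simp add: algebra_simps)
  from norm_le_add_i(1)[OF s(1) t(1) this] show ?thesis
    using norm_hermitian_square[OF s(1)] assms(3) by (simp add: s(2) t(2))
qed

section \<open>Kaplansky's theorem\<close>

lemma hpos_add_star_swap: "hpos (star e * e + e * star (e::'b::unital_cstar_algebra))"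
proof -
  \<comment> \<open>\<open>u\<close> and \<open>v\<close> are twice the real and the imaginary part
    of \<open>e\<close>; their squares add up to twice the element in question.\<close>
  define u where "u = e + star e"
  define v where "v = \<i> *\<^sub>C (star e - e)"
  have "star u = u" by (simp add: u_def star_add star_star add.commute)
  moreover have "star v = v"
    by (simp add: v_def star_scaleC star_diff star_star scaleC_minus_left scaleC_diff_right)
  ultimately have "hpos ((1/2) *\<^sub>R (u * u + v * v))"
    by (intro hpos_scaleR hpos_add hpos_square) simp_all
  moreover have "v * v = - ((star e - e) * (star e - e))"
    unfolding v_def mult_scaleC_left mult_scaleC_right i_scaleC_i_scaleC ..
  then have "u * u + v * v = 2 *\<^sub>R (star e * e + e * star e)"
    by (simp add: u_def algebra_simps scaleR_2)
  ultimately show ?thesis by simp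
qed

text \<open>With \<open>p = - star d * d\<close> and \<open>q = d * star d\<close> both positive and of norm \<open>1\<close>, the element
  \<open>p * (1 + p)\<^sup>2 = - star d * (1 - q)\<^sup>2 * d\<close> has norm at most \<open>1\<close> but dominates \<open>2 * p\<^sup>2\<close>.\<close>

lemma hpos_minus_star_mult:
  fixes d :: "'b::unital_cstar_algebra"
  assumes "hpos (- (star d * d))"
  shows "d = 0"
proof (rule ccontr)
  assume d: "d \<noteq> 0"
  define e where "e = (1 / norm d) *\<^sub>R d"
  define p where "p = - (star e * e)"
  define q where "q = e * star e"
  have e: "norm e = 1" using d by (simp add: e_def)
  have "p = (1 / norm d)\<^sup>2 *\<^sub>R (- (star d * d))"
    by (simp add: p_def e_def star_scaleR power2_eq_square)
  then have p: "hpos p" using hpos_scaleR[OF assms, of "(1 / norm d)\<^sup>2"] by simp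
  have "q = p + (star e * e + e * star e)" by (simp add: p_def q_def)
  then have q: "hpos q" using hpos_add[OF p hpos_add_star_swap] by metis
  have np: "norm p = 1" using cstar_identity[of e] e by (simp add: p_def)
  have nq: "norm q = 1" using cstar_identity[of "star e"] e by (simp add: q_def star_star)
  define X where "X = p + 2 *\<^sub>R (p * p) + p * p * p"
  \<comment> \<open>Moving \<open>star e\<close> past \<open>q\<close> turns \<open>q\<close> into
    \<open>- p\<close>. This exhibits \<open>- X\<close> as a product of factors of norm at most
    1.\<close>
  have shift: "star e * (1 - q) = (1 + p) * star e" by (simp add: p_def q_def algebra_simps)
  have "star e * (1 - q) * ((1 - q) * e) = (1 + p) * ((star e * (1 - q)) * e)"
    by (metis shift mult.assoc)
  also have "\<dots> = (1 + p) * (1 + p) * (star e * e)"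
    by (simp only: shift) (simp only: mult.assoc)
  also have "\<dots> = - X" unfolding X_def p_def by (simp add: algebra_simps scaleR_2)
  finally have "norm X = norm (star e * (1 - q) * ((1 - q) * e))" by (metis norm_minus_cancel)
  also have "\<dots> \<le> (norm (star e) * norm (1 - q)) * (norm (1 - q) * norm e)"
    by (intro norm_mult_ineq[THEN order_trans] mult_mono) (simp_all add: norm_mult_ineq)
  also have "\<dots> \<le> 1"
    using norm_diff_hpos_le[OF q, of 1] nq e by (simp add: mult_le_one)
  finally have nX: "norm X \<le> 1" .
  have pp: "hpos (p * p)" and ppp: "hpos (p * p * p)"
    using p by (auto intro!: hpos_mult simp: mult.assoc)
  have "hpos X" unfolding X_def by (intro hpos_add p pp ppp hpos_scaleR) simp
  then have "hpos (1 *\<^sub>R 1 - X)" by (intro hpos_norm_diff nX hpos_star)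
  then have "hpos ((1 *\<^sub>R 1 - X) + (p + p * p * p))" by (intro hpos_add p ppp)
  then have "hpos (1 *\<^sub>R 1 - 2 *\<^sub>R (p * p))" by (simp add: X_def algebra_simps)
  then have "norm (2 *\<^sub>R (p * p)) \<le> 1" by (intro hpos_norm_le hpos_scaleR pp) simp_all
  then show False using norm_hermitian_square[OF hpos_star[OF p]] np by simp
qed

text \<open>Neumann series: positivity of \<open>s\<close> gives
  \<open>norm (R *\<^sub>R 1 - s) \<le> R\<close>, and the shift by \<delta> makes the ratio
  \<open>R / (R + \<delta>)\<close> less than 1. The inverse is positive because it is the square of
  \<open>r * w\<close>, where \<open>w\<close> is a root of the shifted element.\<close>

lemma hpos_inverse:
  fixes s :: "'b::unital_cstar_algebra"
  assumes "hpos s" "\<delta> > 0"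
  shows "\<exists>r. hpos r \<and> r * (s + \<delta> *\<^sub>R 1) = 1 \<and> (\<forall>y. y * s = s * y \<longrightarrow> y * r = r * y)"
proof -
  define R where "R = norm s"
  define A where "A = s + \<delta> *\<^sub>R 1"
  define x where "x = (1 / (R + \<delta>)) *\<^sub>R (R *\<^sub>R 1 - s)"
  have R: "R \<ge> 0" "R + \<delta> > 0" using assms(2) by (simp_all add: R_def add_nonneg_pos)
  have "norm x \<le> R / (R + \<delta>)"
    using norm_diff_hpos_le[OF assms(1), of R] R by (simp add: x_def R_def divide_right_mono)
  also have "\<dots> < 1" using assms(2) R by simp
  finally have sx: "summable (\<lambda>n. x ^ n)" by (rule complete_algebra_summable_geometric)
  define g where "g = (\<Sum>n. x ^ n)"
  have g1: "g = 1 + (\<Sum>n. x ^ Suc n)" using suminf_split_head[OF sx] by (simp add: g_def)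
  have "x * g = (\<Sum>n. x ^ Suc n)" unfolding g_def suminf_mult[OF sx, symmetric] by simp
  with g1 have xg: "(1 - x) * g = 1" by (simp add: algebra_simps)
  have "g * x = (\<Sum>n. x ^ Suc n)" unfolding g_def suminf_mult2[OF sx] by (simp add: power_commutes)
  with g1 have gx: "g * (1 - x) = 1" by (simp add: algebra_simps)
  have "(R + \<delta>) *\<^sub>R x = R *\<^sub>R 1 - s" using R by (simp add: x_def)
  then have A: "A = (R + \<delta>) *\<^sub>R (1 - x)" by (simp add: A_def algebra_simps)
  define r where "r = (1 / (R + \<delta>)) *\<^sub>R g"
  have rA: "r * A = 1" "A * r = 1" using R xg gx by (simp_all add: A r_def)
  have comm: "y * r = r * y" if "y * A = A * y" for y
  proof -
    have "y * r = r * (A * y) * r" by (simp add: rA mult.assoc[symmetric])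
    also have "\<dots> = r * y" by (simp add: that[symmetric] rA mult.assoc)
    finally show ?thesis .
  qed
  have pA: "hpos A" unfolding A_def using assms by (intro hpos_add hpos_scaleR_one) simp_all
  obtain w where w: "star w = w" "w * w = A" "\<And>y. y * A = A * y \<Longrightarrow> y * w = w * y"
    using hpos_sqrt[OF pA] by blast
  have rw: "w * r = r * w" by (metis comm mult.assoc w(2))
  have "star r * A = 1" using rA(2) hpos_star[OF pA] by (metis star_mult star_one)
  then have "star r = r" by (metis mult.assoc mult_1_right mult_1_left rA(2))
  then have "hpos ((r * w) * (r * w))" by (intro hpos_square) (simp add: star_mult w rw)
  also have "(r * w) * (r * w) = r * A * r" by (metis mult.assoc rw w(2))
  finally have "hpos r" by (simp add: rA)
  moreover have "y * r = r * y" if "y * s = s * y" for y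
    by (rule comm) (simp add: A_def algebra_simps that)
  ultimately show ?thesis using rA(1) unfolding A_def by blast
qed

text \<open>\<open>s\<close> is the absolute value of \<open>h\<close>. With
  \<open>k = s - h\<close> one has \<open>k * k = 2 *\<^sub>R (s * k)\<close>, so twice
  \<open>(s + \<delta> *\<^sub>R 1) * (k + \<delta> *\<^sub>R 1)\<close> is a sum of visibly
  positive terms, the element \<open>X\<close> below. Multiplying by the inverse of the first factor
  and letting \<delta> tend to 0 makes \<open>k\<close> positive.\<close>

lemma hpos_absolute_value:
  fixes h :: "'b::unital_cstar_algebra"
  assumes "star h = h"
  shows "\<exists>s. hpos s \<and> s * s = h * h \<and> s * h = h * s \<and> hpos (s - h)"
proof -
  obtain s where s: "hpos s" "s * s = h * h" "\<And>y. y * (h * h) = (h * h) * y \<Longrightarrow> y * s = s * y"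
    using hpos_sqrt[OF hpos_square[OF assms]] by blast
  have sh: "s * h = h * s" using s(3)[of h] by (simp add: mult.assoc)
  define k where "k = s - h"
  have ks: "k * s = s * k" by (simp add: k_def algebra_simps sh)
  have kk: "k * k = 2 *\<^sub>R (s * k)" by (simp add: k_def algebra_simps sh s(2) scaleR_2)
  have sk: "star k = k" by (simp add: k_def star_diff hpos_star s assms)
  have pos: "hpos (k + \<delta> *\<^sub>R 1)" if "\<delta> > 0" for \<delta>
  proof -
    obtain r where r: "hpos r" "r * (s + \<delta> *\<^sub>R 1) = 1" "\<And>y. y * s = s * y \<Longrightarrow> y * r = r * y"
      using hpos_inverse[OF s(1), of \<delta>] \<open>\<delta> > 0\<close> by blast
    define X where "X = (k + \<delta> *\<^sub>R 1) * (k + \<delta> *\<^sub>R 1) + (\<delta> + \<delta>) *\<^sub>R s + \<delta>\<^sup>2 *\<^sub>R 1"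
    have "hpos X" unfolding X_def using that
      by (intro hpos_add hpos_square hpos_scaleR hpos_scaleR_one s(1))
        (simp_all add: star_add star_scaleR sk)
    moreover have "r * k = k * r" "r * s = s * r" using r(3) ks by simp_all
    moreover from this have "r * (k * k) = k * (k * r)" by (metis mult.assoc)
    ultimately have "hpos X" "r * X = X * r" by (simp_all add: X_def algebra_simps)
    then have "hpos ((1/2) *\<^sub>R (r * X))" using r(1) by (intro hpos_scaleR hpos_mult) simp_all
    moreover have d2: "(\<delta> * 2) *\<^sub>R y = \<delta> *\<^sub>R y + \<delta> *\<^sub>R y"
        "(\<delta> * (\<delta> * 2)) *\<^sub>R y = (\<delta> * \<delta>) *\<^sub>R y + (\<delta> * \<delta>) *\<^sub>R y" for y :: 'b
      by (simp_all add: distrib_left flip: scaleR_add_left)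
    have "X = 2 *\<^sub>R ((s + \<delta> *\<^sub>R 1) * (k + \<delta> *\<^sub>R 1))"
      by (simp add: X_def algebra_simps kk scaleR_2 power2_eq_square) (simp add: d2)
    then have "r * X = 2 *\<^sub>R (r * (s + \<delta> *\<^sub>R 1) * (k + \<delta> *\<^sub>R 1))" by (simp add: mult.assoc)
    ultimately show ?thesis by (simp add: r(2))
  qed
  have "(\<lambda>n. k + inverse (real (Suc n)) *\<^sub>R 1) \<longlonglongrightarrow> k + 0 *\<^sub>R 1"
    by (intro tendsto_intros LIMSEQ_inverse_real_of_nat)
  moreover have "k + inverse (real (Suc n)) *\<^sub>R 1 \<in> Collect hpos" for n
    using pos[of "inverse (real (Suc n))"] by simp
  ultimately have "k + 0 *\<^sub>R 1 \<in> Collect hpos"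
    by (rule closed_sequentially[OF hpos_closed, rotated])
  then have "hpos k" by simp
  then show ?thesis using s(1,2) sh unfolding k_def by blast
qed

text \<open>For \<open>h = star c * c\<close> the element \<open>k = s - h\<close> is twice the
  negative part of \<open>h\<close>. Conjugating \<open>h\<close> by \<open>k\<close> gives
  \<open>- (s * (k * k))\<close>, so that \<open>- (star (c * k) * (c * k))\<close> is positive.
  This forces \<open>c * k = 0\<close>, and then \<open>h * k\<close>, \<open>s * k\<close> and
  finally \<open>k * k\<close> vanish.\<close>

lemma hpos_star_mult: "hpos (star c * (c::'b::unital_cstar_algebra))"
proof -
  define h where "h = star c * c"
  have h: "star h = h" by (simp add: h_def star_mult star_star)
  obtain s where s: "hpos s" "s * s = h * h" "s * h = h * s" "hpos (s - h)"
    using hpos_absolute_value[OF h] by blast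
  define k where "k = s - h"
  have k: "hpos k" "star k = k" "s * k = k * s" using s by (simp_all add: k_def hpos_star algebra_simps)
  have hk: "h * k = k * h" "h * k = - (s * k)" by (simp_all add: k_def algebra_simps s(2,3))
  have "star (c * k) * (c * k) = k * h * k" by (simp add: star_mult k h_def mult.assoc)
  also have "\<dots> = - (s * (k * k))" by (simp add: hk(1)[symmetric] hk(2) mult.assoc)
  finally have eq: "s * (k * k) = - (star (c * k) * (c * k))" by simp
  have "hpos (s * (k * k))"
    by (intro hpos_mult s hpos_square k) (metis k(3) mult.assoc)
  then have "c * k = 0" unfolding eq by (rule hpos_minus_star_mult)
  then have "h * k = 0" by (simp add: h_def mult.assoc)
  moreover have "k * k = s * k - h * k" by (simp add: k_def left_diff_distrib)
  ultimately have "k * k = 0" using hk(2) by simp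
  then have "k = 0" using norm_hermitian_square[OF k(2)] by simp
  then show ?thesis using s(1) by (simp add: k_def h_def)
qed

lemma cstar_positive_iff_hpos: "cstar_positive a \<longleftrightarrow> hpos a"
  unfolding cstar_positive_def using hpos_star_mult hpos_def by metis

lemma cstar_positive_norm_mono:
  assumes "cstar_positive (a::'b::unital_cstar_algebra)" "cstar_positive (b - a)"
  shows "norm a \<le> norm b"
proof (rule hpos_norm_le)
  have ab: "hpos a" "hpos (b - a)" using assms by (simp_all add: cstar_positive_iff_hpos)
  then have "hpos (a + (b - a))" by (rule hpos_add)
  then have "hpos b" by simp
  then have "hpos ((norm b *\<^sub>R 1 - b) + (b - a))" by (intro hpos_add hpos_norm_diff hpos_star ab) simp_all
  then show "hpos (norm b *\<^sub>R 1 - a)" by simp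
  show "hpos a" by fact
qed simp

lemma cstar_positive_conj:
  "cstar_positive (a::'b::unital_cstar_algebra) \<Longrightarrow> cstar_positive (star d * a * d)"
  unfolding cstar_positive_def by (metis mult.assoc star_mult)

section \<open>Hilbert bimodules\<close>

text \<open>Although \<open>star\<close> is antilinear, it is bounded and real linear and so belongs
  to \<open>'b \<Rightarrow>\<^sub>L 'b\<close>. Conjugation with it is the effect on a kernel of
  exchanging its two vectors (\<open>Kop_flip\<close>).\<close>

definition blinfun_conj :: "('b::unital_cstar_algebra \<Rightarrow>\<^sub>L 'b) \<Rightarrow> ('b \<Rightarrow>\<^sub>L 'b)"
  where "blinfun_conj A = Blinfun star o\<^sub>L (A o\<^sub>L Blinfun star)"

lemma blinfun_conj_apply [simp]: "blinfun_conj A b = star (blinfun_apply A (star b))"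
  by (simp add: blinfun_conj_def bounded_linear_Blinfun_apply bounded_linear_star)

lemma blinfun_conj_id [simp]: "blinfun_conj id_blinfun = id_blinfun"
  by (rule blinfun_eqI) (simp add: star_star)

lemma bounded_linear_blinfun_conj: "bounded_linear blinfun_conj"
proof (rule bounded_linear_intro[of _ 1])
  show "blinfun_conj (A + B) = blinfun_conj A + blinfun_conj B" for A B :: "'a \<Rightarrow>\<^sub>L 'a"
    by (rule blinfun_eqI) (simp add: blinfun.add_left star_add)
  show "blinfun_conj (r *\<^sub>R A) = r *\<^sub>R blinfun_conj A" for r and A :: "'a \<Rightarrow>\<^sub>L 'a"
    by (rule blinfun_eqI) (simp add: blinfun.scaleR_left star_scaleR)
  show "norm (blinfun_conj A) \<le> norm A * 1" for A :: "'a \<Rightarrow>\<^sub>L 'a"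
    by (rule norm_blinfun_bound) (use norm_blinfun[of A "star _"] in simp_all)
qed

text \<open>Unlike \<open>kernel\<close> this takes two vectors of one module, because products
  along partitions are not values of units.\<close>

definition Kop :: "('b::unital_cstar_algebra, 'e) bimodule \<Rightarrow> 'e \<Rightarrow> 'e \<Rightarrow> 'b \<Rightarrow>\<^sub>L 'b"
  where "Kop M x y = Blinfun (\<lambda>b. ip M x (lact M b y))"

lemma hnorm_nonneg [simp]: "hnorm M x \<ge> 0"
  by (simp add: hnorm_def)

lemma hnorm_power2: "(hnorm M x)\<^sup>2 = norm (ip M x x)"
  by (simp add: hnorm_def)

context hilbert_bimodule
begin

lemma diff_closed: "x \<in> car M \<Longrightarrow> y \<in> car M \<Longrightarrow> x - y \<in> car M"
  using add_closed[of x "- y"] uminus_closed by simp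

lemmas closed_rules = zero_closed add_closed uminus_closed diff_closed ract_closed lact_closed

lemma sum_list_closed: "(\<And>x. x \<in> set xs \<Longrightarrow> f x \<in> car M) \<Longrightarrow> (\<Sum>x\<leftarrow>xs. f x) \<in> car M"
  by (induction xs) (auto intro: zero_closed add_closed)

lemma ip_zero_right: "x \<in> car M \<Longrightarrow> ip M x 0 = 0"
  using ip_add[of x 0 0] zero_closed by simp

lemma ip_minus_right: "x \<in> car M \<Longrightarrow> y \<in> car M \<Longrightarrow> ip M x (- y) = - ip M x y"
  using ip_add[of x y "- y"] uminus_closed ip_zero_right by (simp add: eq_neg_iff_add_eq_0 add.commute)

lemma ip_diff_right: "x \<in> car M \<Longrightarrow> y \<in> car M \<Longrightarrow> z \<in> car M \<Longrightarrow> ip M x (y - z) = ip M x y - ip M x z"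
  using ip_add[of x y "- z"] uminus_closed ip_minus_right by simp

lemma ip_add_left: "x \<in> car M \<Longrightarrow> y \<in> car M \<Longrightarrow> z \<in> car M \<Longrightarrow> ip M (x + y) z = ip M x z + ip M y z"
  using ip_star[of "x + y" z] ip_star[of z x] ip_star[of z y]
  by (simp add: ip_add closed_rules star_add star_star)

lemma ip_diff_left: "x \<in> car M \<Longrightarrow> y \<in> car M \<Longrightarrow> z \<in> car M \<Longrightarrow> ip M (x - y) z = ip M x z - ip M y z"
  using ip_star[of "x - y" z] ip_star[of z x] ip_star[of z y]
  by (simp add: ip_diff_right closed_rules star_diff star_star)

lemma ip_zero_left: "x \<in> car M \<Longrightarrow> ip M 0 x = 0"
  using ip_diff_left[of 0 0 x] zero_closed by simp

lemma ip_ract_left: "x \<in> car M \<Longrightarrow> y \<in> car M \<Longrightarrow> ip M (ract M x b) y = star b * ip M x y"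
  using ip_star[of "ract M x b" y] ip_star[of y x] by (simp add: ip_ract closed_rules star_mult star_star)

lemma lact_zero_right: "lact M b 0 = 0"
  using lact_add_right[of 0 0 b] zero_closed by simp

lemma lact_minus_right: "x \<in> car M \<Longrightarrow> lact M b (- x) = - lact M b x"
  using lact_add_right[of x "- x" b] uminus_closed lact_zero_right
  by (simp add: eq_neg_iff_add_eq_0 add.commute)

lemma lact_diff_right: "x \<in> car M \<Longrightarrow> y \<in> car M \<Longrightarrow> lact M b (x - y) = lact M b x - lact M b y"
  using lact_add_right[of x "- y" b] uminus_closed lact_minus_right by simp

lemma ip_lact_scaleC:
  "x \<in> car M \<Longrightarrow> y \<in> car M \<Longrightarrow> ip M x (lact M (\<alpha> *\<^sub>C b) y) = \<alpha> *\<^sub>C ip M x (lact M b y)"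
  by (simp add: lact_scaleC ip_ract closed_rules mult_scaleC_right)

section \<open>The norm of a Hilbert module\<close>

lemma hnorm_zero [simp]: "hnorm M 0 = 0"
  using zero_closed by (simp add: hnorm_def ip_zero_right)

lemma hnorm_eq_zero: "x \<in> car M \<Longrightarrow> hnorm M x = 0 \<Longrightarrow> x = 0"
  using ip_definite by (simp add: hnorm_def)

lemma cauchy_schwarz:
  assumes x: "x \<in> car M" and y: "y \<in> car M"
  shows "norm (ip M x y) \<le> hnorm M x * hnorm M y"
proof (cases "x = 0")
  case True
  then show ?thesis using y by (simp add: ip_zero_left)
next
  case False
  define r where "r = norm (ip M x x)"
  define a where "a = ip M x y"
  have r: "r > 0" using False x ip_definite unfolding r_def by fastforce
  \<comment> \<open>The usual projection would divide by \<open>ip M x x\<close>, which need not be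
    invertible. Dividing by its norm \<open>r\<close> is enough, as \<open>ip M x x\<close> is at
    most \<open>r *\<^sub>R 1\<close>.\<close>
  define z where "z = y - ract M x ((1 / r) *\<^sub>R a)"
  have ay: "ip M y x = star a" unfolding a_def by (rule ip_star[OF y x])
  have "ip M z z = ip M y y - ip M y x * ((1 / r) *\<^sub>R a) - star ((1 / r) *\<^sub>R a) * ip M x y
      + star ((1 / r) *\<^sub>R a) * ip M x x * ((1 / r) *\<^sub>R a)"
    unfolding z_def using x y
    by (simp add: ip_diff_left ip_diff_right closed_rules ip_ract ip_ract_left algebra_simps)
  then have zz: "ip M z z = ip M y y - (2 / r) *\<^sub>R (star a * a) + (1 / r\<^sup>2) *\<^sub>R (star a * ip M x x * a)"
    by (simp add: ay a_def[symmetric] star_scaleR power2_eq_square diff_diff_eq flip: scaleR_add_left)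
  have "cstar_positive (r *\<^sub>R 1 - ip M x x)"
    unfolding r_def cstar_positive_iff_hpos
    by (intro hpos_norm_diff) (simp_all add: ip_star[OF x x, symmetric])
  then have "cstar_positive ((1 / r\<^sup>2) *\<^sub>R (star a * (r *\<^sub>R 1 - ip M x x) * a))"
    unfolding cstar_positive_iff_hpos
    by (intro hpos_scaleR) (use cstar_positive_conj cstar_positive_iff_hpos in auto)
  moreover have "(1 / r\<^sup>2) *\<^sub>R (star a * (r *\<^sub>R 1 - ip M x x) * a)
      = (1 / r) *\<^sub>R (star a * a) - (1 / r\<^sup>2) *\<^sub>R (star a * ip M x x * a)"
    using r by (simp add: algebra_simps power2_eq_square)
  moreover have "z \<in> car M" unfolding z_def using x y by (intro closed_rules)
  then have "cstar_positive (ip M z z)" by (rule ip_positive)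
  ultimately have "cstar_positive (ip M y y - (2 / r) *\<^sub>R (star a * a) + (1 / r) *\<^sub>R (star a * a))"
    using hpos_add[of "ip M z z"] unfolding cstar_positive_iff_hpos zz by fastforce
  moreover have "(2 / r) *\<^sub>R (star a * a) = (1 / r) *\<^sub>R (star a * a) + (1 / r) *\<^sub>R (star a * a)"
    by (simp flip: scaleR_add_left)
  ultimately have "cstar_positive (ip M y y - (1 / r) *\<^sub>R (star a * a))" by simp
  moreover have "cstar_positive ((1 / r) *\<^sub>R (star a * a))"
    unfolding cstar_positive_iff_hpos using r by (intro hpos_scaleR hpos_star_mult) simp
  ultimately have "norm ((1 / r) *\<^sub>R (star a * a)) \<le> norm (ip M y y)"
    by (intro cstar_positive_norm_mono)
  then have "(norm a)\<^sup>2 \<le> r * norm (ip M y y)"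
    using r by (simp add: cstar_identity field_simps)
  also have "\<dots> = (hnorm M x * hnorm M y)\<^sup>2"
    by (simp add: power_mult_distrib hnorm_power2 r_def)
  finally show ?thesis unfolding a_def by (rule power2_le_imp_le) simp
qed

lemma hnorm_triangle:
  assumes x: "x \<in> car M" and y: "y \<in> car M"
  shows "hnorm M (x + y) \<le> hnorm M x + hnorm M y"
proof (rule power2_le_imp_le)
  have "(hnorm M (x + y))\<^sup>2 = norm (ip M x x + ip M x y + (ip M y x + ip M y y))"
    using x y by (simp add: hnorm_power2 ip_add ip_add_left closed_rules algebra_simps)
  also have "\<dots> \<le> norm (ip M x x) + norm (ip M x y) + (norm (ip M y x) + norm (ip M y y))"
    by (intro norm_triangle_mono order_refl)
  also have "\<dots> \<le> (hnorm M x)\<^sup>2 + hnorm M x * hnorm M y + (hnorm M y * hnorm M x + (hnorm M y)\<^sup>2)"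
    unfolding hnorm_power2 by (intro add_mono cauchy_schwarz x y order_refl)
  finally show "(hnorm M (x + y))\<^sup>2 \<le> (hnorm M x + hnorm M y)\<^sup>2"
    by (simp add: power2_eq_square algebra_simps)
qed simp

lemma hnorm_minus: "x \<in> car M \<Longrightarrow> hnorm M (- x) = hnorm M x"
  using ip_diff_left[of 0 x "- x"] zero_closed
  by (simp add: hnorm_def ip_minus_right ip_zero_left closed_rules)

lemma hnorm_minus_commute: "x \<in> car M \<Longrightarrow> y \<in> car M \<Longrightarrow> hnorm M (x - y) = hnorm M (y - x)"
  using hnorm_minus[of "x - y"] diff_closed by simp

lemma hnorm_diff_triangle:
  "x \<in> car M \<Longrightarrow> y \<in> car M \<Longrightarrow> z \<in> car M \<Longrightarrow> hnorm M (x - z) \<le> hnorm M (x - y) + hnorm M (y - z)"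
  using hnorm_triangle[of "x - y" "y - z"] diff_closed by simp

lemma hnorm_le_add_diff:
  "x \<in> car M \<Longrightarrow> y \<in> car M \<Longrightarrow> hnorm M x \<le> hnorm M y + hnorm M (x - y)"
  using hnorm_triangle[of y "x - y"] diff_closed by simp

text \<open>Contractivity of the left action follows from positivity: \<open>d\<close> is chosen
  with \<open>star b * b + star d * d = R *\<^sub>R 1\<close>, so
  \<open>R *\<^sub>R ip M x x\<close> splits into the squares of \<open>lact M b x\<close> and
  \<open>lact M d x\<close>, both positive.\<close>

lemma hnorm_lact:
  assumes x: "x \<in> car M"
  shows "hnorm M (lact M b x) \<le> norm b * hnorm M x"
proof (rule power2_le_imp_le)
  define R where "R = (norm b)\<^sup>2"
  have "hpos (R *\<^sub>R 1 - star b * b)"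
    unfolding R_def by (intro hpos_norm_diff) (simp_all add: star_mult star_star cstar_identity)
  then obtain d where d: "R *\<^sub>R 1 - star b * b = star d * d"
    unfolding cstar_positive_iff_hpos[symmetric] cstar_positive_def by blast
  have sq: "ip M (lact M c x) (lact M c x) = ip M x (lact M (star c * c) x)" for c
    using x by (simp add: lact_adjoint lact_closed lact_mult)
  have "ip M x (lact M (R *\<^sub>R 1) x) = R *\<^sub>R ip M x x"
    using ip_lact_scaleC[OF x x, of "complex_of_real R" 1] x by (simp add: scaleC_of_real lact_one)
  moreover have "R *\<^sub>R 1 = star b * b + star d * d" by (simp add: d[symmetric])
  ultimately have "R *\<^sub>R ip M x x = ip M (lact M b x) (lact M b x) + ip M (lact M d x) (lact M d x)"
    using x by (simp add: sq lact_add_left ip_add lact_closed)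
  then have "norm (ip M (lact M b x) (lact M b x)) \<le> norm (R *\<^sub>R ip M x x)"
    by (intro cstar_positive_norm_mono ip_positive lact_closed x)
      (simp add: ip_positive lact_closed x)
  then show "(hnorm M (lact M b x))\<^sup>2 \<le> (norm b * hnorm M x)\<^sup>2"
    by (simp add: power_mult_distrib hnorm_power2 R_def)
qed simp

lemma norm_ip_lact:
  "x \<in> car M \<Longrightarrow> y \<in> car M \<Longrightarrow> norm (ip M x (lact M b y)) \<le> norm b * (hnorm M x * hnorm M y)"
  using order_trans[OF cauchy_schwarz[of x "lact M b y"] mult_left_mono[OF hnorm_lact[of y b], of "hnorm M x"]]
  by (simp add: closed_rules mult.left_commute)

section \<open>The operators \<open>Kop M x y\<close>\<close>

lemma Kop_apply: 
  assumes "x \<in> car M" "y \<in> car M"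
  shows "blinfun_apply (Kop M x y) b = ip M x (lact M b y)"
proof -
  have "bounded_linear (\<lambda>b. ip M x (lact M b y))"
  proof (rule bounded_linear_intro[of _ "hnorm M x * hnorm M y"])
    show "ip M x (lact M (r *\<^sub>R b) y) = r *\<^sub>R ip M x (lact M b y)" for r b
      using ip_lact_scaleC[OF assms, of "complex_of_real r" b] by (simp add: scaleC_of_real)
  qed (use assms in \<open>simp_all add: lact_add_left ip_add lact_closed norm_ip_lact\<close>)
  then show ?thesis by (simp add: Kop_def bounded_linear_Blinfun_apply)
qed

lemma norm_Kop: "x \<in> car M \<Longrightarrow> y \<in> car M \<Longrightarrow> norm (Kop M x y) \<le> hnorm M x * hnorm M y"
  by (rule norm_blinfun_bound) (simp_all add: Kop_apply norm_ip_lact mult.commute[of _ "norm _"])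

lemma Kop_add_left:
  "x \<in> car M \<Longrightarrow> y \<in> car M \<Longrightarrow> z \<in> car M \<Longrightarrow> Kop M (x + y) z = Kop M x z + Kop M y z"
  by (rule blinfun_eqI) (simp add: Kop_apply closed_rules ip_add_left blinfun.add_left)

lemma Kop_add_right:
  "x \<in> car M \<Longrightarrow> y \<in> car M \<Longrightarrow> z \<in> car M \<Longrightarrow> Kop M x (y + z) = Kop M x y + Kop M x z"
  by (rule blinfun_eqI) (simp add: Kop_apply closed_rules lact_add_right ip_add blinfun.add_left)

lemma Kop_diff_left:
  "x \<in> car M \<Longrightarrow> y \<in> car M \<Longrightarrow> z \<in> car M \<Longrightarrow> Kop M (x - y) z = Kop M x z - Kop M y z"
  by (rule blinfun_eqI) (simp add: Kop_apply closed_rules ip_diff_left blinfun.diff_left)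

lemma Kop_diff_right:
  "x \<in> car M \<Longrightarrow> y \<in> car M \<Longrightarrow> z \<in> car M \<Longrightarrow> Kop M x (y - z) = Kop M x y - Kop M x z"
  by (rule blinfun_eqI) (simp add: Kop_apply closed_rules lact_diff_right ip_diff_right blinfun.diff_left)

lemma Kop_zero_left: "x \<in> car M \<Longrightarrow> Kop M 0 x = 0"
  by (rule blinfun_eqI) (simp add: Kop_apply closed_rules ip_zero_left)

lemma Kop_zero_right: "x \<in> car M \<Longrightarrow> Kop M x 0 = 0"
  by (rule blinfun_eqI) (simp add: Kop_apply closed_rules lact_zero_right ip_zero_right)

text \<open>\<open>blinfun_mult_right c\<close> multiplies by \<open>c\<close> on the left, and
  \<open>blinfun_mult_left c\<close> on the right. Coefficients of the right action are applied
  after the kernel, those of the left action before it.\<close>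

lemma Kop_bimodule_left:
  "x \<in> car M \<Longrightarrow> y \<in> car M \<Longrightarrow> Kop M (lact M a (ract M x c)) y
    = blinfun_mult_right (star c) o\<^sub>L (Kop M x y o\<^sub>L blinfun_mult_right (star a))"
  by (rule blinfun_eqI) (simp add: Kop_apply closed_rules lact_adjoint ip_ract_left lact_mult)

lemma Kop_bimodule_right:
  "x \<in> car M \<Longrightarrow> y \<in> car M \<Longrightarrow> Kop M x (lact M a (ract M y c))
    = blinfun_mult_left c o\<^sub>L (Kop M x y o\<^sub>L blinfun_mult_left a)"
  by (rule blinfun_eqI) (simp add: Kop_apply closed_rules lact_ract ip_ract lact_mult)

lemma Kop_flip: "x \<in> car M \<Longrightarrow> y \<in> car M \<Longrightarrow> Kop M y x = blinfun_conj (Kop M x y)"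
  using ip_star[of y "lact M _ x"]
  by (intro blinfun_eqI) (simp add: Kop_apply closed_rules lact_adjoint)

text \<open>The bridge from kernels to norms. A single mixed kernel suffices because one half of
  \<open>ip M (x - y) (x - y)\<close> is rewritten as an adjoint, which has the same norm.\<close>

lemma hnorm_diff_le_Kop:
  assumes x: "x \<in> car M" and y: "y \<in> car M"
  shows "(hnorm M (x - y))\<^sup>2 \<le> norm (Kop M x x - Kop M x y) + norm (Kop M y y - Kop M x y)"
proof -
  have le: "norm (ip M u v - ip M x y) \<le> norm (Kop M u v - Kop M x y)" if "u \<in> car M" "v \<in> car M" for u v
    using norm_blinfun[of "Kop M u v - Kop M x y" 1] that x y
    by (simp add: blinfun.diff_left Kop_apply lact_one)
  have "ip M (x - y) (x - y) = (ip M x x - ip M x y) + star (ip M y y - ip M x y)"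
    using x y
    by (simp add: ip_diff_left ip_diff_right closed_rules star_diff
        ip_star[OF y x, symmetric] ip_star[OF y y, symmetric])
  then have "(hnorm M (x - y))\<^sup>2 = norm ((ip M x x - ip M x y) + star (ip M y y - ip M x y))"
    by (simp add: hnorm_power2)
  also have "\<dots> \<le> norm (ip M x x - ip M x y) + norm (ip M y y - ip M x y)"
    using norm_triangle_ineq by (metis norm_star)
  also have "\<dots> \<le> norm (Kop M x x - Kop M x y) + norm (Kop M y y - Kop M x y)"
    by (intro add_mono le x y)
  finally show ?thesis .
qed

text \<open>Membership is asked only eventually: the sequence in \<open>limit_unit\<close> starts at
  m = 0, where its entry lies in the fibre at 0.\<close>

lemma hlimit_unique:
  assumes "z \<in> car M" "w \<in> car M" "\<forall>\<^sub>F n in sequentially. X n \<in> car M"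
    "(\<lambda>n. hnorm M (X n - z)) \<longlonglongrightarrow> 0" "(\<lambda>n. hnorm M (X n - w)) \<longlonglongrightarrow> 0"
  shows "z = w"
proof -
  have "(\<lambda>n. hnorm M (X n - z) + hnorm M (X n - w)) \<longlonglongrightarrow> 0 + 0"
    by (intro tendsto_add assms)
  moreover have "\<forall>\<^sub>F n in sequentially. hnorm M (z - w) \<le> hnorm M (X n - z) + hnorm M (X n - w)"
    using assms(3)
    by eventually_elim (metis assms(1,2) hnorm_diff_triangle hnorm_minus_commute)
  ultimately have "hnorm M (z - w) \<le> 0 + 0"
    by (rule tendsto_lowerbound) simp
  then show ?thesis using hnorm_eq_zero[of "z - w"] diff_closed[OF assms(1,2)]
    by (metis add_0 antisym eq_iff_diff_eq_0 hnorm_nonneg)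
qed

lemma hlim_eqI:
  assumes "z \<in> car M" "\<forall>\<^sub>F n in sequentially. X n \<in> car M" "(\<lambda>n. hnorm M (X n - z)) \<longlonglongrightarrow> 0"
  shows "hlim M X = z"
  unfolding hlim_def using assms hlimit_unique by (intro the_equality) blast+

lemma tendsto_Kop:
  assumes x: "x \<in> car M" "\<forall>\<^sub>F n in F. X n \<in> car M" "((\<lambda>n. hnorm M (X n - x)) \<longlongrightarrow> 0) F"
    and y: "y \<in> car M" "\<forall>\<^sub>F n in F. Y n \<in> car M" "((\<lambda>n. hnorm M (Y n - y)) \<longlongrightarrow> 0) F"
  shows "((\<lambda>n. Kop M (X n) (Y n)) \<longlongrightarrow> Kop M x y) F"
proof (rule LIM_zero_cancel, rule Lim_null_comparison)
  have "((\<lambda>n. (hnorm M x + hnorm M (X n - x)) * hnorm M (Y n - y) + hnorm M (X n - x) * hnorm M y)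
      \<longlongrightarrow> (hnorm M x + 0) * 0 + 0 * hnorm M y) F"
    by (intro tendsto_intros x y)
  then show "((\<lambda>n. (hnorm M x + hnorm M (X n - x)) * hnorm M (Y n - y) + hnorm M (X n - x) * hnorm M y)
      \<longlongrightarrow> 0) F" by simp
  show "\<forall>\<^sub>F n in F. norm (Kop M (X n) (Y n) - Kop M x y)
      \<le> (hnorm M x + hnorm M (X n - x)) * hnorm M (Y n - y) + hnorm M (X n - x) * hnorm M y"
    using x(2) y(2)
  proof eventually_elim
    case (elim n)
    have "Kop M (X n) (Y n) - Kop M x y = Kop M (X n) (Y n - y) + Kop M (X n - x) y"
      using elim x(1) y(1) by (simp add: Kop_diff_left Kop_diff_right)
    also have "norm \<dots> \<le> hnorm M (X n) * hnorm M (Y n - y) + hnorm M (X n - x) * hnorm M y"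
      using elim x(1) y(1) by (intro norm_triangle_le add_mono norm_Kop diff_closed)
    also have "\<dots> \<le> (hnorm M x + hnorm M (X n - x)) * hnorm M (Y n - y) + hnorm M (X n - x) * hnorm M y"
      using elim x(1) by (intro add_right_mono mult_right_mono hnorm_le_add_diff) auto
    finally show ?case .
  qed
qed

lemma Kop_sum_list_left:
  "(\<And>p. p \<in> set ps \<Longrightarrow> f p \<in> car M) \<Longrightarrow> z \<in> car M \<Longrightarrow>
    Kop M (\<Sum>p\<leftarrow>ps. f p) z = (\<Sum>p\<leftarrow>ps. Kop M (f p) z)"
  by (induction ps) (simp_all add: Kop_zero_left Kop_add_left sum_list_closed)

lemma Kop_sum_list_right:
  "(\<And>p. p \<in> set ps \<Longrightarrow> f p \<in> car M) \<Longrightarrow> z \<in> car M \<Longrightarrow>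
    Kop M z (\<Sum>p\<leftarrow>ps. f p) = (\<Sum>p\<leftarrow>ps. Kop M z (f p))"
  by (induction ps) (simp_all add: Kop_zero_right Kop_add_right sum_list_closed)

end

section \<open>Kernels and norms of elementary tensors\<close>

lemma (in inner_tensor_product) Kop_tensor:
  assumes "hilbert_bimodule M" "hilbert_bimodule N" "hilbert_bimodule T"
    "u \<in> car M" "v \<in> car N" "u' \<in> car M" "v' \<in> car N"
  shows "Kop T (\<tau> u v) (\<tau> u' v') = Kop N v v' o\<^sub>L Kop M u u'"
proof -
  interpret M: hilbert_bimodule M by fact
  interpret N: hilbert_bimodule N by fact
  interpret T: hilbert_bimodule T by fact
  show ?thesis
    by (rule blinfun_eqI)
      (simp add: assms M.Kop_apply N.Kop_apply T.Kop_apply tensor_closed tensor_lact tensor_ip M.lact_closed)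
qed

lemma (in inner_tensor_product) hnorm_tensor:
  assumes "hilbert_bimodule M" "hilbert_bimodule N" "u \<in> car M" "v \<in> car N"
  shows "hnorm T (\<tau> u v) \<le> hnorm M u * hnorm N v"
proof (rule power2_le_imp_le)
  interpret N: hilbert_bimodule N by fact
  have "(hnorm T (\<tau> u v))\<^sup>2 = norm (ip N v (lact N (ip M u u) v))"
    by (simp add: hnorm_power2 tensor_ip assms)
  also have "\<dots> \<le> norm (ip M u u) * (hnorm N v * hnorm N v)" by (intro N.norm_ip_lact assms)
  finally show "(hnorm T (\<tau> u v))\<^sup>2 \<le> (hnorm M u * hnorm N v)\<^sup>2"
    by (simp add: hnorm_power2[symmetric] power2_eq_square mult_ac)
qed simp

lemma (in inner_tensor_product) tensor_diff:
  assumes "hilbert_bimodule M" "hilbert_bimodule N"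
  shows "\<lbrakk>u \<in> car M; u' \<in> car M; v \<in> car N\<rbrakk> \<Longrightarrow> \<tau> (u - u') v = \<tau> u v - \<tau> u' v"
    and "\<lbrakk>u \<in> car M; v \<in> car N; v' \<in> car N\<rbrakk> \<Longrightarrow> \<tau> u (v - v') = \<tau> u v - \<tau> u v'"
  using tensor_add_left[of "u - u'" u' v] tensor_add_right[of u "v - v'" v'] assms
  by (auto simp: hilbert_bimodule.diff_closed algebra_simps)

section \<open>Products of operators close to the identity\<close>

text \<open>The head acts first, in accordance with \<open>Kop_tensor\<close>, where the kernel of
  the left tensor factor is applied before that of the right one.\<close>

primrec compose_list :: "('x \<Rightarrow> 'a::real_normed_vector \<Rightarrow>\<^sub>L 'a) \<Rightarrow> 'x list \<Rightarrow> 'a \<Rightarrow>\<^sub>L 'a"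
  where
    "compose_list A [] = id_blinfun"
  | "compose_list A (x # xs) = compose_list A xs o\<^sub>L A x"

lemma norm_compose_list_le:
  assumes "\<And>x. x \<in> set xs \<Longrightarrow> norm (A x) \<le> exp (w x)"
  shows "norm (compose_list A xs) \<le> exp (\<Sum>x\<leftarrow>xs. w x)"
  using assms
proof (induction xs)
  case (Cons x xs)
  have "norm (compose_list A (x # xs)) \<le> exp (\<Sum>x\<leftarrow>xs. w x) * exp (w x)"
    unfolding compose_list.simps
    by (rule order_trans[OF norm_blinfun_compose]) (intro mult_mono Cons; simp add: Cons)
  then show ?case by (simp add: exp_add mult.commute)
qed (simp add: norm_blinfun_id_le)

text \<open>Telescoping: exchanging one factor costs \<open>e * w x\<close>, and the other factors
  contribute at most the exponential. The bound depends on the total weight alone, however fine the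
  list is.\<close>

lemma norm_compose_list_diff_le:
  assumes "\<And>x. x \<in> set xs \<Longrightarrow> norm (A x) \<le> exp (c * w x)"
    "\<And>x. x \<in> set xs \<Longrightarrow> norm (B x) \<le> exp (c * w x)"
    "\<And>x. x \<in> set xs \<Longrightarrow> norm (A x - B x) \<le> e * w x"
    "\<And>x. x \<in> set xs \<Longrightarrow> 0 \<le> w x" "c \<ge> 0" "e \<ge> 0"
  shows "norm (compose_list A xs - compose_list B xs) \<le> exp (c * (\<Sum>x\<leftarrow>xs. w x)) * (e * (\<Sum>x\<leftarrow>xs. w x))"
  using assms
proof (induction xs)
  case (Cons x xs)
  let ?S = "\<Sum>x\<leftarrow>xs. w x"
  have S: "?S \<ge> 0" using Cons.prems(4) by (intro sum_list_nonneg) auto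
  have w: "w x \<ge> 0" using Cons.prems(4) by simp
  have IH: "norm (compose_list A xs - compose_list B xs) \<le> exp (c * ?S) * (e * ?S)"
    using Cons by simp
  have B: "norm (compose_list B xs) \<le> exp (c * ?S)"
    using norm_compose_list_le[of xs B "\<lambda>x. c * w x"] Cons.prems(2)
    by (simp add: sum_list_const_mult)
  have "compose_list A (x # xs) - compose_list B (x # xs)
      = ((compose_list A xs - compose_list B xs) o\<^sub>L A x) + (compose_list B xs o\<^sub>L (A x - B x))"
    by (rule blinfun_eqI) (simp add: blinfun.diff_left blinfun.diff_right blinfun.add_left)
  also have "norm \<dots> \<le> exp (c * ?S) * (e * ?S) * exp (c * w x) + exp (c * ?S) * (e * w x)"
    by (intro norm_triangle_le add_mono order_trans[OF norm_blinfun_compose] mult_mono IH B Cons.prems)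
      (use S Cons.prems(6) in auto)
  also have "\<dots> \<le> exp (c * ?S) * (e * ?S) * exp (c * w x) + exp (c * ?S) * (e * w x) * exp (c * w x)"
    using w S Cons.prems(5,6) mult_left_mono[of 1 "exp (c * w x)" "exp (c * ?S) * (e * w x)"] by simp
  finally show ?case by (simp add: exp_add algebra_simps)
qed simp

text \<open>When the product is expanded, each factor contributes its own error
  \<open>e * w x\<close> and a cross term with the product of the factors after it. One factor is
  within \<open>c * w x\<close> of the identity, the product after it within
  \<open>exp (c * T) - 1\<close>; hence the constant.\<close>

lemma compose_list_first_order:
  assumes "\<And>x. x \<in> set xs \<Longrightarrow> norm (A x - id_blinfun - w x *\<^sub>R N) \<le> e * w x"
    "\<And>x. x \<in> set xs \<Longrightarrow> 0 \<le> w x" "(\<Sum>x\<leftarrow>xs. w x) \<le> T" "e \<ge> 0"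
  defines "c \<equiv> norm N + e"
  shows "norm (compose_list A xs - id_blinfun - (\<Sum>x\<leftarrow>xs. w x) *\<^sub>R N)
    \<le> (e + (exp (c * T) - 1) * c) * (\<Sum>x\<leftarrow>xs. w x)"
  using assms(1-4)
proof (induction xs)
  case (Cons x xs)
  let ?S = "\<Sum>x\<leftarrow>xs. w x"
  have c: "c \<ge> 0" by (simp add: c_def Cons.prems)
  have near: "norm (A y - id_blinfun) \<le> c * w y" if "y \<in> set (x # xs)" for y
  proof -
    have "norm (A y - id_blinfun) \<le> norm (A y - id_blinfun - w y *\<^sub>R N) + norm (w y *\<^sub>R N)"
      using norm_triangle_ineq[of "A y - id_blinfun - w y *\<^sub>R N" "w y *\<^sub>R N"] by simp
    also have "\<dots> \<le> e * w y + w y * norm N"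
      using Cons.prems(1,2)[OF that] by simp
    finally show ?thesis by (simp add: c_def algebra_simps)
  qed
  have S: "?S \<ge> 0" using Cons.prems(2) by (intro sum_list_nonneg) auto
  have w: "w x \<ge> 0" using Cons.prems(2) by simp
  have ST: "?S \<le> T" using Cons.prems(3) w by simp
  have IH: "norm (compose_list A xs - id_blinfun - ?S *\<^sub>R N) \<le> (e + (exp (c * T) - 1) * c) * ?S"
    using Cons ST by simp
  \<comment> \<open>Stated for all lists with entries among \<open>x # xs\<close>, so that the inner
    induction can use \<open>near\<close>.\<close>
  have one: "norm (compose_list A ys - id_blinfun) \<le> exp (c * (\<Sum>x\<leftarrow>ys. w x)) - 1"
    if "set ys \<subseteq> set (x # xs)" for ys
    using that
  proof (induction ys)
    case (Cons y ys)
    let ?Y = "\<Sum>x\<leftarrow>ys. w x"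
    have y: "y \<in> set (x # xs)" and ys: "set ys \<subseteq> set (x # xs)" using Cons.prems by auto
    have "compose_list A (y # ys) - id_blinfun
        = ((compose_list A ys - id_blinfun) o\<^sub>L (A y - id_blinfun))
          + (compose_list A ys - id_blinfun) + (A y - id_blinfun)"
      by (rule blinfun_eqI) (simp add: blinfun.diff_left blinfun.diff_right blinfun.add_left)
    also have "norm \<dots> \<le> (exp (c * ?Y) - 1) * (c * w y) + (exp (c * ?Y) - 1) + c * w y"
      by (intro norm_triangle_le add_mono order_trans[OF norm_blinfun_compose] mult_mono Cons.IH near y ys)
        (use order_trans[OF norm_ge_zero Cons.IH[OF ys]] in auto)
    also have "\<dots> = exp (c * ?Y) * (1 + c * w y) - 1" by (simp add: algebra_simps)
    also have "\<dots> \<le> exp (c * ?Y) * exp (c * w y) - 1"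
      using exp_ge_add_one_self[of "c * w y"] by (simp add: add.commute)
    finally show ?case by (simp add: exp_add algebra_simps)
  qed simp
  have "compose_list A (x # xs) - id_blinfun - (\<Sum>x\<leftarrow>x # xs. w x) *\<^sub>R N
      = ((compose_list A xs - id_blinfun) o\<^sub>L (A x - id_blinfun))
        + (compose_list A xs - id_blinfun - ?S *\<^sub>R N) + (A x - id_blinfun - w x *\<^sub>R N)"
    by (rule blinfun_eqI) (simp add: blinfun.diff_left blinfun.diff_right blinfun.add_left
        blinfun.scaleR_left scaleR_add_left)
  also have "norm \<dots> \<le> (exp (c * T) - 1) * (c * w x) + (e + (exp (c * T) - 1) * c) * ?S + e * w x"
  proof (intro norm_triangle_le add_mono order_trans[OF norm_blinfun_compose] mult_mono IH near Cons.prems)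
    show "norm (compose_list A xs - id_blinfun) \<le> exp (c * T) - 1"
    proof -
      have "exp (c * ?S) \<le> exp (c * T)" using mult_left_mono[OF ST c] by (simp only: exp_le_cancel_iff)
      with one[OF set_subset_Cons[of xs x]] show ?thesis by linarith
    qed
    show "0 \<le> exp (c * T) - 1" using c order_trans[OF S ST] by simp
  qed auto
  finally show ?case by (simp add: algebra_simps)
qed simp

text \<open>No semigroup law is demanded: the notion is also applied to kernels such as
  \<open>K s (x s) (y s)\<close> with \<open>y\<close> not multiplicative.\<close>

definition has_gen :: "(real \<Rightarrow> 'a::real_normed_vector \<Rightarrow>\<^sub>L 'a) \<Rightarrow> ('a \<Rightarrow>\<^sub>L 'a) \<Rightarrow> bool"
  where "has_gen A N \<longleftrightarrow> A 0 = id_blinfun \<and> (A has_vector_derivative N) (at 0 within {0..})"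

lemma has_gen_iff:
  "has_gen A N \<longleftrightarrow> A 0 = id_blinfun \<and>
    (\<forall>e>0. \<exists>d>0. \<forall>t. 0 \<le> t \<and> t < d \<longrightarrow> norm (A t - id_blinfun - t *\<^sub>R N) \<le> e * t)"
  unfolding has_gen_def has_vector_derivative_def has_derivative_within_alt
  by (auto simp: bounded_linear_scaleR_left Ball_def imp_conjL)

lemma has_genD:
  assumes "has_gen A N" "e > 0"
  shows "\<exists>d>0. \<forall>t. 0 \<le> t \<and> t < d \<longrightarrow> norm (A t - id_blinfun - t *\<^sub>R N) \<le> e * t"
  using assms has_gen_iff by blast

text \<open>Each entry is at most the total, so a short total length makes every factor first order,
  and the cross terms, of size \<open>(exp (c * T) - 1) * c\<close>, vanish with \<open>T\<close>.
  The resulting estimate is uniform over all partitions of a short interval.\<close>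

lemma has_gen_compose_list:
  assumes "has_gen A N" "e > 0"
  shows "\<exists>d>0. \<forall>xs. (\<forall>x\<in>set xs. 0 \<le> x) \<and> sum_list xs < d
    \<longrightarrow> norm (compose_list A xs - id_blinfun - sum_list xs *\<^sub>R N) \<le> e * sum_list xs"
proof -
  define c where "c = norm N + e / 2"
  obtain d where d: "d > 0" "\<And>t. 0 \<le> t \<Longrightarrow> t < d \<Longrightarrow> norm (A t - id_blinfun - t *\<^sub>R N) \<le> e / 2 * t"
    using has_genD[OF assms(1), of "e / 2"] assms(2) by auto
  have "((\<lambda>T. (exp (c * T) - 1) * c) \<longlongrightarrow> (exp (c * 0) - 1) * c) (at_right 0)"
    by (intro tendsto_intros)
  then have "eventually (\<lambda>T. (exp (c * T) - 1) * c < e / 2) (at_right 0)"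
    using assms(2) by (intro order_tendstoD(2)) auto
  then obtain d' where d': "d' > 0" "\<And>T. 0 < T \<Longrightarrow> T < d' \<Longrightarrow> (exp (c * T) - 1) * c < e / 2"
    unfolding eventually_at_right_field by auto
  define T where "T = min d d' / 2"
  have T: "T > 0" "T < d" "T < d'" using d(1) d'(1) by (auto simp: T_def)
  have "norm (compose_list A xs - id_blinfun - sum_list xs *\<^sub>R N) \<le> e * sum_list xs"
    if xs: "\<And>x. x \<in> set xs \<Longrightarrow> 0 \<le> x" "sum_list xs < T" for xs
  proof -
    have "norm (compose_list A xs - id_blinfun - (\<Sum>x\<leftarrow>xs. x) *\<^sub>R N)
        \<le> (e / 2 + (exp ((norm N + e / 2) * T) - 1) * (norm N + e / 2)) * (\<Sum>x\<leftarrow>xs. x)"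
    proof (rule compose_list_first_order)
      fix x assume x: "x \<in> set xs"
      have "x \<le> sum_list xs" using xs(1) x by (intro member_le_sum_list) auto
      then show "norm (A x - id_blinfun - x *\<^sub>R N) \<le> e / 2 * x"
        using d(2)[of x] xs x T by force
    qed (use xs assms(2) in auto)
    also have "\<dots> \<le> e * (\<Sum>x\<leftarrow>xs. x)"
      using d'(2)[of T] T xs(1) by (intro mult_right_mono) (auto simp: c_def intro: sum_list_nonneg)
    finally show ?thesis by simp
  qed
  then show ?thesis using T(1) by blast
qed

lemma norm_le_exp_of_first_order:
  assumes "norm (A - id_blinfun - t *\<^sub>R N) \<le> e * t" "t \<ge> 0"
  shows "norm A \<le> exp ((norm N + e) * t)"
proof -
  have "A = id_blinfun + t *\<^sub>R N + (A - id_blinfun - t *\<^sub>R N)" by simp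
  also have "norm \<dots> \<le> norm (id_blinfun :: 'a \<Rightarrow>\<^sub>L 'a) + norm (t *\<^sub>R N) + norm (A - id_blinfun - t *\<^sub>R N)"
    by (intro norm_triangle_mono order_refl)
  also have "\<dots> \<le> 1 + t * norm N + e * t"
    using assms norm_blinfun_id_le by (intro add_mono) auto
  also have "\<dots> \<le> exp ((norm N + e) * t)"
    using exp_ge_add_one_self[of "(norm N + e) * t"] by (simp add: algebra_simps)
  finally show ?thesis .
qed

lemma has_gen_continuous_at_zero:
  assumes "has_gen A N" shows "(A \<longlongrightarrow> id_blinfun) (at_right 0)"
proof -
  have "continuous (at 0 within {0..}) A"
    using assms unfolding has_gen_def by (auto intro: has_vector_derivative_continuous)
  then have "(A \<longlongrightarrow> A 0) (at 0 within {0..})" by (simp add: continuous_within)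
  then have "(A \<longlongrightarrow> A 0) (at 0 within {0<..})" by (rule tendsto_within_subset) auto
  then show ?thesis using assms by (simp add: has_gen_def)
qed

section \<open>Uniformly continuous semigroups\<close>

text \<open>Boundedness near 0 spreads over bounded intervals by the semigroup law. Once
  \<open>K s\<close> is bounded for s < t + 1, the increment from s to s + h is controlled by the
  distance of \<open>K h\<close> from the identity, uniformly in s. This yields continuity from the
  left too, although only a right limit is given.\<close>

lemma semigroup_continuous:
  fixes K :: "real \<Rightarrow> 'a::real_normed_vector \<Rightarrow>\<^sub>L 'a"
  assumes sg: "\<And>t s. t \<ge> 0 \<Longrightarrow> s \<ge> 0 \<Longrightarrow> K (t + s) = K s o\<^sub>L K t"
    and lim: "(K \<longlongrightarrow> id_blinfun) (at_right 0)" and K0: "K 0 = id_blinfun"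
  shows "continuous_on {0..} K"
proof -
  have "eventually (\<lambda>t. norm (K t - id_blinfun) < 1) (at_right 0)"
    using tendstoD[OF lim, of 1] by (simp add: dist_norm)
  then obtain d where d: "d > 0" "\<And>t. 0 < t \<Longrightarrow> t < d \<Longrightarrow> norm (K t - id_blinfun) < 1"
    unfolding eventually_at_right_field by auto
  have small: "norm (K t) \<le> 2" if "0 \<le> t" "t < d" for t
  proof (cases "t = 0")
    case True
    then show ?thesis using norm_blinfun_id_le[where ?'a='a] by (simp add: K0)
  next
    case False
    then have "norm (K t) \<le> norm (id_blinfun :: 'a \<Rightarrow>\<^sub>L 'a) + norm (K t - id_blinfun)"
      using norm_triangle_ineq[of id_blinfun "K t - id_blinfun"] by simp
    then show ?thesis using d(2)[of t] that False norm_blinfun_id_le[where ?'a='a] by simp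
  qed
  \<comment> \<open>Steps of half the length \<open>d\<close> stay where the norm is at most
    2.\<close>
  have bound: "\<exists>B. \<forall>t. 0 \<le> t \<and> t < real n * (d / 2) \<longrightarrow> norm (K t) \<le> B" for n
  proof (induction n)
    case (Suc n)
    then obtain B where B: "\<And>t. 0 \<le> t \<Longrightarrow> t < real n * (d / 2) \<Longrightarrow> norm (K t) \<le> B" by auto
    have "norm (K t) \<le> max 2 (B * 2)" if t: "0 \<le> t" "t < real (Suc n) * (d / 2)" for t
    proof (cases "t < d")
      case False
      have *: "0 \<le> t - d/2" "t - d/2 < real n * (d/2)" using t False d(1) by (auto simp: algebra_simps)
      have "K t = K (t - d/2) o\<^sub>L K (d/2)" using sg[of "d/2" "t - d/2"] * d(1) by simp
      then have "norm (K t) \<le> norm (K (t - d/2)) * norm (K (d/2))" by (simp add: norm_blinfun_compose)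
      also have "\<dots> \<le> B * 2"
        using B[OF *] small[of "d/2"] d(1) order_trans[OF norm_ge_zero B[OF *]] by (intro mult_mono) auto
      finally show ?thesis by simp
    qed (use small[of t] t in simp)
    then show ?case by blast
  qed auto
  show ?thesis unfolding continuous_on_iff
  proof (intro ballI allI impI)
    fix t e :: real assume t: "t \<in> {0..}" and e: "e > 0"
    obtain n where "real n * (d / 2) > t + 1" using d(1) reals_Archimedean3[of "d/2"] by (meson half_gt_zero)
    then obtain B where B: "\<And>s. 0 \<le> s \<Longrightarrow> s < t + 1 \<Longrightarrow> norm (K s) \<le> B" using bound[of n] by force
    have B0: "B \<ge> 0" using order_trans[OF norm_ge_zero B[of 0]] t by simp
    have "eventually (\<lambda>t. norm (K t - id_blinfun) < e / (B + 1)) (at_right 0)"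
      using tendstoD[OF lim, of "e / (B + 1)"] e B0 by (simp add: dist_norm)
    then obtain d' where d': "d' > 0" "\<And>t. 0 < t \<Longrightarrow> t < d' \<Longrightarrow> norm (K t - id_blinfun) < e / (B + 1)"
      unfolding eventually_at_right_field by auto
    have step: "norm (K (s + h) - K s) < e" if "0 \<le> s" "s < t + 1" "0 < h" "h < d'" for s h
    proof -
      have "K (s + h) - K s = (K h - id_blinfun) o\<^sub>L K s"
        using sg[of s h] that by (intro blinfun_eqI) (simp add: blinfun.diff_left)
      then have "norm (K (s + h) - K s) \<le> norm (K h - id_blinfun) * norm (K s)"
        by (simp add: norm_blinfun_compose)
      also have "\<dots> \<le> e / (B + 1) * B"
        using d'(2)[OF that(3,4)] B[OF that(1,2)] e B0 by (intro mult_mono) auto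
      also have "\<dots> < e" using e B0 by (simp add: field_simps)
      finally show ?thesis .
    qed
    have "dist (K s) (K t) < e" if s: "s \<in> {0..}" "dist s t < min d' 1" for s
    proof (cases s t rule: linorder_cases)
      case less
      then show ?thesis using step[of s "t - s"] s t by (simp add: dist_norm norm_minus_commute)
    next
      case greater
      then show ?thesis using step[of t "s - t"] s t by (simp add: dist_norm)
    qed (use e in simp)
    then show "\<exists>d>0. \<forall>s\<in>{0..}. dist s t < d \<longrightarrow> dist (K s) (K t) < e"
      using d'(1) by (intro exI[of _ "min d' 1"]) auto
  qed
qed

text \<open>Averaging: \<open>J = (\<integral>\<^sub>0\<^sup>h K s ds) / h\<close> is within \<open>1/2\<close> of the identity for small \<open>h\<close>, and
  \<open>(K t - id) / t o\<^sub>L J\<close> converges, so that \<open>(K t - id) / t\<close> is Cauchy.\<close>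

lemma semigroup_differentiable:
  fixes K :: "real \<Rightarrow> 'a::banach \<Rightarrow>\<^sub>L 'a"
  assumes sg: "\<And>t s. t \<ge> 0 \<Longrightarrow> s \<ge> 0 \<Longrightarrow> K (t + s) = K s o\<^sub>L K t"
    and cont: "continuous_on {0..} K" and K0: "K 0 = id_blinfun"
  shows "\<exists>N. has_gen K N"
proof -
  obtain h where h: "h > 0" "\<And>s. 0 \<le> s \<Longrightarrow> s \<le> h \<Longrightarrow> norm (K s - id_blinfun) \<le> 1/2"
  proof -
    obtain d where d: "d > 0" "\<And>s. s \<ge> 0 \<Longrightarrow> dist s 0 < d \<Longrightarrow> dist (K s) (K 0) < 1/2"
      using cont[unfolded continuous_on_iff, rule_format, of 0 "1/2"] by auto
    show ?thesis using d(1) less_imp_le[OF d(2)]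
      by (intro that[of "d/2"]) (auto simp: dist_norm K0)
  qed
  have contab: "continuous_on {a..b} K" if "a \<ge> 0" for a b
    by (rule continuous_on_subset[OF cont]) (use that in auto)
  have int: "K integrable_on {a..b}" if "a \<ge> 0" for a b
    by (intro integrable_continuous_interval contab that)
  define F where "F t = integral {0..t} K" for t
  define J where "J = (1 / h) *\<^sub>R F h"
  have J: "norm (id_blinfun - J) \<le> 1/2"
  proof -
    have "F h - h *\<^sub>R id_blinfun = integral {0..h} (\<lambda>s. K s - id_blinfun)"
      using h(1) int[of 0 h] by (simp add: F_def integral_diff integrable_const_ivl)
    also have "norm \<dots> \<le> 1/2 * (h - 0)"
      by (rule integral_bound) (use h in \<open>auto intro!: continuous_intros contab\<close>)
    finally have "norm ((1 / h) *\<^sub>R (F h - h *\<^sub>R id_blinfun)) \<le> 1/2" using h(1) by (simp add: divide_le_eq)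
    moreover have "(1 / h) *\<^sub>R (F h - h *\<^sub>R id_blinfun) = - (id_blinfun - J)"
      using h(1) by (simp add: J_def algebra_simps)
    ultimately show ?thesis by (metis norm_minus_cancel)
  qed
  define D where "D t = (1 / t) *\<^sub>R (K t - id_blinfun)" for t
  \<comment> \<open>The semigroup law moves \<open>K t\<close> under the integral as a shift, so
    only the ends of the interval survive: averages over \<open>{h..h + t}\<close> and
    \<open>{0..t}\<close>.\<close>
  have DJ: "D t o\<^sub>L J = (1 / h) *\<^sub>R ((1 / t) *\<^sub>R (F (h + t) - F h) - (1 / t) *\<^sub>R F t)" if t: "t > 0" for t
  proof -
    have "K t o\<^sub>L F h = integral {0..h} (\<lambda>s. K t o\<^sub>L K s)"
      using integral_linear[OF int[of 0 h] bounded_bilinear.bounded_linear_right[OF bounded_bilinear_blinfun_compose], of "K t"]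
      by (simp add: F_def o_def)
    also have "\<dots> = integral {0..h} (\<lambda>s. K (s + t))"
      by (rule integral_cong) (use sg t in auto)
    also have "\<dots> = integral {t..h + t} K"
      using integral_shift_real_ivl[of t t "h + t" K] by simp
    also have "\<dots> = F (h + t) - F t"
      using Henstock_Kurzweil_Integration.integral_combine[where a=0 and c=t and b="h + t" and f=K] int[of 0 "h + t"] t h(1) by (simp add: F_def eq_diff_eq add.commute)
    finally have KF: "K t o\<^sub>L F h = F (h + t) - F t" .
    have "(K t - id_blinfun) o\<^sub>L F h = (K t o\<^sub>L F h) - F h"
      by (rule blinfun_eqI) (simp add: blinfun.diff_left)
    then have "(K t - id_blinfun) o\<^sub>L F h = F (h + t) - F h - F t" unfolding KF by simp
    moreover have "D t o\<^sub>L J = (1 / h) *\<^sub>R (1 / t) *\<^sub>R ((K t - id_blinfun) o\<^sub>L F h)"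
      by (rule blinfun_eqI)
        (simp add: D_def J_def blinfun.scaleR_left blinfun.scaleR_right blinfun.diff_left mult.commute)
    ultimately show ?thesis by (simp add: scaleR_diff_right)
  qed
  have dF: "((\<lambda>t. (1 / t) *\<^sub>R (F (a + t) - F a)) \<longlongrightarrow> K a) (at_right 0)" if a: "a \<ge> 0" for a
  proof -
    have hvd: "(F has_vector_derivative K a) (at a within {0..a + 1})"
      unfolding F_def by (rule integral_has_vector_derivative) (use contab a in auto)
    show ?thesis
    proof (rule tendstoI)
      fix e :: real assume e: "e > 0"
      obtain d where d: "d > 0" "\<And>y. y \<in> {0..a + 1} \<Longrightarrow> norm (y - a) < d \<Longrightarrow>
          norm (F y - F a - (y - a) *\<^sub>R K a) \<le> e / 2 * norm (y - a)"
        using hvd e unfolding has_vector_derivative_def has_derivative_within_alt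
        by (meson half_gt_zero)
      have "dist ((1 / t) *\<^sub>R (F (a + t) - F a)) (K a) < e" if t: "0 < t" "t < min d 1" for t
      proof -
        have "(1 / t) *\<^sub>R (F (a + t) - F a) - K a = (1 / t) *\<^sub>R (F (a + t) - F a - (a + t - a) *\<^sub>R K a)"
          using t by (simp add: algebra_simps)
        then have "dist ((1 / t) *\<^sub>R (F (a + t) - F a)) (K a)
            = (1 / t) * norm (F (a + t) - F a - (a + t - a) *\<^sub>R K a)"
          using t by (simp add: dist_norm)
        also have "\<dots> \<le> (1 / t) * (e / 2 * norm (a + t - a))"
          using t a by (intro mult_left_mono d(2)) auto
        also have "\<dots> < e" using t e by simp
        finally show ?thesis .
      qed
      then show "\<forall>\<^sub>F t in at_right 0. dist ((1 / t) *\<^sub>R (F (a + t) - F a)) (K a) < e"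
        unfolding eventually_at_right_field using d(1) by (intro exI[of _ "min d 1"]) auto
    qed
  qed
  have lim: "((\<lambda>t. D t o\<^sub>L J) \<longlongrightarrow> (1 / h) *\<^sub>R (K h - K 0)) (at_right 0)"
  proof (rule Lim_transform_eventually)
    show "((\<lambda>t. (1 / h) *\<^sub>R ((1 / t) *\<^sub>R (F (h + t) - F h) - (1 / t) *\<^sub>R (F (0 + t) - F 0)))
        \<longlongrightarrow> (1 / h) *\<^sub>R (K h - K 0)) (at_right 0)"
      using h(1) by (intro tendsto_intros dF) auto
    show "\<forall>\<^sub>F t in at_right 0. (1 / h) *\<^sub>R ((1 / t) *\<^sub>R (F (h + t) - F h) - (1 / t) *\<^sub>R (F (0 + t) - F 0))
        = D t o\<^sub>L J"
      using eventually_at_right_less[of 0] by eventually_elim (simp add: DJ F_def)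
  qed
  \<comment> \<open>The term with \<open>id_blinfun - J\<close> has at most half the norm of
    \<open>D t - D s\<close> and is absorbed on the left.\<close>
  have key: "norm (D t - D s) \<le> 2 * norm ((D t o\<^sub>L J) - (D s o\<^sub>L J))" for t s
  proof -
    have "D t - D s = ((D t o\<^sub>L J) - (D s o\<^sub>L J)) + ((D t - D s) o\<^sub>L (id_blinfun - J))"
      by (rule blinfun_eqI) (simp add: blinfun.diff_left blinfun.diff_right blinfun.add_left)
    then have "norm (D t - D s) \<le> norm ((D t o\<^sub>L J) - (D s o\<^sub>L J)) + norm (D t - D s) * norm (id_blinfun - J)"
      by (metis norm_triangle_le add_left_mono norm_blinfun_compose)
    also have "\<dots> \<le> norm ((D t o\<^sub>L J) - (D s o\<^sub>L J)) + norm (D t - D s) * (1/2)"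
      by (intro add_left_mono mult_left_mono J) simp
    finally show ?thesis by simp
  qed
  have close: "\<exists>d>0. \<forall>t s. 0 < t \<and> t < d \<and> 0 < s \<and> s < d \<longrightarrow> norm (D t - D s) \<le> e" if e: "e > 0" for e
  proof -
    define L where "L = (1 / h) *\<^sub>R (K h - K 0)"
    have "eventually (\<lambda>t. dist (D t o\<^sub>L J) L < e / 4) (at_right 0)"
      using tendstoD[OF lim, of "e / 4"] e by (simp add: L_def)
    then obtain d where d: "d > 0" "\<And>t. 0 < t \<Longrightarrow> t < d \<Longrightarrow> dist (D t o\<^sub>L J) L < e / 4"
      unfolding eventually_at_right_field by auto
    have "norm (D t - D s) \<le> e" if "0 < t" "t < d" "0 < s" "s < d" for t s
      using key[of t s] dist_triangle_half_l[of "D t o\<^sub>L J" L "e / 2" "D s o\<^sub>L J"] d(2)[of t] d(2)[of s] that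
      by (simp add: dist_norm)
    then show ?thesis using d(1) by blast
  qed
  have inv: "\<exists>m. \<forall>n\<ge>m. inverse (real (Suc n)) < d" if "d > 0" for d
    using order_tendstoD(2)[OF LIMSEQ_inverse_real_of_nat that] by (simp add: eventually_sequentially)
  have "Cauchy (\<lambda>n. D (inverse (real (Suc n))))"
  proof (rule metric_CauchyI)
    fix e :: real assume e: "e > 0"
    obtain d where d: "d > 0" "\<And>t s. 0 < t \<Longrightarrow> t < d \<Longrightarrow> 0 < s \<Longrightarrow> s < d \<Longrightarrow> norm (D t - D s) \<le> e / 2"
      using close[of "e / 2"] e by auto
    obtain m where m: "\<And>n. n \<ge> m \<Longrightarrow> inverse (real (Suc n)) < d" using inv[OF d(1)] by blast
    have "dist (D (inverse (real (Suc i)))) (D (inverse (real (Suc j)))) < e" if "i \<ge> m" "j \<ge> m" for i j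
      using d(2)[of "inverse (real (Suc i))" "inverse (real (Suc j))"] m[OF that(1)] m[OF that(2)] e
      by (simp add: dist_norm)
    then show "\<exists>M. \<forall>i\<ge>M. \<forall>j\<ge>M. dist (D (inverse (real (Suc i)))) (D (inverse (real (Suc j)))) < e" by blast
  qed
  then obtain N where N: "(\<lambda>n. D (inverse (real (Suc n)))) \<longlonglongrightarrow> N"
    using Cauchy_convergent convergent_def by blast
  have "\<exists>d>0. \<forall>t. 0 \<le> t \<and> t < d \<longrightarrow> norm (K t - id_blinfun - t *\<^sub>R N) \<le> e * t" if e: "e > 0" for e
  proof -
    obtain d where d: "d > 0" "\<And>t s. 0 < t \<Longrightarrow> t < d \<Longrightarrow> 0 < s \<Longrightarrow> s < d \<Longrightarrow> norm (D t - D s) \<le> e"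
      using close[OF e] by auto
    obtain m where m: "\<And>n. n \<ge> m \<Longrightarrow> inverse (real (Suc n)) < d" using inv[OF d(1)] by blast
    have "norm (K t - id_blinfun - t *\<^sub>R N) \<le> e * t" if t: "0 \<le> t" "t < d" for t
    proof (cases "t = 0")
      case False
      with t have t0: "0 < t" by simp
      have "(\<lambda>n. norm (D t - D (inverse (real (Suc n))))) \<longlonglongrightarrow> norm (D t - N)"
        by (intro tendsto_intros N)
      then have DN: "norm (D t - N) \<le> e"
        by (rule LIMSEQ_le_const2) (use d(2)[OF t0 t(2)] m in \<open>intro exI[of _ m], simp\<close>)
      have "K t - id_blinfun - t *\<^sub>R N = t *\<^sub>R (D t - N)" using t0 by (simp add: D_def algebra_simps)
      then have "norm (K t - id_blinfun - t *\<^sub>R N) = t * norm (D t - N)" using t0 by simp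
      also have "\<dots> \<le> t * e" using DN t0 by simp
      finally show ?thesis by (simp add: mult.commute)
    qed (simp add: K0)
    then show ?thesis using d(1) by blast
  qed
  then show ?thesis using K0 unfolding has_gen_iff by blast
qed

section \<open>Product systems and tensor products along partitions\<close>

text \<open>Entries and their lengths are kept apart so that the blocks of a partition can serve as
  entries, with \<open>sum_list\<close> as length.\<close>

primrec weighted_tensor :: "('b::unital_cstar_algebra, 'e) prodsys \<Rightarrow> ('x \<Rightarrow> real) \<Rightarrow> ('x \<Rightarrow> 'e) \<Rightarrow> 'x list \<Rightarrow> 'e"
  where
    "weighted_tensor P w f [] = emb P 1"
  | "weighted_tensor P w f (x # xs) = tens P (w x) (\<Sum>x\<leftarrow>xs. w x) (f x) (weighted_tensor P w f xs)"

abbreviation partition_tensor :: "('b::unital_cstar_algebra, 'e) prodsys \<Rightarrow> (real \<Rightarrow> 'e) \<Rightarrow> real list \<Rightarrow> 'e"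
  where "partition_tensor P \<equiv> weighted_tensor P (\<lambda>d. d)"

context product_system
begin

abbreviation K :: "real \<Rightarrow> 'e \<Rightarrow> 'e \<Rightarrow> 'b \<Rightarrow>\<^sub>L 'b" where "K t \<equiv> Kop (fib P t)"
abbreviation E :: "real \<Rightarrow> 'e set" where "E t \<equiv> car (fib P t)"

lemma tens_closed: "\<lbrakk>t \<ge> 0; s \<ge> 0; u \<in> E t; v \<in> E s\<rbrakk> \<Longrightarrow> tens P t s u v \<in> E (t + s)"
  using inner_tensor_product.tensor_closed[OF tens_tensor] by blast

lemma K_tens:
  "\<lbrakk>t \<ge> 0; s \<ge> 0; u \<in> E t; v \<in> E s; u' \<in> E t; v' \<in> E s\<rbrakk>
    \<Longrightarrow> K (t + s) (tens P t s u v) (tens P t s u' v') = K s v v' o\<^sub>L K t u u'"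
  using inner_tensor_product.Kop_tensor[OF tens_tensor fib_hilbert fib_hilbert fib_hilbert] by simp

lemma hnorm_tens:
  "\<lbrakk>t \<ge> 0; s \<ge> 0; u \<in> E t; v \<in> E s\<rbrakk>
    \<Longrightarrow> hnorm (fib P (t + s)) (tens P t s u v) \<le> hnorm (fib P t) u * hnorm (fib P s) v"
  using inner_tensor_product.hnorm_tensor[OF tens_tensor fib_hilbert fib_hilbert] by simp

lemma tens_diff_left:
  "\<lbrakk>t \<ge> 0; s \<ge> 0; u \<in> E t; u' \<in> E t; v \<in> E s\<rbrakk>
    \<Longrightarrow> tens P t s (u - u') v = tens P t s u v - tens P t s u' v"
  using inner_tensor_product.tensor_diff(1)[OF tens_tensor fib_hilbert fib_hilbert] by simp

lemma tens_diff_right: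
  "\<lbrakk>t \<ge> 0; s \<ge> 0; u \<in> E t; v \<in> E s; v' \<in> E s\<rbrakk>
    \<Longrightarrow> tens P t s u (v - v') = tens P t s u v - tens P t s u v'"
  using inner_tensor_product.tensor_diff(2)[OF tens_tensor fib_hilbert fib_hilbert] by simp

lemma emb_closed: "emb P b \<in> E 0"
  using emb_bij by (auto simp: bij_betw_def)

lemma K_emb_one: "K 0 (emb P 1) (emb P 1) = id_blinfun"
proof (rule blinfun_eqI)
  interpret hilbert_bimodule "fib P 0" by (rule fib_hilbert) simp
  show "blinfun_apply (K 0 (emb P 1) (emb P 1)) b = blinfun_apply id_blinfun b" for b
    using emb_lact[of b 1] emb_ip[of 1 b] by (simp add: Kop_apply emb_closed)
qed

lemma unit_closed: "u \<in> units P \<Longrightarrow> t \<ge> 0 \<Longrightarrow> u t \<in> E t"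
  by (auto simp: units_def)

lemma unit_zero: "u \<in> units P \<Longrightarrow> u 0 = emb P 1"
  by (auto simp: units_def)

lemma unit_tens: "u \<in> units P \<Longrightarrow> t \<ge> 0 \<Longrightarrow> s \<ge> 0 \<Longrightarrow> tens P t s (u t) (u s) = u (t + s)"
  by (auto simp: units_def)

lemma weighted_tensor_closed:
  "(\<And>x. x \<in> set xs \<Longrightarrow> 0 \<le> w x \<and> f x \<in> E (w x)) \<Longrightarrow> weighted_tensor P w f xs \<in> E (\<Sum>x\<leftarrow>xs. w x)"
  by (induction xs) (auto intro!: emb_closed tens_closed sum_list_nonneg)

lemma K_weighted_tensor:
  assumes "\<And>x. x \<in> set xs \<Longrightarrow> 0 \<le> w x" "\<And>x. x \<in> set xs \<Longrightarrow> f x \<in> E (w x)" "\<And>x. x \<in> set xs \<Longrightarrow> g x \<in> E (w x)"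
  shows "K (\<Sum>x\<leftarrow>xs. w x) (weighted_tensor P w f xs) (weighted_tensor P w g xs)
    = compose_list (\<lambda>x. K (w x) (f x) (g x)) xs"
  using assms
proof (induction xs)
  case (Cons x xs)
  have "K (w x + (\<Sum>x\<leftarrow>xs. w x)) (weighted_tensor P w f (x # xs)) (weighted_tensor P w g (x # xs))
      = K (\<Sum>x\<leftarrow>xs. w x) (weighted_tensor P w f xs) (weighted_tensor P w g xs) o\<^sub>L K (w x) (f x) (g x)"
    unfolding weighted_tensor.simps
    by (intro K_tens weighted_tensor_closed sum_list_nonneg) (use Cons.prems in auto)
  then show ?case using Cons by simp
qed (simp add: K_emb_one)

lemma partition_tensor_unit:
  assumes "u \<in> units P" "\<And>d. d \<in> set ds \<Longrightarrow> 0 \<le> d"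
  shows "partition_tensor P u ds = u (sum_list ds)"
  using assms(2) by (induction ds) (auto simp: unit_zero unit_tens assms(1) sum_list_nonneg)

end

text \<open>The axioms of a product system do not state that tensoring with \<open>emb P 1\<close>
  is the identity. The presence of one unit provides the starting point \<open>tens_emb_emb\<close>
  from which this is derived.\<close>

locale pointed_product_system = product_system P
  for P :: "('b::unital_cstar_algebra, 'e::ab_group_add) prodsys" +
  fixes \<omega> :: "real \<Rightarrow> 'e"
  assumes unit_\<omega>: "\<omega> \<in> units P"
begin

lemma tens_emb_emb: "tens P 0 0 (emb P 1) (emb P 1) = emb P 1"
  using unit_tens[OF unit_\<omega>, of 0 0] by (simp add: unit_zero unit_\<omega>)

text \<open>Tensoring with \<open>emb P 1\<close> is an isometric idempotent, hence the identity.\<close>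

lemma tens_emb_left:
  assumes t: "t \<ge> 0" and z: "z \<in> E t"
  shows "tens P 0 t (emb P 1) z = z"
proof -
  interpret H: hilbert_bimodule "fib P t" by (rule fib_hilbert) fact
  define L where "L z = tens P 0 t (emb P 1) z" for z
  have L: "L z \<in> E t" if "z \<in> E t" for z
    using tens_closed[of 0 t "emb P 1" z] t that emb_closed by (simp add: L_def)
  have "K t (L u) (L u) = K t u u" if "u \<in> E t" for u
    using K_tens[of 0 t "emb P 1" u "emb P 1" u] t that emb_closed
    by (simp add: L_def K_emb_one) (rule blinfun_eqI, simp)
  then have iso: "ip (fib P t) (L u) (L u) = ip (fib P t) u u" if "u \<in> E t" for u
    using that L by (metis H.Kop_apply H.lact_one)
  have LL: "L (L z) = L z" using tens_assoc[of 0 0 t "emb P 1" "emb P 1" z] t z emb_closed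
    by (simp add: L_def tens_emb_emb)
  have "L (L z - z) = 0"
    using tens_diff_right[of 0 t "emb P 1" "L z" z] t z emb_closed L[OF z] LL by (simp add: L_def)
  then have "ip (fib P t) (L z - z) (L z - z) = 0"
    using iso[of "L z - z"] H.diff_closed[OF L[OF z] z] H.ip_zero_left[OF H.zero_closed] by simp
  then have "L z - z = 0" using H.ip_definite H.diff_closed[OF L[OF z] z] by blast
  then show ?thesis by (simp add: L_def)
qed

lemma tens_emb_right:
  assumes t: "t \<ge> 0" and z: "z \<in> E t"
  shows "tens P t 0 z (emb P 1) = z"
proof -
  interpret H: hilbert_bimodule "fib P t" by (rule fib_hilbert) fact
  define L where "L z = tens P t 0 z (emb P 1)" for z
  have L: "L z \<in> E t" if "z \<in> E t" for z
    using tens_closed[of t 0 z "emb P 1"] t that emb_closed by (simp add: L_def)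
  have "K t (L u) (L u) = K t u u" if "u \<in> E t" for u
    using K_tens[of t 0 u "emb P 1" u "emb P 1"] t that emb_closed
    by (simp add: L_def K_emb_one) (rule blinfun_eqI, simp)
  then have iso: "ip (fib P t) (L u) (L u) = ip (fib P t) u u" if "u \<in> E t" for u
    using that L by (metis H.Kop_apply H.lact_one)
  have LL: "L (L z) = L z" using tens_assoc[of t 0 0 z "emb P 1" "emb P 1"] t z emb_closed
    by (simp add: L_def tens_emb_emb)
  have "L (L z - z) = 0"
    using tens_diff_left[of t 0 "L z" z "emb P 1"] t z emb_closed L[OF z] LL by (simp add: L_def)
  then have "ip (fib P t) (L z - z) (L z - z) = 0"
    using iso[of "L z - z"] H.diff_closed[OF L[OF z] z] H.ip_zero_left[OF H.zero_closed] by simp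
  then have "L z - z = 0" using H.ip_definite H.diff_closed[OF L[OF z] z] by blast
  then show ?thesis by (simp add: L_def)
qed

lemma partition_tensor_append:
  assumes "\<And>d. d \<in> set ds \<union> set es \<Longrightarrow> 0 \<le> d \<and> y d \<in> E d"
  shows "partition_tensor P y (ds @ es)
    = tens P (sum_list ds) (sum_list es) (partition_tensor P y ds) (partition_tensor P y es)"
proof -
  have closed: "sum_list fs \<ge> 0" "partition_tensor P y fs \<in> E (sum_list fs)"
    if "\<And>d. d \<in> set fs \<Longrightarrow> 0 \<le> d \<and> y d \<in> E d" for fs
    using weighted_tensor_closed[of fs "\<lambda>d. d" y] that by (auto intro!: sum_list_nonneg)
  have es: "\<And>d. d \<in> set es \<Longrightarrow> 0 \<le> d \<and> y d \<in> E d" using assms by auto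
  show ?thesis using assms
  proof (induction ds)
    case Nil
    then show ?case by (simp add: tens_emb_left closed es)
  next
    case (Cons d ds)
    have ds: "\<And>d. d \<in> set ds \<Longrightarrow> 0 \<le> d \<and> y d \<in> E d" using Cons.prems by auto
    have "partition_tensor P y (ds @ es)
        = tens P (sum_list ds) (sum_list es) (partition_tensor P y ds) (partition_tensor P y es)"
      by (rule Cons.IH) (use Cons.prems in auto)
    then show ?case using Cons.prems[of d] by (simp add: tens_assoc closed ds es)
  qed
qed

lemma sum_list_concat_real: "sum_list (concat dss) = (\<Sum>ds\<leftarrow>dss. sum_list (ds :: real list))"
  by (induction dss) simp_all

text \<open>Together with \<open>partition_tensor_map_sum_list\<close> this presents the product
  over a fine partition and the product over a coarser one as tensors over the same list of blocks,
  with the factors \<open>partition_tensor P y ds\<close> and \<open>y (sum_list ds)\<close>. The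
  two can then be compared block by block.\<close>

lemma partition_tensor_concat:
  assumes "\<And>ds d. ds \<in> set dss \<Longrightarrow> d \<in> set ds \<Longrightarrow> 0 \<le> d \<and> y d \<in> E d"
  shows "partition_tensor P y (concat dss) = weighted_tensor P sum_list (partition_tensor P y) dss"
  using assms
proof (induction dss)
  case (Cons ds dss)
  have IH: "partition_tensor P y (concat dss) = weighted_tensor P sum_list (partition_tensor P y) dss"
    by (rule Cons.IH) (use Cons.prems in auto)
  have "partition_tensor P y (ds @ concat dss) = tens P (sum_list ds) (sum_list (concat dss))
      (partition_tensor P y ds) (partition_tensor P y (concat dss))"
    by (rule partition_tensor_append) (use Cons.prems in auto)
  then show ?case by (simp add: IH sum_list_concat_real)
qed simp

lemma partition_tensor_map_sum_list:
  "partition_tensor P y (map sum_list dss) = weighted_tensor P sum_list (\<lambda>ds. y (sum_list ds)) dss"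
  by (induction dss) (simp_all add: comp_def)

text \<open>\<open>tpow\<close> grows on the right and \<open>partition_tensor\<close> on the left;
  associativity reconciles them.\<close>

lemma tpow_eq_partition_tensor:
  assumes s: "s \<ge> 0" and y: "y s \<in> E s"
  shows "tpow P s (y s) m = partition_tensor P y (replicate m s)"
proof (induction m)
  case (Suc m)
  have "partition_tensor P y (replicate m s @ [s]) = tens P (sum_list (replicate m s)) (sum_list [s])
      (partition_tensor P y (replicate m s)) (partition_tensor P y [s])"
    by (rule partition_tensor_append) (use s y in auto)
  then show ?case using Suc s y
    by (simp add: sum_list_replicate tens_emb_right replicate_append_same)
qed simp

end

text \<open>A merge: the shorter of the two leading entries is split off and the remainder of the
  longer one is put back. The combined length of the lists drops each time.\<close>

lemma common_refinement:
  fixes ds es :: "real list"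
  assumes "\<And>d. d \<in> set ds \<Longrightarrow> d > 0" "\<And>e. e \<in> set es \<Longrightarrow> e > 0" "sum_list ds = sum_list es"
  shows "\<exists>dss ess. map sum_list dss = ds \<and> map sum_list ess = es \<and> concat dss = concat ess
    \<and> (\<forall>d\<in>set (concat dss). d > 0)"
  using assms
proof (induction "length ds + length es" arbitrary: ds es rule: less_induct)
  case less
  have pos: "sum_list fs \<ge> 0" if "set fs \<subseteq> set ds \<union> set es" for fs
    using that less.prems(1,2) by (intro sum_list_nonneg) (auto intro: less_imp_le)
  show ?case
  proof (cases ds)
    case Nil
    have "es = []"
    proof (cases es)
      case (Cons e es')
      then show ?thesis using less.prems(2)[of e] less.prems(3) pos[of es'] Nil by auto
    qed
    with Nil show ?thesis by (intro exI[of _ "[]"]) simp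
  next
    case ds: (Cons d ds')
    obtain e es' where es: "es = e # es'"
      using less.prems(1)[of d] less.prems(3) pos[of ds'] ds by (cases es) auto
    have de: "d > 0" "e > 0" using less.prems ds es by auto
    show ?thesis
    proof (cases d e rule: linorder_cases)
      case equal
      have "\<exists>dss ess. map sum_list dss = ds' \<and> map sum_list ess = es' \<and> concat dss = concat ess
          \<and> (\<forall>d\<in>set (concat dss). d > 0)"
        by (rule less.hyps) (use less.prems ds es equal in auto)
      then obtain dss ess where "map sum_list dss = ds'" "map sum_list ess = es'" "concat dss = concat ess"
          "\<forall>d\<in>set (concat dss). d > 0"
        by (elim exE conjE) (rule that)
      then show ?thesis using ds es equal de
        by (intro exI[of _ "[d] # dss"] exI[of _ "[d] # ess"]) auto
    next
      case l: less
      have "\<exists>dss ess. map sum_list dss = ds' \<and> map sum_list ess = (e - d) # es' \<and> concat dss = concat ess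
          \<and> (\<forall>d\<in>set (concat dss). d > 0)"
        by (rule less.hyps) (use less.prems ds es l in auto)
      then obtain dss ess where *: "map sum_list dss = ds'" "map sum_list ess = (e - d) # es'"
          "concat dss = concat ess" "\<forall>d\<in>set (concat dss). d > 0"
        by (elim exE conjE) (rule that)
      then obtain gs gss where "ess = gs # gss" "sum_list gs = e - d" "map sum_list gss = es'" by auto
      with * show ?thesis using ds es de
        by (intro exI[of _ "[d] # dss"] exI[of _ "(d # gs) # gss"]) auto
    next
      case g: greater
      have "\<exists>dss ess. map sum_list dss = (d - e) # ds' \<and> map sum_list ess = es' \<and> concat dss = concat ess
          \<and> (\<forall>d\<in>set (concat dss). d > 0)"
        by (rule less.hyps) (use less.prems ds es g in auto)
      then obtain dss ess where *: "map sum_list dss = (d - e) # ds'" "map sum_list ess = es'"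
          "concat dss = concat ess" "\<forall>d\<in>set (concat dss). d > 0"
        by (elim exE conjE) (rule that)
      then obtain gs gss where "dss = gs # gss" "sum_list gs = d - e" "map sum_list gss = ds'" by auto
      with * show ?thesis using ds es de
        by (intro exI[of _ "(e # gs) # gss"] exI[of _ "[e] # ess"]) auto
    qed
  qed
qed

section \<open>The unit generated by an approximate unit\<close>

text \<open>The last assumption makes \<open>y\<close> inherit first order estimates from the units in \<open>X\<close>, for
  which they follow from multiplicativity.\<close>

locale approximate_unit = pointed_product_system P \<omega>
  for P :: "('b::unital_cstar_algebra, 'e::ab_group_add) prodsys" and \<omega> :: "real \<Rightarrow> 'e" +
  fixes y :: "real \<Rightarrow> 'e" and X :: "(real \<Rightarrow> 'e) list" and M :: "'b \<Rightarrow>\<^sub>L 'b" and C :: real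
  assumes y_closed: "s \<ge> 0 \<Longrightarrow> y s \<in> E s"
    and y_zero: "y 0 = emb P 1"
    and X_units: "set X \<subseteq> units P"
    and gen_X: "x \<in> set X \<Longrightarrow> \<exists>N. has_gen (\<lambda>s. K s (x s) (y s)) N"
    and gen_y: "has_gen (\<lambda>s. K s (y s) (y s)) M"
    and C_nonneg: "C \<ge> 0"
    and norm_K_y_le: "\<lbrakk>0 \<le> s; s \<le> 1; z \<in> E s\<rbrakk>
      \<Longrightarrow> norm (K s (y s) z) \<le> C * (\<Sum>x\<leftarrow>X. norm (K s (x s) z))"
begin

abbreviation Y :: "real list \<Rightarrow> 'e" where "Y \<equiv> partition_tensor P y"

section \<open>Comparison of products over different partitions\<close>

lemma Y_closed: "(\<And>d. d \<in> set ds \<Longrightarrow> 0 \<le> d) \<Longrightarrow> Y ds \<in> E (sum_list ds)"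
  using weighted_tensor_closed[of ds "\<lambda>d. d" y] y_closed by simp

lemma K_unit_Y:
  assumes "\<xi> \<in> units P" "\<And>d. d \<in> set ds \<Longrightarrow> 0 \<le> d"
  shows "K (sum_list ds) (\<xi> (sum_list ds)) (Y ds) = compose_list (\<lambda>d. K d (\<xi> d) (y d)) ds"
  using K_weighted_tensor[of ds "\<lambda>d. d" \<xi> y] partition_tensor_unit[OF assms]
    assms unit_closed y_closed by simp

lemma K_Y_Y:
  "(\<And>d. d \<in> set ds \<Longrightarrow> 0 \<le> d) \<Longrightarrow> K (sum_list ds) (Y ds) (Y ds) = compose_list (\<lambda>d. K d (y d) (y d)) ds"
  using K_weighted_tensor[of ds "\<lambda>d. d" y y] y_closed by simp

lemma unit_coarsening:
  assumes x: "x \<in> set X" and e: "e > 0"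
  shows "\<exists>d>0. \<forall>ds. (\<forall>t\<in>set ds. 0 \<le> t) \<and> sum_list ds < d \<longrightarrow>
    norm (K (sum_list ds) (x (sum_list ds)) (Y ds - y (sum_list ds))) \<le> e * sum_list ds"
proof -
  obtain N where N: "has_gen (\<lambda>s. K s (x s) (y s)) N" using gen_X[OF x] by blast
  have xu: "x \<in> units P" using x X_units by blast
  obtain d1 where d1: "d1 > 0" "\<And>t. 0 \<le> t \<Longrightarrow> t < d1 \<Longrightarrow> norm (K t (x t) (y t) - id_blinfun - t *\<^sub>R N) \<le> e / 2 * t"
    using has_genD[OF N, of "e / 2"] e by auto
  obtain d2 where d2: "d2 > 0" "\<And>ds. (\<forall>t\<in>set ds. 0 \<le> t) \<Longrightarrow> sum_list ds < d2 \<Longrightarrow>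
      norm (compose_list (\<lambda>d. K d (x d) (y d)) ds - id_blinfun - sum_list ds *\<^sub>R N) \<le> e / 2 * sum_list ds"
    using has_gen_compose_list[OF N, of "e / 2"] e by auto
  have "norm (K (sum_list ds) (x (sum_list ds)) (Y ds - y (sum_list ds))) \<le> e * sum_list ds"
    if ds: "\<And>t. t \<in> set ds \<Longrightarrow> 0 \<le> t" "sum_list ds < min d1 d2" for ds
  proof -
    define t where "t = sum_list ds"
    have t: "t \<ge> 0" unfolding t_def using ds(1) by (intro sum_list_nonneg) auto
    interpret H: hilbert_bimodule "fib P t" by (rule fib_hilbert) fact
    have "K t (x t) (Y ds - y t) = (compose_list (\<lambda>d. K d (x d) (y d)) ds - id_blinfun - t *\<^sub>R N)
        - (K t (x t) (y t) - id_blinfun - t *\<^sub>R N)"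
      using K_unit_Y[OF xu, of ds] Y_closed[of ds] ds(1) unit_closed[OF xu t] y_closed[OF t]
      by (simp add: t_def[symmetric] H.Kop_diff_right)
    also have "norm \<dots> \<le> e / 2 * t + e / 2 * t"
      using d1(2)[of t] d2(2)[of ds] ds t
      by (intro order_trans[OF norm_triangle_ineq4 add_mono]) (auto simp: t_def)
    finally show ?thesis by (simp add: t_def)
  qed
  then show ?thesis using d1(1) d2(1) by (intro exI[of _ "min d1 d2"]) auto
qed

text \<open>The estimate of \<open>unit_coarsening\<close> has a unit in the first argument;
  \<open>norm_K_y_le\<close> transfers it to \<open>y\<close>, at the cost of the constant
  \<open>C\<close> and the number of units.\<close>

lemma coarsening:
  assumes e: "e > 0"
  shows "\<exists>d>0. \<forall>ds. (\<forall>t\<in>set ds. 0 \<le> t) \<and> sum_list ds < d \<longrightarrow>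
    norm (K (sum_list ds) (y (sum_list ds)) (Y ds - y (sum_list ds))) \<le> e * sum_list ds"
proof -
  \<comment> \<open>The summand 1 keeps the divisor positive.\<close>
  define e' where "e' = e / (C * real (length X) + 1)"
  have CX: "C * real (length X) \<ge> 0" using C_nonneg by simp
  then have e': "e' > 0" using e by (simp add: e'_def add_nonneg_pos)
  \<comment> \<open>The induction over \<open>Z\<close> produces one \<open>d\<close> for the
    finitely many units.\<close>
  have "\<exists>d>0. \<forall>x\<in>set Z. \<forall>ds. (\<forall>t\<in>set ds. 0 \<le> t) \<and> sum_list ds < d \<longrightarrow>
      norm (K (sum_list ds) (x (sum_list ds)) (Y ds - y (sum_list ds))) \<le> e' * sum_list ds"
    if "set Z \<subseteq> set X" for Z
    using that
  proof (induction Z)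
    case Nil
    show ?case by (intro exI[of _ 1]) simp
  next
    case (Cons z Z)
    then obtain d1 where d1: "d1 > 0" "\<forall>x\<in>set Z. \<forall>ds. (\<forall>t\<in>set ds. 0 \<le> t) \<and> sum_list ds < d1 \<longrightarrow>
        norm (K (sum_list ds) (x (sum_list ds)) (Y ds - y (sum_list ds))) \<le> e' * sum_list ds"
      by auto
    have "z \<in> set X" using Cons.prems by simp
    from unit_coarsening[OF this e'] obtain d2 where d2: "d2 > 0"
        "\<forall>ds. (\<forall>t\<in>set ds. 0 \<le> t) \<and> sum_list ds < d2 \<longrightarrow>
        norm (K (sum_list ds) (z (sum_list ds)) (Y ds - y (sum_list ds))) \<le> e' * sum_list ds"
      by auto
    show ?case using d1 d2 by (intro exI[of _ "min d1 d2"]) simp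
  qed
  from this[OF order_refl] obtain d where d: "d > 0" "\<And>x ds. x \<in> set X \<Longrightarrow> \<forall>t\<in>set ds. 0 \<le> t \<Longrightarrow> sum_list ds < d \<Longrightarrow>
      norm (K (sum_list ds) (x (sum_list ds)) (Y ds - y (sum_list ds))) \<le> e' * sum_list ds"
    by blast
  \<comment> \<open>The restriction to lengths below 1 is the range in which
    \<open>norm_K_y_le\<close> is assumed.\<close>
  have "norm (K (sum_list ds) (y (sum_list ds)) (Y ds - y (sum_list ds))) \<le> e * sum_list ds"
    if ds: "\<forall>t\<in>set ds. 0 \<le> t" "sum_list ds < min d 1" for ds
  proof -
    define t where "t = sum_list ds"
    have t: "t \<ge> 0" "t \<le> 1" unfolding t_def using ds by (auto intro!: sum_list_nonneg)
    interpret H: hilbert_bimodule "fib P t" by (rule fib_hilbert) fact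
    have z: "Y ds - y t \<in> E t"
      using Y_closed[of ds] y_closed[OF t(1)] ds(1) by (intro H.diff_closed) (auto simp: t_def)
    have "norm (K t (y t) (Y ds - y t)) \<le> C * (\<Sum>x\<leftarrow>X. norm (K t (x t) (Y ds - y t)))"
      by (rule norm_K_y_le[OF t z])
    also have "\<dots> \<le> C * (\<Sum>x\<leftarrow>X. e' * t)"
      using d(2)[of _ ds] ds by (intro mult_left_mono sum_list_mono C_nonneg) (auto simp: t_def)
    also have "\<dots> = (C * real (length X)) * e' * t" by (simp add: sum_list_triv)
    also have "\<dots> \<le> (C * real (length X) + 1) * e' * t"
      using e' t by (intro mult_right_mono) auto
    also have "\<dots> = e * t" using CX by (simp add: e'_def)
    finally show ?thesis by (simp add: t_def)
  qed
  then show ?thesis using d(1) by (intro exI[of _ "min d 1"]) auto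
qed

text \<open>All three pairings of \<open>y t\<close> and \<open>Y ds\<close> that occur in
  \<open>hnorm_diff_le_Kop\<close> share the first order part \<open>M\<close>: the diagonal one of
  \<open>Y ds\<close> as a product of kernels of \<open>y\<close>, the mixed one by
  \<open>coarsening\<close>.\<close>

lemma coarsening_first_order:
  assumes e: "e > 0"
  shows "\<exists>d>0. \<forall>ds. (\<forall>t\<in>set ds. 0 \<le> t) \<and> sum_list ds < d \<longrightarrow>
    (\<forall>u\<in>{y (sum_list ds), Y ds}.
      norm (K (sum_list ds) u (Y ds) - id_blinfun - sum_list ds *\<^sub>R M) \<le> e * sum_list ds) \<and>
    norm (K (sum_list ds) (y (sum_list ds)) (y (sum_list ds)) - id_blinfun - sum_list ds *\<^sub>R M) \<le> e * sum_list ds"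
proof -
  obtain d1 where d1: "d1 > 0" "\<And>t. 0 \<le> t \<Longrightarrow> t < d1 \<Longrightarrow> norm (K t (y t) (y t) - id_blinfun - t *\<^sub>R M) \<le> e / 2 * t"
    using has_genD[OF gen_y, of "e / 2"] e by auto
  obtain d2 where d2: "d2 > 0" "\<And>ds. (\<forall>t\<in>set ds. 0 \<le> t) \<Longrightarrow> sum_list ds < d2 \<Longrightarrow>
      norm (compose_list (\<lambda>d. K d (y d) (y d)) ds - id_blinfun - sum_list ds *\<^sub>R M) \<le> e * sum_list ds"
    using has_gen_compose_list[OF gen_y, of e] e by auto
  obtain d3 where d3: "d3 > 0" "\<And>ds. (\<forall>t\<in>set ds. 0 \<le> t) \<Longrightarrow> sum_list ds < d3 \<Longrightarrow>
      norm (K (sum_list ds) (y (sum_list ds)) (Y ds - y (sum_list ds))) \<le> e / 2 * sum_list ds"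
    using coarsening[of "e / 2"] e by auto
  have "(\<forall>u\<in>{y (sum_list ds), Y ds}.
      norm (K (sum_list ds) u (Y ds) - id_blinfun - sum_list ds *\<^sub>R M) \<le> e * sum_list ds) \<and>
    norm (K (sum_list ds) (y (sum_list ds)) (y (sum_list ds)) - id_blinfun - sum_list ds *\<^sub>R M) \<le> e * sum_list ds"
    if ds: "\<forall>t\<in>set ds. 0 \<le> t" "sum_list ds < min d1 (min d2 d3)" for ds
  proof -
    define t where "t = sum_list ds"
    have t: "t \<ge> 0" unfolding t_def using ds by (auto intro!: sum_list_nonneg)
    interpret H: hilbert_bimodule "fib P t" by (rule fib_hilbert) fact
    have cl: "y t \<in> E t" "Y ds \<in> E t"
      using Y_closed[of ds] y_closed[OF t(1)] ds(1) by (auto simp: t_def)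
    have yy: "norm (K t (y t) (y t) - id_blinfun - t *\<^sub>R M) \<le> e / 2 * t"
      using d1(2)[OF t] ds by (simp add: t_def)
    have "K t (y t) (Y ds) - id_blinfun - t *\<^sub>R M
        = K t (y t) (Y ds - y t) + (K t (y t) (y t) - id_blinfun - t *\<^sub>R M)"
      using cl by (simp add: H.Kop_diff_right)
    also have "norm \<dots> \<le> e / 2 * t + e / 2 * t"
      using d3(2)[of ds] ds by (intro norm_triangle_le add_mono yy) (auto simp: t_def)
    finally have "norm (K t (y t) (Y ds) - id_blinfun - t *\<^sub>R M) \<le> e * t" by simp
    moreover have "norm (K t (Y ds) (Y ds) - id_blinfun - t *\<^sub>R M) \<le> e * t"
      using d2(2)[of ds] K_Y_Y[of ds] ds by (simp add: t_def)
    moreover have "e / 2 * t \<le> e * t" using e t by simp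
    ultimately show ?thesis using yy by (auto simp: t_def)
  qed
  then show ?thesis using d1(1) d2(1) d3(1) by (intro exI[of _ "min d1 (min d2 d3)"]) auto
qed

text \<open>The kernels of both products are compositions over the blocks, with factors that differ
  by at most a small multiple of the block length. The telescoping bound adds these errors, and
  \<open>hnorm_diff_le_Kop\<close> is applied to the complete products.\<close>

lemma refinement_close:
  assumes e: "e > 0" and T: "T \<ge> 0"
  shows "\<exists>d>0. \<forall>dss. (\<forall>ds\<in>set dss. (\<forall>t\<in>set ds. 0 \<le> t) \<and> sum_list ds < d)
    \<and> (\<Sum>ds\<leftarrow>dss. sum_list ds) \<le> T \<longrightarrow>
    hnorm (fib P (\<Sum>ds\<leftarrow>dss. sum_list ds)) (Y (map sum_list dss) - Y (concat dss)) \<le> e"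
proof -
  define c where "c = norm M + 1"
  \<comment> \<open>Two kernel differences of size \<open>exp (c * t) * (2 * r * t)\<close> account
    for the 4, and the summand 1 covers \<open>T = 0\<close>. Below, \<open>r \<le> 1\<close>
    ensures that \<open>c = norm M + 1\<close> bounds the growth of all factors.\<close>
  define B where "B = 4 * exp (c * T) * T + 1"
  define r where "r = min 1 (e\<^sup>2 / B)"
  have c: "c \<ge> 0" by (simp add: c_def)
  have B: "B > 0" using T by (simp add: B_def add_nonneg_pos)
  have r: "r > 0" "r \<le> 1" "r \<le> e\<^sup>2 / B" using e B by (simp_all add: r_def)
  obtain d where d: "d > 0" "\<And>ds. (\<forall>t\<in>set ds. 0 \<le> t) \<Longrightarrow> sum_list ds < d \<Longrightarrow>
      (\<forall>u\<in>{y (sum_list ds), Y ds}.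
      norm (K (sum_list ds) u (Y ds) - id_blinfun - sum_list ds *\<^sub>R M) \<le> r * sum_list ds) \<and>
    norm (K (sum_list ds) (y (sum_list ds)) (y (sum_list ds)) - id_blinfun - sum_list ds *\<^sub>R M) \<le> r * sum_list ds"
    using coarsening_first_order[OF r(1)] by blast
  have "hnorm (fib P (\<Sum>ds\<leftarrow>dss. sum_list ds)) (Y (map sum_list dss) - Y (concat dss)) \<le> e"
    if dss: "\<And>ds t. ds \<in> set dss \<Longrightarrow> t \<in> set ds \<Longrightarrow> 0 \<le> t" "\<And>ds. ds \<in> set dss \<Longrightarrow> sum_list ds < d"
      "(\<Sum>ds\<leftarrow>dss. sum_list ds) \<le> T" for dss
  proof -
    define t where "t = (\<Sum>ds\<leftarrow>dss. sum_list ds)"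
    have pos: "sum_list ds \<ge> 0" if "ds \<in> set dss" for ds
      using dss(1)[OF that] by (intro sum_list_nonneg)
    then have t: "t \<ge> 0" unfolding t_def by (intro sum_list_nonneg) auto
    interpret H: hilbert_bimodule "fib P t" by (rule fib_hilbert) fact
    define f where "f = (\<lambda>ds. y (sum_list ds))"
    have cl: "f ds \<in> E (sum_list ds)" "Y ds \<in> E (sum_list ds)" if "ds \<in> set dss" for ds
      using y_closed[OF pos[OF that]] Y_closed[of ds] dss(1)[OF that] by (auto simp: f_def)
    have eqs: "Y (map sum_list dss) = weighted_tensor P sum_list f dss"
        "Y (concat dss) = weighted_tensor P sum_list Y dss"
      using partition_tensor_map_sum_list[of y dss] partition_tensor_concat[of dss y] dss(1) y_closed
      by (auto simp: f_def)
    have cl': "weighted_tensor P sum_list f dss \<in> E t" "weighted_tensor P sum_list Y dss \<in> E t"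
      unfolding t_def using cl pos by (auto intro!: weighted_tensor_closed)
    define A where "A u v = (\<lambda>ds. K (sum_list ds) (u ds) (v ds))" for u v
    have fo: "norm (A u v ds - id_blinfun - sum_list ds *\<^sub>R M) \<le> r * sum_list ds"
      if "ds \<in> set dss" "(u, v) \<in> {(f, f), (f, Y), (Y, Y)}" for u v ds
      using d(2)[of ds] dss(1,2)[OF that(1)] that(2) by (auto simp: A_def f_def)
    have Ale: "norm (A u v ds) \<le> exp (c * sum_list ds)"
      if "ds \<in> set dss" "(u, v) \<in> {(f, f), (f, Y), (Y, Y)}" for u v ds
      unfolding c_def
    proof (rule norm_le_exp_of_first_order)
      show "norm (A u v ds - id_blinfun - sum_list ds *\<^sub>R M) \<le> 1 * sum_list ds"
        using order_trans[OF fo[OF that] mult_right_mono[OF r(2) pos[OF that(1)]]] by simp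
    qed (rule pos[OF that(1)])
    have diff: "norm (A u v ds - A u' v' ds) \<le> 2 * r * sum_list ds"
      if "ds \<in> set dss" "(u, v) \<in> {(f, f), (f, Y), (Y, Y)}" "(u', v') \<in> {(f, f), (f, Y), (Y, Y)}" for u v u' v' ds
    proof -
      have "A u v ds - A u' v' ds = (A u v ds - id_blinfun - sum_list ds *\<^sub>R M)
          - (A u' v' ds - id_blinfun - sum_list ds *\<^sub>R M)" by simp
      also have "norm \<dots> \<le> r * sum_list ds + r * sum_list ds"
        by (rule order_trans[OF norm_triangle_ineq4 add_mono[OF fo[OF that(1,2)] fo[OF that(1,3)]]])
      finally show ?thesis by simp
    qed
    have KA: "K t (weighted_tensor P sum_list u dss) (weighted_tensor P sum_list v dss) = compose_list (A u v) dss"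
      if "(u, v) \<in> {(f, f), (f, Y), (Y, Y)}" for u v
      unfolding t_def A_def by (rule K_weighted_tensor) (use that pos cl in auto)
    have cd: "norm (compose_list (A u v) dss - compose_list (A u' v') dss) \<le> exp (c * t) * (2 * r * t)"
      if "(u, v) \<in> {(f, f), (f, Y), (Y, Y)}" "(u', v') \<in> {(f, f), (f, Y), (Y, Y)}" for u v u' v'
      unfolding t_def
      by (rule norm_compose_list_diff_le) (use Ale diff that pos c r in auto)
    have "(hnorm (fib P t) (Y (map sum_list dss) - Y (concat dss)))\<^sup>2
        \<le> exp (c * t) * (2 * r * t) + exp (c * t) * (2 * r * t)"
      unfolding eqs
      by (rule order_trans[OF H.hnorm_diff_le_Kop[OF cl']]) (intro add_mono; simp only: KA insert_iff simp_thms; rule cd; simp)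
    also have "\<dots> = r * (4 * exp (c * t) * t)" by simp
    also have "\<dots> \<le> r * B"
    proof -
      have tT: "t \<le> T" using dss(3) by (simp add: t_def)
      have "exp (c * t) \<le> exp (c * T)" using mult_left_mono[OF tT c] by (simp only: exp_le_cancel_iff)
      then have "exp (c * t) * t \<le> exp (c * T) * T" using t tT by (intro mult_mono) auto
      then show ?thesis unfolding B_def using r(1) by (intro mult_left_mono) auto
    qed
    also have "\<dots> \<le> e\<^sup>2" using r(3) B by (simp add: pos_le_divide_eq)
    finally have "hnorm (fib P t) (Y (map sum_list dss) - Y (concat dss)) \<le> e"
      by (rule power2_le_imp_le) (rule less_imp_le[OF e])
    then show ?thesis unfolding t_def .
  qed
  then show ?thesis using d(1) by blast
qed

text \<open>Both partitions are coarsenings of a common refinement, and each is within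
  \<open>e / 2\<close> of it. Positive entries are what \<open>common_refinement\<close> works
  with.\<close>

lemma partitions_close:
  assumes e: "e > 0" and T: "T \<ge> 0"
  shows "\<exists>d>0. \<forall>ds es. (\<forall>t\<in>set ds \<union> set es. 0 < t \<and> t < d) \<and> sum_list ds = T \<and> sum_list es = T \<longrightarrow>
    hnorm (fib P T) (Y ds - Y es) \<le> e"
proof -
  interpret H: hilbert_bimodule "fib P T" by (rule fib_hilbert) fact
  obtain d where d: "d > 0" "\<And>dss. (\<forall>ds\<in>set dss. (\<forall>t\<in>set ds. 0 \<le> t) \<and> sum_list ds < d) \<Longrightarrow>
      (\<Sum>ds\<leftarrow>dss. sum_list ds) \<le> T \<Longrightarrow>
      hnorm (fib P (\<Sum>ds\<leftarrow>dss. sum_list ds)) (Y (map sum_list dss) - Y (concat dss)) \<le> e / 2"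
    using refinement_close[of "e / 2" T] e T by auto
  have "hnorm (fib P T) (Y ds - Y es) \<le> e"
    if *: "\<And>t. t \<in> set ds \<union> set es \<Longrightarrow> 0 < t \<and> t < d" "sum_list ds = T" "sum_list es = T" for ds es
  proof -
    have "\<exists>dss ess. map sum_list dss = ds \<and> map sum_list ess = es \<and> concat dss = concat ess
        \<and> (\<forall>d\<in>set (concat dss). d > 0)"
      by (rule common_refinement) (use * in auto)
    then obtain dss ess where r: "map sum_list dss = ds" "map sum_list ess = es" "concat dss = concat ess"
        "\<forall>d\<in>set (concat dss). d > 0"
      by (elim exE conjE) (rule that)
    have "sum_list fs < d" if "fs \<in> set dss \<union> set ess" for fs
      using *(1)[of "sum_list fs"] that r(1,2) by auto
    moreover have "0 \<le> t" if "fs \<in> set dss \<union> set ess" "t \<in> set fs" for fs t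
    proof -
      have "t \<in> set (concat dss)" using that r(3) by (metis UN_I UnE set_concat)
      then show ?thesis using r(4) less_imp_le by blast
    qed
    ultimately have "hnorm (fib P T) (Y ds - Y (concat dss)) \<le> e / 2"
        "hnorm (fib P T) (Y es - Y (concat dss)) \<le> e / 2"
      using d(2)[of dss] d(2)[of ess] r *(2,3) by auto
    moreover have "Y ds \<in> E T" "Y es \<in> E T" "Y (concat dss) \<in> E T"
      using Y_closed[of ds] Y_closed[of es] Y_closed[of "concat dss"] * r sum_list_concat_real[of dss]
      by (auto intro: less_imp_le)
    ultimately show ?thesis
      using H.hnorm_diff_triangle[of "Y ds" "Y (concat dss)" "Y es"]
        H.hnorm_minus_commute[of "Y es" "Y (concat dss)"] by simp
  qed
  then show ?thesis using d(1) by blast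
qed

end

section \<open>Convergence over fine partitions\<close>

lemma uniform_partition_fine:
  assumes t: "t > (0::real)" and d: "d > 0"
  shows "\<forall>\<^sub>F m in sequentially. (\<forall>x\<in>set (replicate m (t / real m)). 0 < x \<and> x < d)
    \<and> sum_list (replicate m (t / real m)) = t"
proof -
  have "(\<lambda>m. t / real m) \<longlonglongrightarrow> 0" by (rule lim_const_over_n)
  then have "\<forall>\<^sub>F m in sequentially. t / real m < d" using d by (rule order_tendstoD)
  then show ?thesis using eventually_gt_at_top[of "0::nat"]
    by eventually_elim (use t in \<open>simp add: sum_list_replicate\<close>)
qed

context approximate_unit
begin

text \<open>Completeness is available for sequences, so a limit is first taken along uniform
  partitions; \<open>partitions_close\<close> then extends the convergence to all fine ones.\<close>

lemma limit_exists:
  assumes t: "t \<ge> 0"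
  shows "\<exists>z\<in>E t. \<forall>e>0. \<exists>d>0. \<forall>ds. (\<forall>x\<in>set ds. 0 < x \<and> x < d) \<and> sum_list ds = t \<longrightarrow>
    hnorm (fib P t) (Y ds - z) \<le> e"
proof (cases "t = 0")
  case True
  interpret H: hilbert_bimodule "fib P 0" by (rule fib_hilbert) simp
  have "ds = []" if "\<forall>x\<in>set ds. 0 < x" "sum_list ds = 0" for ds :: "real list"
  proof (cases ds)
    case (Cons a as)
    have "sum_list as \<ge> 0" using that Cons by (intro sum_list_nonneg) (auto intro: less_imp_le)
    then show ?thesis using that Cons by auto
  qed simp
  then have "hnorm (fib P t) (Y ds - emb P 1) \<le> e"
    if "\<forall>x\<in>set ds. 0 < x \<and> x < 1" "sum_list ds = t" "e > 0" for ds e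
    using that True by fastforce
  then show ?thesis using emb_closed True by (intro bexI[of _ "emb P 1"] allI impI exI[of _ 1]) auto
next
  case False
  with t have t: "t > 0" by simp
  interpret H: hilbert_bimodule "fib P t" by (rule fib_hilbert) (use t in simp)
  \<comment> \<open>\<open>Suc\<close> skips the empty list, which does not partition a positive
    \<open>t\<close>.\<close>
  define S where "S n = Y (replicate (Suc n) (t / real (Suc n)))" for n
  have S: "S n \<in> E t" for n
    using Y_closed[of "replicate (Suc n) (t / real (Suc n))"] t
    by (simp add: S_def sum_list_replicate del: replicate_Suc of_nat_Suc)
  have fine: "\<exists>N. \<forall>n\<ge>N. (\<forall>x\<in>set (replicate (Suc n) (t / real (Suc n))). 0 < x \<and> x < d)
    \<and> sum_list (replicate (Suc n) (t / real (Suc n))) = t" if "d > 0" for d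
    using uniform_partition_fine[OF t that] unfolding eventually_sequentially by (meson le_Suc_eq)
  have "\<exists>z\<in>E t. (\<lambda>n. hnorm (fib P t) (S n - z)) \<longlonglongrightarrow> 0"
  proof (rule H.complete[OF S])
    fix e :: real assume e: "e > 0"
    obtain d where d: "d > 0" "\<And>ds es. (\<forall>t\<in>set ds \<union> set es. 0 < t \<and> t < d) \<Longrightarrow> sum_list ds = t \<Longrightarrow> sum_list es = t
        \<Longrightarrow> hnorm (fib P t) (Y ds - Y es) \<le> e / 2"
      using partitions_close[of "e / 2" t] e t by auto
    obtain N where N: "\<And>n. n \<ge> N \<Longrightarrow> (\<forall>x\<in>set (replicate (Suc n) (t / real (Suc n))). 0 < x \<and> x < d)
        \<and> sum_list (replicate (Suc n) (t / real (Suc n))) = t"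
      using fine[OF d(1)] by blast
    have "hnorm (fib P t) (S m - S n) < e" if "m \<ge> N" "n \<ge> N" for m n
    proof -
      have "hnorm (fib P t) (S m - S n) \<le> e / 2"
        unfolding S_def by (rule d(2)) (use N[OF that(1)] N[OF that(2)] in blast)+
      then show ?thesis using e by simp
    qed
    then show "\<exists>N. \<forall>m\<ge>N. \<forall>n\<ge>N. hnorm (fib P t) (S m - S n) < e" by blast
  qed
  then obtain z where z: "z \<in> E t" "(\<lambda>n. hnorm (fib P t) (S n - z)) \<longlonglongrightarrow> 0" by blast
  have "\<exists>d>0. \<forall>ds. (\<forall>x\<in>set ds. 0 < x \<and> x < d) \<and> sum_list ds = t \<longrightarrow> hnorm (fib P t) (Y ds - z) \<le> e"
    if e: "e > 0" for e
  proof -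
    obtain d where d: "d > 0" "\<And>ds es. (\<forall>t\<in>set ds \<union> set es. 0 < t \<and> t < d) \<Longrightarrow> sum_list ds = t \<Longrightarrow> sum_list es = t
        \<Longrightarrow> hnorm (fib P t) (Y ds - Y es) \<le> e / 2"
      using partitions_close[of "e / 2" t] e t by auto
    obtain N where N: "\<And>n. n \<ge> N \<Longrightarrow> (\<forall>x\<in>set (replicate (Suc n) (t / real (Suc n))). 0 < x \<and> x < d)
        \<and> sum_list (replicate (Suc n) (t / real (Suc n))) = t"
      using fine[OF d(1)] by blast
    obtain N' where N': "\<And>n. n \<ge> N' \<Longrightarrow> hnorm (fib P t) (S n - z) < e / 2"
      using order_tendstoD(2)[OF z(2), of "e / 2"] e by (auto simp: eventually_sequentially)
    have "hnorm (fib P t) (Y ds - z) \<le> e" if ds: "\<forall>x\<in>set ds. 0 < x \<and> x < d" "sum_list ds = t" for ds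
    proof -
      define n where "n = max N N'"
      have Yds: "Y ds \<in> E t" using Y_closed[of ds] ds by (auto intro: less_imp_le)
      have "hnorm (fib P t) (Y ds - S n) \<le> e / 2"
        unfolding S_def by (rule d(2)) (use N[of n] ds in \<open>auto simp: n_def simp del: replicate_Suc of_nat_Suc\<close>)
      moreover have "hnorm (fib P t) (S n - z) < e / 2" by (rule N') (simp add: n_def)
      ultimately show ?thesis using H.hnorm_diff_triangle[OF Yds S[of n] z(1)] by simp
    qed
    then show ?thesis using d(1) by blast
  qed
  then show ?thesis using z(1) by blast
qed

abbreviation Z :: "real \<Rightarrow> 'e" where "Z \<equiv> limit_unit P y"

text \<open>\<open>limit_unit\<close> is defined by uniform partitions; its values are identified
  here with the limits over all fine partitions.\<close>

lemma Z_limit: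
  assumes t: "t \<ge> 0"
  shows "Z t \<in> E t"
    and "e > 0 \<Longrightarrow> \<exists>d>0. \<forall>ds. (\<forall>x\<in>set ds. 0 < x \<and> x < d) \<and> sum_list ds = t \<longrightarrow>
      hnorm (fib P t) (Y ds - Z t) \<le> e"
proof -
  interpret H: hilbert_bimodule "fib P t" by (rule fib_hilbert) fact
  obtain z where z: "z \<in> E t" "\<And>e. e > 0 \<Longrightarrow> \<exists>d>0. \<forall>ds. (\<forall>x\<in>set ds. 0 < x \<and> x < d) \<and> sum_list ds = t \<longrightarrow>
      hnorm (fib P t) (Y ds - z) \<le> e"
    using limit_exists[OF t] by blast
  define S where "S m = tpow P (t / real m) (y (t / real m)) m" for m
  have S: "S m = Y (replicate m (t / real m))" for m
    unfolding S_def using t y_closed by (intro tpow_eq_partition_tensor) auto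
  have "hlim (fib P t) S = z"
  proof (rule H.hlim_eqI[OF z(1)])
    show "\<forall>\<^sub>F m in sequentially. S m \<in> E t"
      using eventually_gt_at_top[of "0::nat"]
    proof eventually_elim
      case (elim m)
      then show ?case using Y_closed[of "replicate m (t / real m)"] t by (simp add: S sum_list_replicate)
    qed
    show "(\<lambda>m. hnorm (fib P t) (S m - z)) \<longlonglongrightarrow> 0"
    proof (cases "t = 0")
      case True
      \<comment> \<open>At t = 0 the only partition into positive lengths is empty, while the
        uniform ones consist of zeros. Their products equal \<open>emb P 1\<close>
        nevertheless.\<close>
      have le: "hnorm (fib P t) (Y [] - z) \<le> e" if "e > 0" for e
      proof -
        obtain d where "\<forall>ds. (\<forall>x\<in>set ds. 0 < x \<and> x < d) \<and> sum_list ds = t \<longrightarrow> hnorm (fib P t) (Y ds - z) \<le> e"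
          using z(2)[OF \<open>e > 0\<close>] by blast
        from spec[OF this, of "[]"] show ?thesis using True by (simp del: weighted_tensor.simps)
      qed
      have "hnorm (fib P t) (emb P 1 - z) \<le> 0"
      proof (rule field_le_epsilon)
        show "hnorm (fib P t) (emb P 1 - z) \<le> 0 + e" if "e > 0" for e
          using le[OF that] by simp
      qed
      moreover have "S m = emb P 1" for m
        unfolding S True by (induction m) (simp_all add: y_zero sum_list_replicate tens_emb_emb)
      moreover have "hnorm (fib P t) (emb P 1 - z) = 0" by (intro antisym hnorm_nonneg) fact
      ultimately show ?thesis by simp
    next
      case False
      with t have t0: "t > 0" by simp
      show ?thesis
      proof (rule tendstoI)
        fix e :: real assume e: "e > 0"
        obtain d where d: "d > 0" "\<And>ds. (\<forall>x\<in>set ds. 0 < x \<and> x < d) \<Longrightarrow> sum_list ds = t \<Longrightarrow>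
            hnorm (fib P t) (Y ds - z) \<le> e / 2"
          using z(2)[of "e / 2"] e by auto
        show "\<forall>\<^sub>F m in sequentially. dist (hnorm (fib P t) (S m - z)) 0 < e"
          using uniform_partition_fine[OF t0 d(1)]
        proof eventually_elim
          case (elim m)
          then show ?case using d(2)[of "replicate m (t / real m)"] e unfolding S by (simp add: dist_real_def)
        qed
      qed
    qed
  qed
  then have "Z t = z" using t by (simp add: limit_unit_def S_def[abs_def])
  then show "Z t \<in> E t" "e > 0 \<Longrightarrow> \<exists>d>0. \<forall>ds. (\<forall>x\<in>set ds. 0 < x \<and> x < d) \<and> sum_list ds = t \<longrightarrow>
      hnorm (fib P t) (Y ds - Z t) \<le> e"
    using z by auto
qed

lemma Z_tendsto:
  assumes t: "t \<ge> 0" and f: "\<And>d. d > 0 \<Longrightarrow> \<forall>\<^sub>F m in F. (\<forall>x\<in>set (f m). 0 < x \<and> x < d) \<and> sum_list (f m) = t"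
  shows "((\<lambda>m. hnorm (fib P t) (Y (f m) - Z t)) \<longlongrightarrow> 0) F"
proof (rule tendstoI)
  fix e :: real assume e: "e > 0"
  obtain d where d: "d > 0" "\<And>ds. (\<forall>x\<in>set ds. 0 < x \<and> x < d) \<Longrightarrow> sum_list ds = t \<Longrightarrow>
      hnorm (fib P t) (Y ds - Z t) \<le> e / 2"
    using Z_limit(2)[OF t, of "e / 2"] e by auto
  show "\<forall>\<^sub>F m in F. dist (hnorm (fib P t) (Y (f m) - Z t)) 0 < e"
    using f[OF d(1)]
  proof eventually_elim
    case (elim m)
    then show ?case using d(2)[of "f m"] e by (simp add: dist_real_def)
  qed
qed

lemma Z_zero: "Z 0 = emb P 1"
proof -
  interpret H: hilbert_bimodule "fib P 0" by (rule fib_hilbert) simp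
  have "((\<lambda>m::nat. hnorm (fib P 0) (Y [] - Z 0)) \<longlongrightarrow> 0) sequentially"
    by (rule Z_tendsto) auto
  then have "hnorm (fib P 0) (emb P 1 - Z 0) = 0" by (simp add: LIMSEQ_const_iff)
  then show ?thesis
    using H.hnorm_eq_zero[of "emb P 1 - Z 0"] H.diff_closed[OF emb_closed Z_limit(1)] by simp
qed

text \<open>Both sides are limits of \<open>Y (f m @ g m)\<close>: this list is a fine partition of
  \<open>t + s\<close>, though in general not a uniform one, and \<open>Y\<close> turns
  concatenation into a tensor product.\<close>

lemma Z_tens:
  assumes t: "t \<ge> 0" and s: "s \<ge> 0"
  shows "tens P t s (Z t) (Z s) = Z (t + s)"
proof (cases "t = 0 \<or> s = 0")
  case True
  then show ?thesis using t s Z_limit(1) tens_emb_left tens_emb_right by (auto simp: Z_zero)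
next
  case False
  with t s have pos: "t > 0" "s > 0" by auto
  interpret T: hilbert_bimodule "fib P t" by (rule fib_hilbert) fact
  interpret S: hilbert_bimodule "fib P s" by (rule fib_hilbert) fact
  interpret H: hilbert_bimodule "fib P (t + s)" by (rule fib_hilbert) (use t s in simp)
  define f where "f m = replicate m (t / real m)" for m
  define g where "g m = replicate m (s / real m)" for m
  have f: "\<forall>\<^sub>F m in sequentially. (\<forall>x\<in>set (f m). 0 < x \<and> x < d) \<and> sum_list (f m) = t" if "d > 0" for d
    unfolding f_def by (rule uniform_partition_fine[OF pos(1) that])
  have g: "\<forall>\<^sub>F m in sequentially. (\<forall>x\<in>set (g m). 0 < x \<and> x < d) \<and> sum_list (g m) = s" if "d > 0" for d
    unfolding g_def by (rule uniform_partition_fine[OF pos(2) that])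
  have fg: "\<forall>\<^sub>F m in sequentially. (\<forall>x\<in>set (f m @ g m). 0 < x \<and> x < d) \<and> sum_list (f m @ g m) = t + s" if "d > 0" for d
    using f[OF that] g[OF that] by eventually_elim auto
  have tf: "(\<lambda>m. hnorm (fib P t) (Y (f m) - Z t)) \<longlonglongrightarrow> 0" by (rule Z_tendsto[OF t f])
  have tg: "(\<lambda>m. hnorm (fib P s) (Y (g m) - Z s)) \<longlonglongrightarrow> 0" by (rule Z_tendsto[OF s g])
  have cl: "\<forall>\<^sub>F m in sequentially. Y (f m) \<in> E t \<and> Y (g m) \<in> E s \<and> Y (f m @ g m) = tens P t s (Y (f m)) (Y (g m))"
    using f[OF zero_less_one] g[OF zero_less_one]
  proof eventually_elim
    case (elim m)
    have nn: "0 \<le> d \<and> y d \<in> E d" if "d \<in> set (f m) \<union> set (g m)" for d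
      using elim that y_closed[of d] by (auto intro: less_imp_le)
    then have "Y (f m @ g m) = tens P (sum_list (f m)) (sum_list (g m)) (Y (f m)) (Y (g m))"
      by (intro partition_tensor_append)
    then show ?case using elim Y_closed[of "f m"] Y_closed[of "g m"] nn by auto
  qed
  have lim: "(\<lambda>m. hnorm (fib P (t + s)) (Y (f m @ g m) - tens P t s (Z t) (Z s))) \<longlonglongrightarrow> 0"
  proof (rule tendsto_sandwich[OF _ _ tendsto_const])
    show "\<forall>\<^sub>F m in sequentially. 0 \<le> hnorm (fib P (t + s)) (Y (f m @ g m) - tens P t s (Z t) (Z s))" by simp
    show "\<forall>\<^sub>F m in sequentially. hnorm (fib P (t + s)) (Y (f m @ g m) - tens P t s (Z t) (Z s))
      \<le> hnorm (fib P t) (Y (f m) - Z t) * (hnorm (fib P s) (Z s) + hnorm (fib P s) (Y (g m) - Z s))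
        + hnorm (fib P t) (Z t) * hnorm (fib P s) (Y (g m) - Z s)"
      using cl
    proof eventually_elim
      case (elim m)
      note Zt = Z_limit(1)[OF t] and Zs = Z_limit(1)[OF s]
      have "Y (f m @ g m) - tens P t s (Z t) (Z s)
          = tens P t s (Y (f m) - Z t) (Y (g m)) + tens P t s (Z t) (Y (g m) - Z s)"
        using elim t s Zt Zs by (simp add: tens_diff_left tens_diff_right)
      also have "hnorm (fib P (t + s)) \<dots> \<le> hnorm (fib P t) (Y (f m) - Z t) * hnorm (fib P s) (Y (g m))
          + hnorm (fib P t) (Z t) * hnorm (fib P s) (Y (g m) - Z s)"
        using elim t s Zt Zs
        by (intro order_trans[OF H.hnorm_triangle] add_mono hnorm_tens tens_closed T.diff_closed S.diff_closed) auto
      also have "\<dots> \<le> hnorm (fib P t) (Y (f m) - Z t) * (hnorm (fib P s) (Z s) + hnorm (fib P s) (Y (g m) - Z s))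
          + hnorm (fib P t) (Z t) * hnorm (fib P s) (Y (g m) - Z s)"
        using elim Zs by (intro add_right_mono mult_left_mono S.hnorm_le_add_diff) auto
      finally show ?case .
    qed
    have "(\<lambda>m. hnorm (fib P t) (Y (f m) - Z t) * (hnorm (fib P s) (Z s) + hnorm (fib P s) (Y (g m) - Z s))
        + hnorm (fib P t) (Z t) * hnorm (fib P s) (Y (g m) - Z s))
      \<longlonglongrightarrow> 0 * (hnorm (fib P s) (Z s) + 0) + hnorm (fib P t) (Z t) * 0"
      by (intro tendsto_intros tf tg)
    then show "(\<lambda>m. hnorm (fib P t) (Y (f m) - Z t) * (hnorm (fib P s) (Z s) + hnorm (fib P s) (Y (g m) - Z s))
        + hnorm (fib P t) (Z t) * hnorm (fib P s) (Y (g m) - Z s)) \<longlonglongrightarrow> 0" by simp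
  qed
  show ?thesis
  proof (rule H.hlimit_unique[OF _ _ _ lim])
    show "tens P t s (Z t) (Z s) \<in> E (t + s)" using t s by (intro tens_closed Z_limit)
    show "Z (t + s) \<in> E (t + s)" using t s by (intro Z_limit) simp
    show "\<forall>\<^sub>F m in sequentially. Y (f m @ g m) \<in> E (t + s)"
      using cl by eventually_elim (use t s tens_closed in auto)
    show "(\<lambda>m. hnorm (fib P (t + s)) (Y (f m @ g m) - Z (t + s))) \<longlonglongrightarrow> 0"
      by (rule Z_tendsto) (use t s fg in auto)
  qed
qed

lemma Z_unit: "Z \<in> units P"
  unfolding units_def using Z_limit(1) Z_zero Z_tens by (auto simp: limit_unit_def)

text \<open>The first order estimate for products of \<open>A\<close> is uniform in the partition
  and therefore survives the limit without any change of \<open>N\<close>.\<close>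

lemma has_gen_limit:
  assumes A: "has_gen A N" and B0: "B 0 = id_blinfun"
    and lim: "\<And>t. t > 0 \<Longrightarrow> (\<lambda>m. compose_list A (replicate m (t / real m))) \<longlonglongrightarrow> B t"
  shows "has_gen B N"
  unfolding has_gen_iff
proof (intro conjI allI impI)
  fix e :: real assume e: "e > 0"
  obtain d where d: "d > 0" "\<And>xs. (\<forall>x\<in>set xs. 0 \<le> x) \<Longrightarrow> sum_list xs < d \<Longrightarrow>
      norm (compose_list A xs - id_blinfun - sum_list xs *\<^sub>R N) \<le> e * sum_list xs"
    using has_gen_compose_list[OF A e] by blast
  have "norm (B t - id_blinfun - t *\<^sub>R N) \<le> e * t" if t: "0 \<le> t" "t < d" for t
  proof (cases "t = 0")
    case False
    with t have t0: "t > 0" by simp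
    have "(\<lambda>m. norm (compose_list A (replicate m (t / real m)) - id_blinfun - t *\<^sub>R N))
        \<longlonglongrightarrow> norm (B t - id_blinfun - t *\<^sub>R N)"
      by (intro tendsto_intros lim t0)
    moreover have "\<forall>\<^sub>F m in sequentially. norm (compose_list A (replicate m (t / real m)) - id_blinfun - t *\<^sub>R N) \<le> e * t"
      using uniform_partition_fine[OF t0 zero_less_one]
      by eventually_elim (use d(2) t(2) in \<open>metis less_imp_le\<close>)
    ultimately show ?thesis by (rule tendsto_upperbound) simp
  qed (simp add: B0)
  then show "\<exists>d>0. \<forall>t. 0 \<le> t \<and> t < d \<longrightarrow> norm (B t - id_blinfun - t *\<^sub>R N) \<le> e * t"
    using d(1) by blast
qed (rule B0)

lemma Y_uniform:
  assumes t: "t > 0"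
  shows "\<forall>\<^sub>F m in sequentially. Y (replicate m (t / real m)) \<in> E t"
    and "(\<lambda>m. hnorm (fib P t) (Y (replicate m (t / real m)) - Z t)) \<longlonglongrightarrow> 0"
proof -
  show "\<forall>\<^sub>F m in sequentially. Y (replicate m (t / real m)) \<in> E t"
    using uniform_partition_fine[OF t zero_less_one]
    by eventually_elim (use Y_closed in \<open>metis less_imp_le\<close>)
  show "(\<lambda>m. hnorm (fib P t) (Y (replicate m (t / real m)) - Z t)) \<longlonglongrightarrow> 0"
    by (rule Z_tendsto) (use t uniform_partition_fine in auto)
qed

lemma has_gen_unit_Z:
  assumes \<xi>: "\<xi> \<in> units P" and N: "has_gen (\<lambda>s. K s (\<xi> s) (y s)) N"
  shows "has_gen (\<lambda>s. K s (\<xi> s) (Z s)) N"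
proof (rule has_gen_limit[OF N])
  show "K 0 (\<xi> 0) (Z 0) = id_blinfun" using \<xi> by (simp add: unit_zero Z_zero K_emb_one)
  fix t :: real assume t: "t > 0"
  interpret H: hilbert_bimodule "fib P t" by (rule fib_hilbert) (use t in simp)
  have "(\<lambda>m. K t (\<xi> t) (Y (replicate m (t / real m)))) \<longlonglongrightarrow> K t (\<xi> t) (Z t)"
    using t unit_closed[OF \<xi>, of t] Z_limit(1)[of t] by (intro H.tendsto_Kop Y_uniform) auto
  moreover have "\<forall>\<^sub>F m in sequentially. K t (\<xi> t) (Y (replicate m (t / real m)))
      = compose_list (\<lambda>s. K s (\<xi> s) (y s)) (replicate m (t / real m))"
    using uniform_partition_fine[OF t zero_less_one]
  proof eventually_elim
    case (elim m)
    let ?ds = "replicate m (t / real m)"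
    have "\<And>d. d \<in> set ?ds \<Longrightarrow> 0 \<le> d" using elim less_imp_le by blast
    then have "K (sum_list ?ds) (\<xi> (sum_list ?ds)) (Y ?ds) = compose_list (\<lambda>s. K s (\<xi> s) (y s)) ?ds"
      using K_unit_Y[OF \<xi>, of ?ds] by blast
    then show ?case unfolding conjunct2[OF elim] .
  qed
  ultimately show "(\<lambda>m. compose_list (\<lambda>s. K s (\<xi> s) (y s)) (replicate m (t / real m))) \<longlonglongrightarrow> K t (\<xi> t) (Z t)"
    by (rule Lim_transform_eventually)
qed

lemma has_gen_Z_Z: "has_gen (\<lambda>s. K s (Z s) (Z s)) M"
proof (rule has_gen_limit[OF gen_y])
  show "K 0 (Z 0) (Z 0) = id_blinfun" by (simp add: Z_zero K_emb_one)
  fix t :: real assume t: "t > 0"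
  interpret H: hilbert_bimodule "fib P t" by (rule fib_hilbert) (use t in simp)
  have "(\<lambda>m. K t (Y (replicate m (t / real m))) (Y (replicate m (t / real m)))) \<longlonglongrightarrow> K t (Z t) (Z t)"
    using t Z_limit(1)[of t] by (intro H.tendsto_Kop Y_uniform) auto
  moreover have "\<forall>\<^sub>F m in sequentially. K t (Y (replicate m (t / real m))) (Y (replicate m (t / real m)))
      = compose_list (\<lambda>s. K s (y s) (y s)) (replicate m (t / real m))"
    using uniform_partition_fine[OF t zero_less_one]
  proof eventually_elim
    case (elim m)
    let ?ds = "replicate m (t / real m)"
    have "\<And>d. d \<in> set ?ds \<Longrightarrow> 0 \<le> d" using elim less_imp_le by blast
    then have "K (sum_list ?ds) (Y ?ds) (Y ?ds) = compose_list (\<lambda>s. K s (y s) (y s)) ?ds"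
      using K_Y_Y[of ?ds] by blast
    then show ?case unfolding conjunct2[OF elim] .
  qed
  ultimately show "(\<lambda>m. compose_list (\<lambda>s. K s (y s) (y s)) (replicate m (t / real m))) \<longlonglongrightarrow> K t (Z t) (Z t)"
    by (rule Lim_transform_eventually)
qed

end

section \<open>The maximal continuous set of units\<close>

lemma at_zero_within_nonneg: "at 0 within {0::real..} \<noteq> bot"
proof
  assume "at 0 within {0::real..} = bot"
  moreover have "at_right (0::real) \<le> at 0 within {0..}" by (rule at_le) auto
  ultimately have "at_right (0::real) \<le> bot" by simp
  then show False using trivial_limit_at_right_real[of "0::real"] by (simp add: bot.extremum_unique)
qed

lemma has_gen_cong: "has_gen A N \<Longrightarrow> (\<And>t. t \<ge> 0 \<Longrightarrow> B t = A t) \<Longrightarrow> has_gen B N"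
  unfolding has_gen_def using has_vector_derivative_transform[of 0 "{0..}" B A N] by auto

lemma has_gen_tendsto:
  assumes "has_gen A N"
  shows "((\<lambda>t. (1 / t) *\<^sub>R (A t - id_blinfun)) \<longlongrightarrow> N) (at_right 0)"
proof (rule tendstoI)
  fix e :: real assume e: "e > 0"
  obtain d where d: "d > 0" "\<And>t. 0 \<le> t \<Longrightarrow> t < d \<Longrightarrow> norm (A t - id_blinfun - t *\<^sub>R N) \<le> e / 2 * t"
    using has_genD[OF assms, of "e / 2"] e by auto
  have "dist ((1 / t) *\<^sub>R (A t - id_blinfun)) N < e" if t: "0 < t" "t < d" for t
  proof -
    have "(1 / t) *\<^sub>R (A t - id_blinfun) - N = (1 / t) *\<^sub>R (A t - id_blinfun - t *\<^sub>R N)"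
      using t by (simp add: scaleR_diff_right)
    then have "dist ((1 / t) *\<^sub>R (A t - id_blinfun)) N = (1 / t) * norm (A t - id_blinfun - t *\<^sub>R N)"
      using t by (simp add: dist_norm)
    also have "\<dots> \<le> (1 / t) * (e / 2 * t)" using d(2)[of t] t by (intro mult_left_mono) auto
    also have "\<dots> < e" using t e by simp
    finally show ?thesis .
  qed
  then show "\<forall>\<^sub>F t in at_right 0. dist ((1 / t) *\<^sub>R (A t - id_blinfun)) N < e"
    unfolding eventually_at_right_field using d(1) by blast
qed

lemma has_vector_derivative_sum_list:
  "(\<And>p. p \<in> set ps \<Longrightarrow> (f p has_vector_derivative f' p) F) \<Longrightarrow>
    ((\<lambda>s. \<Sum>p\<leftarrow>ps. f p s) has_vector_derivative (\<Sum>p\<leftarrow>ps. f' p)) F"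
  by (induction ps) (auto intro!: derivative_eq_intros)

context product_system
begin

lemma kernel_eq: "kernel P u v t = K t (u t) (v t)"
  by (simp add: kernel_def Kop_def)

lemma kernel_apply:
  "u \<in> units P \<Longrightarrow> v \<in> units P \<Longrightarrow> t \<ge> 0 \<Longrightarrow>
    blinfun_apply (kernel P u v t) b = ip (fib P t) (u t) (lact (fib P t) b (v t))"
  using hilbert_bimodule.Kop_apply[OF fib_hilbert] unit_closed by (simp add: kernel_eq)

lemma kernel_zero: "u \<in> units P \<Longrightarrow> v \<in> units P \<Longrightarrow> kernel P u v 0 = id_blinfun"
  by (simp add: kernel_eq unit_zero K_emb_one)

lemma kernel_semigroup:
  "u \<in> units P \<Longrightarrow> v \<in> units P \<Longrightarrow> t \<ge> 0 \<Longrightarrow> s \<ge> 0 \<Longrightarrow>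
    kernel P u v (t + s) = kernel P u v s o\<^sub>L kernel P u v t"
  using K_tens[of t s "u t" "u s" "v t" "v s"] unit_closed unit_tens by (simp add: kernel_eq)

lemma kernel_flip:
  "u \<in> units P \<Longrightarrow> v \<in> units P \<Longrightarrow> t \<ge> 0 \<Longrightarrow> kernel P v u t = blinfun_conj (kernel P u v t)"
  unfolding kernel_eq by (rule hilbert_bimodule.Kop_flip[OF fib_hilbert]) (simp_all add: unit_closed)

lemma kernel_continuous:
  assumes "u \<in> units P" "v \<in> units P" "(kernel P u v \<longlongrightarrow> id_blinfun) (at_right 0)"
  shows "continuous_on {0..} (kernel P u v)"
proof (rule semigroup_continuous)
  show "kernel P u v (t + s) = kernel P u v s o\<^sub>L kernel P u v t" if "t \<ge> 0" "s \<ge> 0" for t s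
    by (rule kernel_semigroup[OF assms(1,2) that])
  show "(kernel P u v \<longlongrightarrow> id_blinfun) (at_right 0)" by fact
  show "kernel P u v 0 = id_blinfun" by (rule kernel_zero[OF assms(1,2)])
qed

lemma kernel_has_gen:
  assumes "u \<in> units P" "v \<in> units P" "continuous_on {0..} (kernel P u v)"
  shows "\<exists>N. has_gen (kernel P u v) N"
proof (rule semigroup_differentiable)
  show "kernel P u v (t + s) = kernel P u v s o\<^sub>L kernel P u v t" if "t \<ge> 0" "s \<ge> 0" for t s
    by (rule kernel_semigroup[OF assms(1,2) that])
  show "continuous_on {0..} (kernel P u v)" by fact
  show "kernel P u v 0 = id_blinfun" by (rule kernel_zero[OF assms(1,2)])
qed

lemma gen_eqI: "has_gen (kernel P u v) N \<Longrightarrow> gen P u v = N"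
  unfolding gen_def has_gen_def using vector_derivative_within[OF at_zero_within_nonneg] by blast

lemma kernel_tendsto_at_zero:
  assumes "u \<in> units P" "v \<in> units P" "continuous_on {0..} (kernel P u v)"
  shows "(kernel P u v \<longlongrightarrow> id_blinfun) (at_right 0)"
proof -
  have "(kernel P u v \<longlongrightarrow> kernel P u v 0) (at 0 within {0..})"
    using assms(3) by (simp add: continuous_on)
  then have "(kernel P u v \<longlongrightarrow> kernel P u v 0) (at 0 within {0<..})"
    by (rule tendsto_within_subset) auto
  then show ?thesis by (simp add: kernel_zero assms)
qed

lemma max_units_units: "x \<in> max_units P \<omega> \<Longrightarrow> x \<in> units P"
  by (auto simp: max_units_def continuous_unit_set_def)

lemma max_units_continuous_base:
  assumes "x \<in> max_units P \<omega>" "u \<in> {x, \<omega>}" "v \<in> {x, \<omega>}"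
  shows "u \<in> units P" "v \<in> units P" "(kernel P u v \<longlongrightarrow> id_blinfun) (at_right 0)"
proof -
  show u: "u \<in> units P" and v: "v \<in> units P"
    using assms by (auto simp: max_units_def continuous_unit_set_def)
  have "continuous_on {0..} (kernel P u v)"
    using assms unfolding max_units_def continuous_unit_set_def by blast
  with u v show "(kernel P u v \<longlongrightarrow> id_blinfun) (at_right 0)" by (rule kernel_tendsto_at_zero)
qed

text \<open>By \<open>hnorm_diff_le_Kop\<close>, as the three kernels involved all tend to the
  identity.\<close>

lemma max_units_distance:
  assumes x: "x \<in> max_units P \<omega>"
  shows "((\<lambda>t. hnorm (fib P t) (x t - \<omega> t)) \<longlongrightarrow> 0) (at_right 0)"
proof -
  note c = max_units_continuous_base[OF x]
  have xu: "x \<in> units P" and wu: "\<omega> \<in> units P" using c by auto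
  have "((\<lambda>t. sqrt (norm (kernel P x x t - kernel P x \<omega> t) + norm (kernel P \<omega> \<omega> t - kernel P x \<omega> t)))
      \<longlongrightarrow> sqrt (norm (id_blinfun - id_blinfun :: 'b \<Rightarrow>\<^sub>L 'b) + norm (id_blinfun - id_blinfun :: 'b \<Rightarrow>\<^sub>L 'b))) (at_right 0)"
    by (intro tendsto_intros c) auto
  then have "((\<lambda>t. sqrt (norm (kernel P x x t - kernel P x \<omega> t) + norm (kernel P \<omega> \<omega> t - kernel P x \<omega> t)))
      \<longlongrightarrow> 0) (at_right 0)" by simp
  then show ?thesis
  proof (rule tendsto_sandwich[OF _ _ tendsto_const, rotated 2])
    show "\<forall>\<^sub>F t in at_right 0. 0 \<le> hnorm (fib P t) (x t - \<omega> t)" by simp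
    show "\<forall>\<^sub>F t in at_right 0. hnorm (fib P t) (x t - \<omega> t)
        \<le> sqrt (norm (kernel P x x t - kernel P x \<omega> t) + norm (kernel P \<omega> \<omega> t - kernel P x \<omega> t))"
      using eventually_at_right_less[of 0]
    proof eventually_elim
      case (elim t)
      then show ?case
        using hilbert_bimodule.hnorm_diff_le_Kop[OF fib_hilbert, of t "x t" "\<omega> t"] unit_closed[OF xu] unit_closed[OF wu]
        by (simp add: kernel_eq real_le_rsqrt)
    qed
  qed
qed

text \<open>Maximality: closeness to \<open>\<omega>\<close> at small times is transitive.\<close>

lemma max_units_continuous:
  assumes x: "x \<in> max_units P \<omega>" and z: "z \<in> max_units P \<omega>"
  shows "(kernel P x z \<longlongrightarrow> id_blinfun) (at_right 0)"
proof -
  have u: "x \<in> units P" "z \<in> units P" "\<omega> \<in> units P"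
    using max_units_units x z max_units_continuous_base[OF x] by blast+
  have "((\<lambda>t. sqrt (norm (kernel P x x t)) * hnorm (fib P t) (z t - \<omega> t))
      \<longlongrightarrow> sqrt (norm (id_blinfun :: 'b \<Rightarrow>\<^sub>L 'b)) * 0) (at_right 0)"
    by (intro tendsto_intros max_units_continuous_base[OF x] max_units_distance[OF z]) auto
  then have lim: "((\<lambda>t. sqrt (norm (kernel P x x t)) * hnorm (fib P t) (z t - \<omega> t)) \<longlongrightarrow> 0) (at_right 0)"
    by simp
  have "((\<lambda>t. K t (x t) (z t - \<omega> t)) \<longlongrightarrow> 0) (at_right 0)"
  proof (rule Lim_null_comparison[OF _ lim])
    show "\<forall>\<^sub>F t in at_right 0. norm (K t (x t) (z t - \<omega> t)) \<le> sqrt (norm (kernel P x x t)) * hnorm (fib P t) (z t - \<omega> t)"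
      using eventually_at_right_less[of 0]
    proof eventually_elim
      case (elim t)
      interpret H: hilbert_bimodule "fib P t" by (rule fib_hilbert) (use elim in simp)
      have cl: "x t \<in> E t" "z t \<in> E t" "\<omega> t \<in> E t" using unit_closed u elim by auto
      have "(hnorm (fib P t) (x t))\<^sup>2 \<le> norm (kernel P x x t)"
        using norm_blinfun[of "kernel P x x t" 1] cl elim
        by (simp add: hnorm_power2 kernel_apply u H.lact_one)
      then have "hnorm (fib P t) (x t) \<le> sqrt (norm (kernel P x x t))" by (rule real_le_rsqrt)
      then show ?case
        using cl by (intro order_trans[OF H.norm_Kop] mult_right_mono H.diff_closed) auto
    qed
  qed
  then have "((\<lambda>t. kernel P x \<omega> t + K t (x t) (z t - \<omega> t)) \<longlongrightarrow> id_blinfun + 0) (at_right 0)"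
    by (intro tendsto_add max_units_continuous_base[OF x]) auto
  then have lim2: "((\<lambda>t. kernel P x \<omega> t + K t (x t) (z t - \<omega> t)) \<longlongrightarrow> id_blinfun) (at_right 0)" by simp
  show ?thesis
  proof (rule Lim_transform_eventually[OF lim2])
    show "\<forall>\<^sub>F t in at_right 0. kernel P x \<omega> t + K t (x t) (z t - \<omega> t) = kernel P x z t"
      using eventually_at_right_less[of 0]
    proof eventually_elim
      case (elim t)
      then show ?case using hilbert_bimodule.Kop_diff_right[OF fib_hilbert, of t "x t" "z t" "\<omega> t"] u unit_closed
        by (simp add: kernel_eq)
    qed
  qed
qed

text \<open>Gives \<open>gen\<close> its meaning: \<open>vector_derivative\<close> is a choice, and
  differentiability of the semigroup shows that there is something to choose.\<close>

lemma max_units_has_gen: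
  assumes "x \<in> max_units P \<omega>" "z \<in> max_units P \<omega>"
  shows "has_gen (kernel P x z) (gen P x z)"
proof -
  have u: "x \<in> units P" "z \<in> units P" using assms max_units_units by blast+
  obtain N where "has_gen (kernel P x z) N"
    using kernel_has_gen[OF u kernel_continuous[OF u max_units_continuous[OF assms]]] by blast
  then show ?thesis using gen_eqI by metis
qed

lemma gen_flip:
  assumes "x \<in> max_units P \<omega>" "z \<in> max_units P \<omega>"
  shows "gen P z x = blinfun_conj (gen P x z)"
proof (rule gen_eqI, rule has_gen_cong)
  have u: "x \<in> units P" "z \<in> units P" using assms max_units_units by blast+
  show "kernel P z x t = blinfun_conj (kernel P x z t)" if "t \<ge> 0" for t
    using kernel_flip[OF u that] .
  show "has_gen (\<lambda>t. blinfun_conj (kernel P x z t)) (blinfun_conj (gen P x z))"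
    using max_units_has_gen[OF assms] unfolding has_gen_def
    by (auto intro: bounded_linear.has_vector_derivative[OF bounded_linear_blinfun_conj])
qed

text \<open>Elements of \<open>'b \<Rightarrow>\<^sub>L 'b\<close> are only known to be real linear.
  For kernels complex scalars can be pulled out of the inner product, and uniqueness of the
  derivative passes this on to the generator.\<close>

lemma gen_scaleC:
  assumes "x \<in> max_units P \<omega>" "z \<in> max_units P \<omega>"
  shows "blinfun_apply (gen P x z) (\<alpha> *\<^sub>C b) = \<alpha> *\<^sub>C blinfun_apply (gen P x z) b"
proof -
  have u: "x \<in> units P" "z \<in> units P" using assms max_units_units by blast+
  have bl: "bounded_linear (\<lambda>a. \<alpha> *\<^sub>C (a :: 'b))"
    by (rule bounded_linear_intro[of _ "cmod \<alpha>"])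
      (simp_all add: scaleC_add_right norm_scaleC mult.commute scaleC_scaleC flip: scaleC_of_real)
  have hvd: "(kernel P x z has_vector_derivative gen P x z) (at 0 within {0..})"
    using max_units_has_gen[OF assms] by (simp add: has_gen_def)
  have app: "((\<lambda>t. blinfun_apply (kernel P x z t) a) has_vector_derivative blinfun_apply (gen P x z) a) (at 0 within {0..})" for a
    by (rule bounded_linear.has_vector_derivative[OF _ hvd]) (rule blinfun.bounded_linear_left)
  have "((\<lambda>t. blinfun_apply (kernel P x z t) (\<alpha> *\<^sub>C b)) has_vector_derivative \<alpha> *\<^sub>C blinfun_apply (gen P x z) b) (at 0 within {0..})"
  proof (rule has_vector_derivative_transform)
    show "((\<lambda>t. \<alpha> *\<^sub>C blinfun_apply (kernel P x z t) b) has_vector_derivative \<alpha> *\<^sub>C blinfun_apply (gen P x z) b) (at 0 within {0..})"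
      by (rule bounded_linear.has_vector_derivative[OF bl app])
    show "blinfun_apply (kernel P x z t) (\<alpha> *\<^sub>C b) = \<alpha> *\<^sub>C blinfun_apply (kernel P x z t) b" if "t \<in> {0..}" for t
      using that u unit_closed hilbert_bimodule.ip_lact_scaleC[OF fib_hilbert] by (simp add: kernel_apply)
  qed simp
  then show ?thesis
    using vector_derivative_unique_within[OF at_zero_within_nonneg app] by blast
qed

text \<open>In the alternating sum of the four difference quotients the identities cancel, and what
  is left is the kernel of \<open>x t - z t\<close> with itself. With \<omega> for \<open>z\<close>
  this gives positivity of the forms, in general the limit formula for differences.\<close>

lemma difference_quotient_tendsto:
  assumes x: "x \<in> max_units P \<omega>" and z: "z \<in> max_units P \<omega>"
  shows "((\<lambda>t. ip (fib P t) (x t - z t) (lact (fib P t) b (x t - z t)) /\<^sub>R t)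
    \<longlongrightarrow> blinfun_apply (gen P x x - gen P x z - gen P z x + gen P z z) b) (at_right 0)"
proof -
  have u: "x \<in> units P" "z \<in> units P" using x z max_units_units by blast+
  let ?q = "\<lambda>u v t. (1 / t) *\<^sub>R (kernel P u v t - id_blinfun)"
  have "((\<lambda>t. blinfun_apply (?q x x t - ?q x z t - ?q z x t + ?q z z t) b)
      \<longlongrightarrow> blinfun_apply (gen P x x - gen P x z - gen P z x + gen P z z) b) (at_right 0)"
    by (intro tendsto_intros has_gen_tendsto max_units_has_gen[where \<omega> = \<omega>] x z)
  then show ?thesis
  proof (rule Lim_transform_eventually)
    show "\<forall>\<^sub>F t in at_right 0. blinfun_apply (?q x x t - ?q x z t - ?q z x t + ?q z z t) b
        = ip (fib P t) (x t - z t) (lact (fib P t) b (x t - z t)) /\<^sub>R t"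
      using eventually_at_right_less[of 0]
    proof eventually_elim
      case (elim t)
      interpret H: hilbert_bimodule "fib P t" by (rule fib_hilbert) (use elim in simp)
      have cl: "x t \<in> E t" "z t \<in> E t" using unit_closed u elim by auto
      have "ip (fib P t) (x t - z t) (lact (fib P t) b (x t - z t))
          = blinfun_apply (K t (x t - z t) (x t - z t)) b"
        using cl by (simp add: H.Kop_apply H.diff_closed)
      also have "\<dots> = blinfun_apply (kernel P x x t - kernel P x z t - kernel P z x t + kernel P z z t) b"
        using cl by (simp add: H.Kop_diff_left H.Kop_diff_right H.diff_closed kernel_eq algebra_simps)
      finally show ?case using elim
        by (simp add: blinfun.diff_left blinfun.add_left blinfun.scaleR_left inverse_eq_divide
            flip: scaleR_diff_right scaleR_add_right)
    qed
  qed
qed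

end

lemma (in approximate_unit) Z_max_units:
  assumes \<omega>: "continuous_unit P \<omega>" and N: "\<exists>N. has_gen (\<lambda>s. K s (\<omega> s) (y s)) N"
  shows "Z \<in> max_units P \<omega>"
proof -
  obtain N where "has_gen (\<lambda>s. K s (\<omega> s) (y s)) N" using N by blast
  then have g: "has_gen (kernel P \<omega> Z) N"
    using has_gen_unit_Z[OF unit_\<omega>] by (simp add: kernel_eq[abs_def])
  have c1: "continuous_on {0..} (kernel P \<omega> Z)"
    by (rule kernel_continuous[OF unit_\<omega> Z_unit has_gen_continuous_at_zero[OF g]])
  have "has_gen (kernel P Z Z) M" using has_gen_Z_Z by (simp add: kernel_eq[abs_def])
  then have c2: "continuous_on {0..} (kernel P Z Z)"
    by (rule kernel_continuous[OF Z_unit Z_unit has_gen_continuous_at_zero])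
  have "continuous_on {0..} (\<lambda>t. blinfun_conj (kernel P \<omega> Z t))"
    by (rule bounded_linear.continuous_on[OF bounded_linear_blinfun_conj c1])
  then have "continuous_on {0..} (kernel P Z \<omega>)"
    by (rule continuous_on_eq) (simp add: kernel_flip[OF unit_\<omega> Z_unit])
  then show ?thesis
    using \<omega> c1 c2 Z_unit unit_\<omega>
    by (auto simp: max_units_def continuous_unit_def continuous_unit_set_def)
qed

section \<open>The bimodule operations on units\<close>

text \<open>The entries \<open>(\<kappa>, x, \<rho>, \<rho>')\<close> of \<open>ps\<close> consist of a coefficient \<open>\<kappa>\<close>, a unit \<open>x\<close>, and a
  function \<open>\<rho>\<close> with derivative \<open>\<rho>'\<close> at \<open>0\<close>.\<close>

definition combination :: "('b::unital_cstar_algebra, 'e::ab_group_add) prodsys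
    \<Rightarrow> ('b \<times> (real \<Rightarrow> 'e) \<times> (real \<Rightarrow> 'b) \<times> 'b) list \<Rightarrow> real \<Rightarrow> 'e"
  where "combination P ps s = (\<Sum>(\<kappa>, x, \<rho>, \<rho>')\<leftarrow>ps. lact (fib P s) \<kappa> (ract (fib P s) (x s) (\<rho> s)))"

lemma norm_blinfun_mult_right_le: "norm (blinfun_mult_right (a::'a::real_normed_algebra)) \<le> norm a"
  by (rule norm_blinfun_bound) (simp_all add: norm_mult_ineq)

lemma (in hilbert_bimodule) norm_Kop_bimodule_left:
  assumes "x \<in> car M" "y \<in> car M" "norm c \<le> R"
  shows "norm (Kop M (lact M a (ract M x c)) y) \<le> R * norm a * norm (Kop M x y)"
proof -
  have "norm (Kop M (lact M a (ract M x c)) y) \<le> norm (star c) * (norm (Kop M x y) * norm (star a))"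
    unfolding Kop_bimodule_left[OF assms(1,2)]
    by (intro order_trans[OF norm_blinfun_compose] mult_mono order_refl norm_blinfun_mult_right_le) auto
  also have "\<dots> \<le> R * (norm (Kop M x y) * norm a)"
    using assms(3) by (simp add: mult_right_mono)
  finally show ?thesis by (simp add: mult_ac)
qed

context product_system
begin

text \<open>One statement for all limit constructions: \<rho> constantly 1 gives
  \<open>lbox\<close>, \<kappa> = 1 with constant \<rho> gives \<open>rbox\<close>, and \<kappa> = 1
  with an exponential gives \<open>unit_exp\<close>. The formula is the product rule at 0, where the
  kernel itself is the identity; this leaves the summand
  \<open>b * \<kappa> * \<rho>'\<close>.\<close>

lemma combination_generates:
  assumes \<omega>: "continuous_unit P \<omega>"
    and ps: "\<And>\<kappa> x \<rho> \<rho>'. (\<kappa>, x, \<rho>, \<rho>') \<in> set ps \<Longrightarrow> x \<in> max_units P \<omega>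
      \<and> (\<rho> has_vector_derivative \<rho>') (at 0 within {0..}) \<and> (\<forall>s. 0 \<le> s \<and> s \<le> 1 \<longrightarrow> norm (\<rho> s) \<le> R)"
    and one: "(\<Sum>(\<kappa>, x, \<rho>, \<rho>')\<leftarrow>ps. \<kappa> * \<rho> 0) = 1" and R: "R \<ge> 0"
  shows "limit_unit P (combination P ps) \<in> max_units P \<omega>"
    and "\<xi> \<in> max_units P \<omega> \<Longrightarrow> blinfun_apply (gen P \<xi> (limit_unit P (combination P ps))) b
      = (\<Sum>(\<kappa>, x, \<rho>, \<rho>')\<leftarrow>ps. blinfun_apply (gen P \<xi> x) (b * \<kappa>) * \<rho> 0 + b * \<kappa> * \<rho>')"
proof -
  have w: "\<omega> \<in> max_units P \<omega>" using \<omega> by (simp add: max_units_def continuous_unit_def)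
  then have wu: "\<omega> \<in> units P" by (rule max_units_units)
  interpret PP: pointed_product_system P \<omega> by unfold_locales (rule wu)
  define y where "y = combination P ps"
  define summand where "summand p s = (case p of (\<kappa>, x, \<rho>, \<rho>' :: 'b) \<Rightarrow> lact (fib P s) \<kappa> (ract (fib P s) (x s) (\<rho> s)))" for p s
  have y_eq: "y s = (\<Sum>p\<leftarrow>ps. summand p s)" for s
    by (simp add: y_def combination_def summand_def)
  have cl: "summand p s \<in> E s" if "p \<in> set ps" "s \<ge> 0" for p s
  proof -
    interpret H: hilbert_bimodule "fib P s" by (rule fib_hilbert) fact
    obtain \<kappa> x \<rho> \<rho>' where p: "p = (\<kappa>, x, \<rho>, \<rho>')" by (cases p) auto
    then show ?thesis using ps[of \<kappa> x \<rho> \<rho>'] that max_units_units unit_closed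
      by (auto simp: summand_def intro!: H.closed_rules)
  qed
  have yc: "y s \<in> E s" if "s \<ge> 0" for s
    unfolding y_eq by (rule hilbert_bimodule.sum_list_closed[OF fib_hilbert[OF that] cl[OF _ that]])
  have emb0: "emb P 0 = 0" using emb_add[of 0 0] by simp
  have summand0: "summand p 0 = emb P (case p of (\<kappa>, x, \<rho>, \<rho>') \<Rightarrow> \<kappa> * \<rho> 0)" if "p \<in> set ps" for p
  proof -
    obtain \<kappa> x \<rho> \<rho>' where p: "p = (\<kappa>, x, \<rho>, \<rho>')" by (cases p) auto
    have "x 0 = emb P 1" using ps[of \<kappa> x \<rho> \<rho>'] that p max_units_units unit_zero by blast
    then show ?thesis using emb_ract[of 1 "\<rho> 0"] by (simp add: p summand_def emb_lact)
  qed
  have "(\<Sum>p\<leftarrow>ps. summand p 0) = emb P (\<Sum>p\<leftarrow>ps. case p of (\<kappa>, x, \<rho>, \<rho>') \<Rightarrow> \<kappa> * \<rho> 0)"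
    using summand0 by (induction ps) (auto simp: emb0 emb_add)
  then have y0: "y 0 = emb P 1" by (simp add: y_eq one)
  have hvd_right: "((\<lambda>s. K s (\<xi> s) (y s)) has_vector_derivative (\<Sum>(\<kappa>, x, \<rho>, \<rho>')\<leftarrow>ps.
      (blinfun_mult_left (\<rho> 0) o\<^sub>L (gen P \<xi> x o\<^sub>L blinfun_mult_left \<kappa>))
        + (blinfun_mult_left \<rho>' o\<^sub>L blinfun_mult_left \<kappa>))) (at 0 within {0..})"
    if \<xi>: "\<xi> \<in> max_units P \<omega>" for \<xi>
  proof (rule has_vector_derivative_transform)
    have xu: "\<xi> \<in> units P" by (rule max_units_units[OF \<xi>])
    show "((\<lambda>s. \<Sum>p\<leftarrow>ps. K s (\<xi> s) (summand p s)) has_vector_derivative (\<Sum>(\<kappa>, x, \<rho>, \<rho>')\<leftarrow>ps.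
      (blinfun_mult_left (\<rho> 0) o\<^sub>L (gen P \<xi> x o\<^sub>L blinfun_mult_left \<kappa>))
        + (blinfun_mult_left \<rho>' o\<^sub>L blinfun_mult_left \<kappa>))) (at 0 within {0..})"
    proof (rule has_vector_derivative_sum_list)
      fix p assume "p \<in> set ps"
      obtain \<kappa> x \<rho> \<rho>' where p: "p = (\<kappa>, x, \<rho>, \<rho>')" by (cases p) auto
      have x: "x \<in> max_units P \<omega>" "(\<rho> has_vector_derivative \<rho>') (at 0 within {0..})"
        using ps[of \<kappa> x \<rho> \<rho>'] \<open>p \<in> set ps\<close> p by auto
      have x': "x \<in> units P" by (rule max_units_units[OF x(1)])
      have g: "kernel P \<xi> x 0 = id_blinfun" "(kernel P \<xi> x has_vector_derivative gen P \<xi> x) (at 0 within {0..})"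
        using max_units_has_gen[OF \<xi> x(1)] by (simp_all add: has_gen_def)
      have "((\<lambda>s. kernel P \<xi> x s o\<^sub>L blinfun_mult_left \<kappa>) has_vector_derivative (gen P \<xi> x o\<^sub>L blinfun_mult_left \<kappa>)) (at 0 within {0..})"
        by (rule bounded_linear.has_vector_derivative[OF bounded_bilinear.bounded_linear_left[OF bounded_bilinear_blinfun_compose] g(2)])
      then have "((\<lambda>s. blinfun_mult_left (\<rho> s) o\<^sub>L (kernel P \<xi> x s o\<^sub>L blinfun_mult_left \<kappa>)) has_vector_derivative
          (blinfun_mult_left (\<rho> 0) o\<^sub>L (gen P \<xi> x o\<^sub>L blinfun_mult_left \<kappa>))
          + (blinfun_mult_left \<rho>' o\<^sub>L (kernel P \<xi> x 0 o\<^sub>L blinfun_mult_left \<kappa>))) (at 0 within {0..})"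
        by (intro bounded_bilinear.has_vector_derivative[OF bounded_bilinear_blinfun_compose]
            bounded_linear.has_vector_derivative[OF bounded_linear_blinfun_mult_left] x(2))
      moreover have "kernel P \<xi> x 0 o\<^sub>L blinfun_mult_left \<kappa> = blinfun_mult_left \<kappa>"
        unfolding g(1) by (rule blinfun_eqI) simp
      ultimately have "((\<lambda>s. blinfun_mult_left (\<rho> s) o\<^sub>L (kernel P \<xi> x s o\<^sub>L blinfun_mult_left \<kappa>)) has_vector_derivative
          (blinfun_mult_left (\<rho> 0) o\<^sub>L (gen P \<xi> x o\<^sub>L blinfun_mult_left \<kappa>))
          + (blinfun_mult_left \<rho>' o\<^sub>L blinfun_mult_left \<kappa>)) (at 0 within {0..})"
        by simp
      then show "((\<lambda>s. K s (\<xi> s) (summand p s)) has_vector_derivative (case p of (\<kappa>, x, \<rho>, \<rho>') \<Rightarrow>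
          (blinfun_mult_left (\<rho> 0) o\<^sub>L (gen P \<xi> x o\<^sub>L blinfun_mult_left \<kappa>))
          + (blinfun_mult_left \<rho>' o\<^sub>L blinfun_mult_left \<kappa>))) (at 0 within {0..})"
        unfolding p prod.case
        by (rule has_vector_derivative_transform[rotated 2])
          (auto simp: summand_def kernel_eq intro!: hilbert_bimodule.Kop_bimodule_right[OF fib_hilbert]
            unit_closed xu x')
    qed
    show "K s (\<xi> s) (y s) = (\<Sum>p\<leftarrow>ps. K s (\<xi> s) (summand p s))" if "s \<in> {0..}" for s
      unfolding y_eq using that unit_closed[OF xu]
      by (intro hilbert_bimodule.Kop_sum_list_right[OF fib_hilbert] cl) auto
  qed simp
  have gen_right: "has_gen (\<lambda>s. K s (\<xi> s) (y s)) (\<Sum>(\<kappa>, x, \<rho>, \<rho>')\<leftarrow>ps.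
      (blinfun_mult_left (\<rho> 0) o\<^sub>L (gen P \<xi> x o\<^sub>L blinfun_mult_left \<kappa>))
        + (blinfun_mult_left \<rho>' o\<^sub>L blinfun_mult_left \<kappa>))"
    if \<xi>: "\<xi> \<in> max_units P \<omega>" for \<xi>
    using hvd_right[OF \<xi>] unit_zero[OF max_units_units[OF \<xi>]] y0 by (simp add: has_gen_def K_emb_one)
  \<comment> \<open>The diagonal kernel is expanded in its left argument and the derivatives already
    found are used in the right one. Only the existence of the derivative matters, so its value
    \<open>d\<close> is left implicit.\<close>
  define D where "D p s = (case p of (\<kappa>, x, \<rho>, \<rho>' :: 'b) \<Rightarrow>
      blinfun_mult_right (star (\<rho> s)) o\<^sub>L (K s (x s) (y s) o\<^sub>L blinfun_mult_right (star \<kappa>)))" for p s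
  have "\<exists>d. (D p has_vector_derivative d) (at 0 within {0..})" if pps: "p \<in> set ps" for p
  proof -
    obtain \<kappa> x \<rho> \<rho>' where p: "p = (\<kappa>, x, \<rho>, \<rho>')" by (cases p) auto
    have x: "x \<in> max_units P \<omega>" "(\<rho> has_vector_derivative \<rho>') (at 0 within {0..})"
      using ps[of \<kappa> x \<rho> \<rho>'] pps p by auto
    note h1 = bounded_linear.has_vector_derivative[OF bounded_bilinear.bounded_linear_left[OF
          bounded_bilinear_blinfun_compose] hvd_right[OF x(1)], of "blinfun_mult_right (star \<kappa>)"]
    note h2 = bounded_linear.has_vector_derivative[OF bounded_linear_blinfun_mult_right
        bounded_linear.has_vector_derivative[OF bounded_linear_star x(2)]]
    show ?thesis unfolding D_def p prod.case
      by (rule exI, rule bounded_bilinear.has_vector_derivative[OF bounded_bilinear_blinfun_compose h2 h1])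
  qed
  then obtain d where d: "\<And>p. p \<in> set ps \<Longrightarrow> (D p has_vector_derivative d p) (at 0 within {0..})"
    by metis
  have "((\<lambda>s. K s (y s) (y s)) has_vector_derivative (\<Sum>p\<leftarrow>ps. d p)) (at 0 within {0..})"
  proof (rule has_vector_derivative_transform)
    show "((\<lambda>s. \<Sum>p\<leftarrow>ps. D p s) has_vector_derivative (\<Sum>p\<leftarrow>ps. d p)) (at 0 within {0..})"
      by (rule has_vector_derivative_sum_list) (rule d)
    show "K s (y s) (y s) = (\<Sum>p\<leftarrow>ps. D p s)" if "s \<in> {0..}" for s
    proof -
      have s: "s \<ge> 0" using that by simp
      have "K s (\<Sum>p\<leftarrow>ps. summand p s) (y s) = (\<Sum>p\<leftarrow>ps. K s (summand p s) (y s))"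
        by (rule hilbert_bimodule.Kop_sum_list_left[OF fib_hilbert[OF s] cl[OF _ s] yc[OF s]])
      also have "\<dots> = (\<Sum>p\<leftarrow>ps. D p s)"
      proof (intro arg_cong[of _ _ sum_list] map_cong refl)
        fix p assume pps: "p \<in> set ps"
        obtain \<kappa> x \<rho> \<rho>' where p: "p = (\<kappa>, x, \<rho>, \<rho>')" by (cases p) auto
        have "x s \<in> E s" using ps[of \<kappa> x \<rho> \<rho>'] pps p max_units_units unit_closed s by blast
        then show "K s (summand p s) (y s) = D p s"
          unfolding D_def summand_def p prod.case
          by (rule hilbert_bimodule.Kop_bimodule_left[OF fib_hilbert[OF s] _ yc[OF s]])
      qed
      finally show ?thesis by (simp add: y_eq[symmetric])
    qed
  qed simp
  then have gen_left: "has_gen (\<lambda>s. K s (y s) (y s)) (\<Sum>p\<leftarrow>ps. d p)"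
    using y0 by (simp add: has_gen_def K_emb_one)
  \<comment> \<open>Witnesses for the last assumption of \<open>approximate_unit\<close>: the units
    in \<open>ps\<close>, and the bound \<open>R\<close> on the right coefficients at times up to
    1.\<close>
  define Xs where "Xs = map (\<lambda>p. fst (snd p)) ps"
  define C where "C = (\<Sum>p\<leftarrow>ps. R * norm (fst p))"
  have Xs: "x \<in> max_units P \<omega>" if "x \<in> set Xs" for x
    using that ps unfolding Xs_def by fastforce
  interpret A: approximate_unit P \<omega> y Xs "\<Sum>p\<leftarrow>ps. d p" C
  proof
    show "y s \<in> E s" if "s \<ge> 0" for s by (rule yc[OF that])
    show "y 0 = emb P 1" by (rule y0)
    show "set Xs \<subseteq> units P" using Xs max_units_units by blast
    show "\<exists>N. has_gen (\<lambda>s. K s (x s) (y s)) N" if "x \<in> set Xs" for x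
      using gen_right[OF Xs[OF that]] by blast
    show "has_gen (\<lambda>s. K s (y s) (y s)) (\<Sum>p\<leftarrow>ps. d p)" by (rule gen_left)
    show "C \<ge> 0" unfolding C_def using R by (intro sum_list_nonneg) auto
    show "norm (K s (y s) z) \<le> C * (\<Sum>x\<leftarrow>Xs. norm (K s (x s) z))" if s: "0 \<le> s" "s \<le> 1" and z: "z \<in> E s" for s z
    proof -
      interpret H: hilbert_bimodule "fib P s" by (rule fib_hilbert) fact
      have "norm (K s (y s) z) = norm (\<Sum>p\<leftarrow>ps. K s (summand p s) z)"
        unfolding y_eq by (subst H.Kop_sum_list_left[OF cl[OF _ s(1)] z]) auto
      also have "\<dots> \<le> (\<Sum>p\<leftarrow>ps. norm (K s (summand p s) z))"
        by (induction ps) (auto intro: norm_triangle_le)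
      also have "\<dots> \<le> (\<Sum>p\<leftarrow>ps. R * norm (fst p) * (\<Sum>x\<leftarrow>Xs. norm (K s (x s) z)))"
      proof (rule sum_list_mono)
        fix p assume pps: "p \<in> set ps"
        obtain \<kappa> x \<rho> \<rho>' where p: "p = (\<kappa>, x, \<rho>, \<rho>')" by (cases p) auto
        have x: "x s \<in> E s" "norm (\<rho> s) \<le> R"
          using ps[of \<kappa> x \<rho> \<rho>'] pps p max_units_units unit_closed s by auto
        have "norm (K s (summand p s) z) \<le> R * norm \<kappa> * norm (K s (x s) z)"
          unfolding summand_def p prod.case by (rule H.norm_Kop_bimodule_left[OF x(1) z x(2)])
        also have "\<dots> \<le> R * norm \<kappa> * (\<Sum>x\<leftarrow>Xs. norm (K s (x s) z))"
        proof (rule mult_left_mono)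
          have "norm (K s (x s) z) \<in> set (map (\<lambda>x. norm (K s (x s) z)) Xs)"
            using pps by (force simp: Xs_def p)
          then show "norm (K s (x s) z) \<le> (\<Sum>x\<leftarrow>Xs. norm (K s (x s) z))"
            by (rule member_le_sum_list) auto
        qed (use R in simp)
        finally show "norm (K s (summand p s) z) \<le> R * norm (fst p) * (\<Sum>x\<leftarrow>Xs. norm (K s (x s) z))"
          by (simp add: p)
      qed
      also have "\<dots> = C * (\<Sum>x\<leftarrow>Xs. norm (K s (x s) z))"
        by (simp add: C_def sum_list_mult_const)
      finally show ?thesis .
    qed
  qed
  show "limit_unit P (combination P ps) \<in> max_units P \<omega>"
    using A.Z_max_units[OF \<omega>] gen_right[OF w] by (auto simp: y_def)
  show "blinfun_apply (gen P \<xi> (limit_unit P (combination P ps))) b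
      = (\<Sum>(\<kappa>, x, \<rho>, \<rho>')\<leftarrow>ps. blinfun_apply (gen P \<xi> x) (b * \<kappa>) * \<rho> 0 + b * \<kappa> * \<rho>')"
    if \<xi>: "\<xi> \<in> max_units P \<omega>"
  proof -
    have "has_gen (kernel P \<xi> (limit_unit P y)) (\<Sum>(\<kappa>, x, \<rho>, \<rho>')\<leftarrow>ps.
      (blinfun_mult_left (\<rho> 0) o\<^sub>L (gen P \<xi> x o\<^sub>L blinfun_mult_left \<kappa>))
        + (blinfun_mult_left \<rho>' o\<^sub>L blinfun_mult_left \<kappa>))"
      using A.has_gen_unit_Z[OF max_units_units[OF \<xi>] gen_right[OF \<xi>]] by (simp add: kernel_eq[abs_def])
    then have "gen P \<xi> (limit_unit P y) = (\<Sum>(\<kappa>, x, \<rho>, \<rho>')\<leftarrow>ps.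
      (blinfun_mult_left (\<rho> 0) o\<^sub>L (gen P \<xi> x o\<^sub>L blinfun_mult_left \<kappa>))
        + (blinfun_mult_left \<rho>' o\<^sub>L blinfun_mult_left \<kappa>))" by (rule gen_eqI)
    moreover have "blinfun_apply (\<Sum>(\<kappa>, x, \<rho>, \<rho>')\<leftarrow>ps.
      (blinfun_mult_left (\<rho> 0) o\<^sub>L (gen P \<xi> x o\<^sub>L blinfun_mult_left \<kappa>))
        + (blinfun_mult_left \<rho>' o\<^sub>L blinfun_mult_left \<kappa>)) b
      = (\<Sum>(\<kappa>, x, \<rho>, \<rho>')\<leftarrow>ps. blinfun_apply (gen P \<xi> x) (b * \<kappa>) * \<rho> 0 + b * \<kappa> * \<rho>')"
      by (induction ps) (auto simp: blinfun.add_left)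
    ultimately show ?thesis by (simp add: y_def)
  qed
qed

section \<open>The constructions \<open>lbox\<close>, \<open>rbox\<close> and
  \<open>unit_exp\<close>\<close>

lemma limit_unit_cong: "(\<And>s. s \<ge> 0 \<Longrightarrow> y s = z s) \<Longrightarrow> limit_unit P y = limit_unit P z"
  by (auto simp: limit_unit_def restrict_def intro!: ext)

lemma lbox_max_units:
  assumes \<omega>: "continuous_unit P \<omega>"
    and ps: "\<And>\<kappa> x. (\<kappa>, x) \<in> set ps \<Longrightarrow> x \<in> max_units P \<omega>" and one: "(\<Sum>(\<kappa>, x)\<leftarrow>ps. \<kappa>) = 1"
  shows "lbox P ps \<in> max_units P \<omega>"
    and "\<xi> \<in> max_units P \<omega> \<Longrightarrow> blinfun_apply (gen P \<xi> (lbox P ps)) b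
      = (\<Sum>(\<kappa>, x)\<leftarrow>ps. blinfun_apply (gen P \<xi> x) (b * \<kappa>))"
proof -
  define qs where "qs = map (\<lambda>(\<kappa>, x). (\<kappa>, x, (\<lambda>s::real. 1::'b), 0::'b)) ps"
  have eq: "lbox P ps = limit_unit P (combination P qs)"
    unfolding lbox_def
  proof (rule limit_unit_cong)
    fix s :: real assume s: "s \<ge> 0"
    interpret H: hilbert_bimodule "fib P s" by (rule fib_hilbert) fact
    have "ract (fib P s) (x s) 1 = x s" if "(\<kappa>, x) \<in> set ps" for \<kappa> x
      by (rule H.ract_one[OF unit_closed[OF max_units_units[OF ps[OF that]] s]])
    then show "(\<Sum>(\<kappa>, x)\<leftarrow>ps. lact (fib P s) \<kappa> (x s)) = combination P qs s"
      unfolding combination_def qs_def map_map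
      by (intro arg_cong[of _ _ sum_list] map_cong) (auto simp: comp_def)
  qed
  have q: "x \<in> max_units P \<omega> \<and> (\<rho> has_vector_derivative \<rho>') (at 0 within {0..})
      \<and> (\<forall>s. 0 \<le> s \<and> s \<le> 1 \<longrightarrow> norm (\<rho> s) \<le> 1)" if "(\<kappa>, x, \<rho>, \<rho>') \<in> set qs" for \<kappa> x \<rho> \<rho>'
    using that ps by (auto simp: qs_def)
  have one': "(\<Sum>(\<kappa>, x, \<rho>, \<rho>')\<leftarrow>qs. \<kappa> * \<rho> 0) = 1"
    using one by (simp add: qs_def comp_def case_prod_unfold)
  show "lbox P ps \<in> max_units P \<omega>"
    unfolding eq by (rule combination_generates(1)[OF \<omega> q one']) simp_all
  show "blinfun_apply (gen P \<xi> (lbox P ps)) b = (\<Sum>(\<kappa>, x)\<leftarrow>ps. blinfun_apply (gen P \<xi> x) (b * \<kappa>))"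
    if "\<xi> \<in> max_units P \<omega>"
    unfolding eq by (subst combination_generates(2)[OF \<omega> q one' _ that])
      (simp_all add: qs_def comp_def case_prod_unfold)
qed

lemma rbox_max_units:
  assumes \<omega>: "continuous_unit P \<omega>"
    and ps: "\<And>\<kappa> x. (x, \<kappa>) \<in> set ps \<Longrightarrow> x \<in> max_units P \<omega>" and one: "(\<Sum>(x, \<kappa>)\<leftarrow>ps. \<kappa>) = 1"
    and \<xi>: "\<xi> \<in> max_units P \<omega>"
  shows "blinfun_apply (gen P \<xi> (rbox P ps)) b = (\<Sum>(x, \<kappa>)\<leftarrow>ps. blinfun_apply (gen P \<xi> x) b * \<kappa>)"
proof -
  define qs where "qs = map (\<lambda>(x, \<kappa>). (1::'b, x, (\<lambda>s::real. \<kappa>), 0::'b)) ps"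
  define R where "R = (\<Sum>(x, \<kappa>)\<leftarrow>ps. norm \<kappa>)"
  have eq: "rbox P ps = limit_unit P (combination P qs)"
    unfolding rbox_def
  proof (rule limit_unit_cong)
    fix s :: real assume s: "s \<ge> 0"
    interpret H: hilbert_bimodule "fib P s" by (rule fib_hilbert) fact
    have "lact (fib P s) 1 (ract (fib P s) (x s) \<kappa>) = ract (fib P s) (x s) \<kappa>" if "(x, \<kappa>) \<in> set ps" for \<kappa> x
      by (rule H.lact_one[OF H.ract_closed[OF unit_closed[OF max_units_units[OF ps[OF that]] s]]])
    then show "(\<Sum>(x, \<kappa>)\<leftarrow>ps. ract (fib P s) (x s) \<kappa>) = combination P qs s"
      unfolding combination_def qs_def map_map
      by (intro arg_cong[of _ _ sum_list] map_cong) (auto simp: comp_def)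
  qed
  have "norm \<kappa> \<le> R" if "(x, \<kappa>) \<in> set ps" for x \<kappa>
  proof -
    have "norm \<kappa> \<in> set (map (\<lambda>(x, \<kappa>). norm \<kappa>) ps)" using that by force
    then show ?thesis unfolding R_def by (rule member_le_sum_list) auto
  qed
  then have q: "x \<in> max_units P \<omega> \<and> (\<rho> has_vector_derivative \<rho>') (at 0 within {0..})
      \<and> (\<forall>s. 0 \<le> s \<and> s \<le> 1 \<longrightarrow> norm (\<rho> s) \<le> R)" if "(\<kappa>, x, \<rho>, \<rho>') \<in> set qs" for \<kappa> x \<rho> \<rho>'
    using that ps by (auto simp: qs_def)
  have one': "(\<Sum>(\<kappa>, x, \<rho>, \<rho>')\<leftarrow>qs. \<kappa> * \<rho> 0) = 1"
    using one by (simp add: qs_def comp_def case_prod_unfold)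
  have "R \<ge> 0" unfolding R_def by (intro sum_list_nonneg) auto
  then show ?thesis
    unfolding eq by (subst combination_generates(2)[OF \<omega> q one' _ \<xi>])
      (simp_all add: qs_def comp_def case_prod_unfold)
qed

lemma gen_unit_exp:
  assumes \<omega>: "continuous_unit P \<omega>" and x: "x \<in> max_units P \<omega>" and \<xi>: "\<xi> \<in> max_units P \<omega>"
  shows "blinfun_apply (gen P \<xi> (unit_exp P x \<beta>)) b = blinfun_apply (gen P \<xi> x) b + b * \<beta>"
proof -
  define qs where "qs = [(1::'b, x, (\<lambda>s::real. exp (s *\<^sub>R \<beta>)), \<beta>)]"
  have eq: "unit_exp P x \<beta> = limit_unit P (combination P qs)"
    unfolding unit_exp_def
  proof (rule limit_unit_cong)
    fix s :: real assume s: "s \<ge> 0"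
    interpret H: hilbert_bimodule "fib P s" by (rule fib_hilbert) fact
    show "ract (fib P s) (x s) (exp (s *\<^sub>R \<beta>)) = combination P qs s"
      using unit_closed[OF max_units_units[OF x] s] H.lact_one H.ract_closed
      by (simp add: combination_def qs_def)
  qed
  have q: "x \<in> max_units P \<omega> \<and> (\<rho> has_vector_derivative \<rho>') (at 0 within {0..})
      \<and> (\<forall>s. 0 \<le> s \<and> s \<le> 1 \<longrightarrow> norm (\<rho> s) \<le> exp (norm \<beta>))" if "(\<kappa>, x, \<rho>, \<rho>') \<in> set qs" for \<kappa> x \<rho> \<rho>'
  proof (intro conjI allI impI)
    have eqs: "\<rho> = (\<lambda>s. exp (s *\<^sub>R \<beta>))" "\<rho>' = \<beta>" using that by (auto simp: qs_def)
    show "x \<in> max_units P \<omega>" using that assms by (auto simp: qs_def)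
    show "(\<rho> has_vector_derivative \<rho>') (at 0 within {0..})"
      using exp_scaleR_has_vector_derivative_right[of \<beta> 0 "{0..}"] by (simp add: eqs)
    fix s :: real assume s: "0 \<le> s \<and> s \<le> 1"
    then have "norm (s *\<^sub>R \<beta>) \<le> norm \<beta>" by (simp add: mult_left_le_one_le)
    then show "norm (\<rho> s) \<le> exp (norm \<beta>)" unfolding eqs
      by (intro order_trans[OF norm_exp]) (simp only: exp_le_cancel_iff)
  qed
  have one': "(\<Sum>(\<kappa>, x, \<rho>, \<rho>')\<leftarrow>qs. \<kappa> * \<rho> 0) = 1" by (simp add: qs_def)
  show ?thesis
    unfolding eq by (subst combination_generates(2)[OF \<omega> q one' _ \<xi>]) (simp_all add: qs_def)
qed

end

section \<open>The inner products on the bimodule of units\<close>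

context product_system
begin

text \<open>Positivity enters as \<open>star b = b\<close>: exchanging the arguments of a generator
  evaluates it at \<open>star b\<close>. Rules for the left argument are obtained from those for the
  right one in this way.\<close>

lemma unit_form_flip:
  assumes "cstar_positive b" "x \<in> max_units P \<omega>" "y \<in> max_units P \<omega>" "\<omega> \<in> max_units P \<omega>"
  shows "unit_form P \<omega> b y x = star (unit_form P \<omega> b x y)"
proof -
  have b: "star b = b" using assms(1) by (auto simp: cstar_positive_def star_mult star_star)
  have "star (blinfun_apply (gen P u v) b) = blinfun_apply (gen P v u) b"
    if "u \<in> max_units P \<omega>" "v \<in> max_units P \<omega>" for u v
    by (subst gen_flip[OF that]) (simp add: b)
  then show ?thesis
    using assms by (simp add: unit_form_def blinfun.diff_left blinfun.add_left star_add star_diff)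
qed

context
  fixes \<omega> assumes \<omega>: "continuous_unit P \<omega>"
begin

section \<open>Generators and forms under the module operations\<close>

lemma base_max: "\<omega> \<in> max_units P \<omega>"
  using \<omega> by (simp add: max_units_def continuous_unit_def)

lemma gen_uadd:
  assumes "y \<in> max_units P \<omega>" "z \<in> max_units P \<omega>"
  shows "uadd P \<omega> y z \<in> max_units P \<omega>"
    and "\<xi> \<in> max_units P \<omega> \<Longrightarrow> gen P \<xi> (uadd P \<omega> y z) = gen P \<xi> y + gen P \<xi> z - gen P \<xi> \<omega>"
proof -
  show "uadd P \<omega> y z \<in> max_units P \<omega>"
    unfolding uadd_def by (rule lbox_max_units(1)[OF \<omega>]) (use assms base_max in auto)
  show "gen P \<xi> (uadd P \<omega> y z) = gen P \<xi> y + gen P \<xi> z - gen P \<xi> \<omega>" if "\<xi> \<in> max_units P \<omega>"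
    unfolding uadd_def
    by (rule blinfun_eqI, subst lbox_max_units(2)[OF \<omega> _ _ that])
      (use assms base_max in \<open>auto simp: blinfun.diff_left blinfun.add_left blinfun.minus_right\<close>)
qed

lemma gen_uneg:
  assumes "y \<in> max_units P \<omega>"
  shows "uneg P \<omega> y \<in> max_units P \<omega>"
    and "\<xi> \<in> max_units P \<omega> \<Longrightarrow> gen P \<xi> (uneg P \<omega> y) = gen P \<xi> \<omega> + gen P \<xi> \<omega> - gen P \<xi> y"
proof -
  show "uneg P \<omega> y \<in> max_units P \<omega>"
    unfolding uneg_def by (rule lbox_max_units(1)[OF \<omega>]) (use assms base_max in auto)
  show "gen P \<xi> (uneg P \<omega> y) = gen P \<xi> \<omega> + gen P \<xi> \<omega> - gen P \<xi> y" if "\<xi> \<in> max_units P \<omega>"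
    unfolding uneg_def
    by (rule blinfun_eqI, subst lbox_max_units(2)[OF \<omega> _ _ that])
      (use assms base_max in \<open>auto simp: blinfun.diff_left blinfun.add_left blinfun.minus_right mult_2_right blinfun.add_right\<close>)
qed

lemma gen_ulact:
  assumes "y \<in> max_units P \<omega>"
  shows "ulact P \<omega> a y \<in> max_units P \<omega>"
    and "\<xi> \<in> max_units P \<omega> \<Longrightarrow> blinfun_apply (gen P \<xi> (ulact P \<omega> a y)) b
      = blinfun_apply (gen P \<xi> y) (b * a) + blinfun_apply (gen P \<xi> \<omega>) (b * (1 - a))"
proof -
  show "ulact P \<omega> a y \<in> max_units P \<omega>"
    unfolding ulact_def by (rule lbox_max_units(1)[OF \<omega>]) (use assms base_max in auto)
  show "blinfun_apply (gen P \<xi> (ulact P \<omega> a y)) b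
      = blinfun_apply (gen P \<xi> y) (b * a) + blinfun_apply (gen P \<xi> \<omega>) (b * (1 - a))" if "\<xi> \<in> max_units P \<omega>"
    unfolding ulact_def by (subst lbox_max_units(2)[OF \<omega> _ _ that]) (use assms base_max in auto)
qed

lemma uscale_max_units: "y \<in> max_units P \<omega> \<Longrightarrow> uscale P \<omega> \<alpha> y \<in> max_units P \<omega>"
  unfolding uscale_def by (rule gen_ulact(1))

lemma gen_uract:
  assumes "y \<in> max_units P \<omega>" "\<xi> \<in> max_units P \<omega>"
  shows "blinfun_apply (gen P \<xi> (uract P \<omega> y a)) b
      = blinfun_apply (gen P \<xi> y) b * a + blinfun_apply (gen P \<xi> \<omega>) b * (1 - a)"
  unfolding uract_def by (subst rbox_max_units[OF \<omega> _ _ assms(2)]) (use assms base_max in auto)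

text \<open>On generators the module operations are affine, with a correction at \<omega>. The form
  subtracts the value at \<omega>, so the corrections cancel and the operation becomes linear; the
  rules for the other operations rest on the same cancellation.\<close>

lemma unit_form_uadd:
  assumes "x \<in> max_units P \<omega>" "y \<in> max_units P \<omega>" "z \<in> max_units P \<omega>"
  shows "unit_form P \<omega> b x (uadd P \<omega> y z) = unit_form P \<omega> b x y + unit_form P \<omega> b x z"
  using assms base_max
  by (simp add: unit_form_def gen_uadd blinfun.diff_left blinfun.add_left)

lemma unit_form_uneg:
  assumes "x \<in> max_units P \<omega>" "y \<in> max_units P \<omega>"
  shows "unit_form P \<omega> b x (uneg P \<omega> y) = - unit_form P \<omega> b x y"
  using assms base_max
  by (simp add: unit_form_def gen_uneg blinfun.diff_left blinfun.add_left)

lemma unit_form_uscale: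
  assumes "x \<in> max_units P \<omega>" "y \<in> max_units P \<omega>"
  shows "unit_form P \<omega> b x (uscale P \<omega> \<alpha> y) = \<alpha> *\<^sub>C unit_form P \<omega> b x y"
proof -
  have "b * (1 - \<alpha> *\<^sub>C 1) = b - \<alpha> *\<^sub>C b" by (simp add: right_diff_distrib mult_scaleC_right)
  then have "blinfun_apply (gen P \<xi> (uscale P \<omega> \<alpha> y)) b = \<alpha> *\<^sub>C blinfun_apply (gen P \<xi> y) b
      + blinfun_apply (gen P \<xi> \<omega>) b - \<alpha> *\<^sub>C blinfun_apply (gen P \<xi> \<omega>) b" if "\<xi> \<in> max_units P \<omega>" for \<xi>
    using assms(2) base_max that gen_scaleC[OF that]
    by (simp add: uscale_def gen_ulact mult_scaleC_right blinfun.diff_right)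
  then show ?thesis using assms(1) base_max
    by (simp add: unit_form_def blinfun.diff_left blinfun.add_left scaleC_add_right scaleC_diff_right)
qed

lemma unit_form_self_tendsto:
  assumes "x \<in> max_units P \<omega>"
  shows "((\<lambda>t. ip (fib P t) (x t - \<omega> t) (lact (fib P t) b (x t - \<omega> t)) /\<^sub>R t) \<longlongrightarrow> unit_form P \<omega> b x x) (at_right 0)"
  using difference_quotient_tendsto[OF assms base_max] by (simp add: unit_form_def)

text \<open>Writing \<open>b = star c * c\<close> moves \<open>c\<close> to both arguments, so that
  before the limit the quotient is a positive multiple of the inner product of a vector with
  itself.\<close>

lemma unit_form_positive:
  assumes x: "x \<in> max_units P \<omega>" and b: "cstar_positive b"
  shows "cstar_positive (unit_form P \<omega> b x x)"
proof -
  obtain c where c: "b = star c * c" using b by (auto simp: cstar_positive_def)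
  have "\<forall>\<^sub>F t in at_right 0. ip (fib P t) (x t - \<omega> t) (lact (fib P t) b (x t - \<omega> t)) /\<^sub>R t \<in> Collect hpos"
    using eventually_at_right_less[of 0]
  proof eventually_elim
    case (elim t)
    interpret H: hilbert_bimodule "fib P t" by (rule fib_hilbert) (use elim in simp)
    have cl: "x t - \<omega> t \<in> E t"
      using unit_closed[OF max_units_units[OF x]] unit_closed[OF max_units_units[OF base_max]] elim
      by (intro H.diff_closed) auto
    have "ip (fib P t) (x t - \<omega> t) (lact (fib P t) b (x t - \<omega> t))
        = ip (fib P t) (lact (fib P t) c (x t - \<omega> t)) (lact (fib P t) c (x t - \<omega> t))"
      using cl by (simp add: c H.lact_adjoint H.lact_mult H.lact_closed)
    moreover have "cstar_positive (ip (fib P t) (lact (fib P t) c (x t - \<omega> t)) (lact (fib P t) c (x t - \<omega> t)))"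
      using cl by (intro H.ip_positive H.lact_closed)
    ultimately show ?case using elim by (simp add: cstar_positive_iff_hpos hpos_scaleR)
  qed
  then have "unit_form P \<omega> b x x \<in> Collect hpos"
    by (rule Lim_in_closed_set[OF hpos_closed _ _ unit_form_self_tendsto[OF x]]) simp
  then show ?thesis by (simp add: cstar_positive_iff_hpos)
qed

text \<open>The extra term \<open>b * \<beta>\<close> appears once with \<open>x\<close> and once
  with \<omega> in the first argument, with opposite signs.\<close>

lemma unit_form_unit_exp_right:
  assumes "x \<in> max_units P \<omega>" "y \<in> max_units P \<omega>"
  shows "unit_form P \<omega> b x (unit_exp P y \<beta>) = unit_form P \<omega> b x y"
  using assms base_max by (simp add: unit_form_def gen_unit_exp[OF \<omega>] blinfun.diff_left blinfun.add_left)

lemma unit_form_approx: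
  assumes "cstar_positive b" "x \<in> max_units P \<omega>" "x' \<in> max_units P \<omega>" "y \<in> max_units P \<omega>" "y' \<in> max_units P \<omega>"
    "unit_approx P x x'" "unit_approx P y y'"
  shows "unit_form P \<omega> b x y = unit_form P \<omega> b x' y'"
proof -
  have "unit_form P \<omega> b x y = unit_form P \<omega> b x y'"
    using assms(2,5,7) by (auto simp: unit_approx_def unit_form_unit_exp_right)
  also have "\<dots> = star (unit_form P \<omega> b y' x)" by (rule unit_form_flip[OF assms(1,5,2) base_max])
  also have "unit_form P \<omega> b y' x = unit_form P \<omega> b y' x'"
    using assms(3,5,6) by (auto simp: unit_approx_def unit_form_unit_exp_right)
  also have "star (unit_form P \<omega> b y' x') = unit_form P \<omega> b x' y'"
    by (rule unit_form_flip[OF assms(1,5,3) base_max, symmetric])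
  finally show ?thesis .
qed

lemma unit_form_ulact:
  assumes "x \<in> max_units P \<omega>" "y \<in> max_units P \<omega>"
  shows "unit_form P \<omega> 1 x (ulact P \<omega> a y) = unit_form P \<omega> a x y"
  using assms base_max
  by (simp add: unit_form_def gen_ulact blinfun.diff_left blinfun.add_left blinfun.diff_right)

lemma unit_form_uract:
  assumes "x \<in> max_units P \<omega>" "y \<in> max_units P \<omega>"
  shows "unit_form P \<omega> b x (uract P \<omega> y a) = unit_form P \<omega> b x y * a"
  using assms base_max
  by (simp add: unit_form_def gen_uract blinfun.diff_left blinfun.add_left algebra_simps)

text \<open>The forms are additive in the index, so the difference is the form for
  \<open>1 - b\<close>.\<close>

lemma unit_form_mono:
  assumes "x \<in> max_units P \<omega>" "b \<le>\<^sub>C 1"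
  shows "unit_form P \<omega> b x x \<le>\<^sub>C unit_form P \<omega> 1 x x"
  using unit_form_positive[OF assms(1), of "1 - b"] assms(2)
  by (simp add: cstar_le_def unit_form_def blinfun.diff_right)

text \<open>Expanding in both arguments gives an alternating sum of forms of \<open>x\<close> and
  \<open>y\<close>, in which all terms containing \<omega> cancel. What remains is the limit in
  \<open>difference_quotient_tendsto\<close>. The expansion on the left comes from the one on the
  right by \<open>unit_form_flip\<close>, as 1 is positive.\<close>

lemma unit_form_udiff:
  assumes x: "x \<in> max_units P \<omega>" and y: "y \<in> max_units P \<omega>"
  shows "unit_form P \<omega> 1 (udiff P \<omega> x y) (udiff P \<omega> x y)
    = blinfun_apply (gen P x x - gen P x y - gen P y x + gen P y y) 1"
proof -
  have one: "cstar_positive (1::'b)" unfolding cstar_positive_def by (intro exI[of _ 1]) simp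
  have d: "udiff P \<omega> x y \<in> max_units P \<omega>" unfolding udiff_def by (intro gen_uadd gen_uneg x y)
  have right: "unit_form P \<omega> 1 u (udiff P \<omega> x y) = unit_form P \<omega> 1 u x - unit_form P \<omega> 1 u y"
    if "u \<in> max_units P \<omega>" for u
    using that x y by (simp add: udiff_def unit_form_uadd unit_form_uneg gen_uneg)
  have left: "unit_form P \<omega> 1 (udiff P \<omega> x y) u = unit_form P \<omega> 1 x u - unit_form P \<omega> 1 y u"
    if u: "u \<in> max_units P \<omega>" for u
  proof -
    have "unit_form P \<omega> 1 (udiff P \<omega> x y) u = star (unit_form P \<omega> 1 u (udiff P \<omega> x y))"
      by (rule unit_form_flip[OF one u d base_max])
    also have "\<dots> = star (unit_form P \<omega> 1 u x) - star (unit_form P \<omega> 1 u y)"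
      by (simp add: right[OF u] star_diff)
    also have "\<dots> = unit_form P \<omega> 1 x u - unit_form P \<omega> 1 y u"
      by (simp add: unit_form_flip[OF one u x base_max] unit_form_flip[OF one u y base_max])
    finally show ?thesis .
  qed
  show ?thesis
    by (simp add: right[OF d] left x y) (simp add: unit_form_def blinfun.diff_left blinfun.add_left)
qed

end

end

theorem proposition3p3:
  fixes P :: "('b::unital_cstar_algebra, 'e::ab_group_add) prodsys"
    and \<omega> :: "real \<Rightarrow> 'e"
  assumes "product_system P"
    and "continuous_unit P \<omega>"
  shows
    "(\<forall>b. cstar_positive b \<longrightarrow> (\<forall>x\<in>max_units P \<omega>. \<forall>y\<in>max_units P \<omega>. \<forall>z\<in>max_units P \<omega>. \<forall>\<alpha> \<beta> :: complex.
        unit_form P \<omega> b x (uadd P \<omega> (uscale P \<omega> \<alpha> y) (uscale P \<omega> \<beta> z))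
          = \<alpha> *\<^sub>C unit_form P \<omega> b x y + \<beta> *\<^sub>C unit_form P \<omega> b x z))
    \<and> (\<forall>b. cstar_positive b \<longrightarrow> (\<forall>x\<in>max_units P \<omega>. \<forall>y\<in>max_units P \<omega>. \<forall>a.
        unit_form P \<omega> b x (uract P \<omega> y a) = unit_form P \<omega> b x y * a))
    \<and> (\<forall>b. cstar_positive b \<longrightarrow> (\<forall>x\<in>max_units P \<omega>. \<forall>y\<in>max_units P \<omega>.
        unit_form P \<omega> b x y = star (unit_form P \<omega> b y x)))
    \<and> (\<forall>b. cstar_positive b \<longrightarrow> (\<forall>x\<in>max_units P \<omega>. cstar_positive (unit_form P \<omega> b x x)))
    \<and> (\<forall>b. cstar_positive b \<longrightarrow> (\<forall>x\<in>max_units P \<omega>. \<forall>x'\<in>max_units P \<omega>. \<forall>y\<in>max_units P \<omega>. \<forall>y'\<in>max_units P \<omega>.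
        unit_approx P x x' \<and> unit_approx P y y' \<longrightarrow> unit_form P \<omega> b x y = unit_form P \<omega> b x' y'))
    \<and> (\<forall>x\<in>max_units P \<omega>. \<forall>y\<in>max_units P \<omega>. \<forall>a. cstar_positive a \<longrightarrow>
        unit_form P \<omega> 1 x (ulact P \<omega> a y) = unit_form P \<omega> a x y)
    \<and> (\<forall>b. cstar_positive b \<and> b \<le>\<^sub>C 1 \<longrightarrow> (\<forall>x\<in>max_units P \<omega>. unit_form P \<omega> b x x \<le>\<^sub>C unit_form P \<omega> 1 x x))
    \<and> (\<forall>x\<in>max_units P \<omega>. \<forall>y\<in>max_units P \<omega>.
        ((\<lambda>t. ip (fib P t) (x t - y t) (x t - y t) /\<^sub>R t)
          \<longlongrightarrow> unit_form P \<omega> 1 (udiff P \<omega> x y) (udiff P \<omega> x y)) (at_right 0))"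
proof -
  interpret product_system P by fact
  note \<omega> = assms(2)
  note w = base_max[OF \<omega>]
  show ?thesis
  proof (intro conjI allI ballI impI)
    fix b :: 'b and x y z and \<alpha> \<beta> :: complex
    assume "x \<in> max_units P \<omega>" "y \<in> max_units P \<omega>" "z \<in> max_units P \<omega>"
    then show "unit_form P \<omega> b x (uadd P \<omega> (uscale P \<omega> \<alpha> y) (uscale P \<omega> \<beta> z))
        = \<alpha> *\<^sub>C unit_form P \<omega> b x y + \<beta> *\<^sub>C unit_form P \<omega> b x z"
      by (simp add: unit_form_uadd[OF \<omega>] unit_form_uscale[OF \<omega>] uscale_max_units[OF \<omega>])
  next
    fix b :: 'b and x y
    assume "cstar_positive b" "x \<in> max_units P \<omega>" "y \<in> max_units P \<omega>"
    then show "unit_form P \<omega> b x y = star (unit_form P \<omega> b y x)" by (intro unit_form_flip w)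
  next
    fix x y assume x: "x \<in> max_units P \<omega>" and y: "y \<in> max_units P \<omega>"
    have "((\<lambda>t. ip (fib P t) (x t - y t) (lact (fib P t) 1 (x t - y t)) /\<^sub>R t)
        \<longlongrightarrow> unit_form P \<omega> 1 (udiff P \<omega> x y) (udiff P \<omega> x y)) (at_right 0)"
      unfolding unit_form_udiff[OF \<omega> x y] by (rule difference_quotient_tendsto[OF x y])
    then show "((\<lambda>t. ip (fib P t) (x t - y t) (x t - y t) /\<^sub>R t)
        \<longlongrightarrow> unit_form P \<omega> 1 (udiff P \<omega> x y) (udiff P \<omega> x y)) (at_right 0)"
    proof (rule Lim_transform_eventually)
      show "\<forall>\<^sub>F t in at_right 0. ip (fib P t) (x t - y t) (lact (fib P t) 1 (x t - y t)) /\<^sub>R t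
          = ip (fib P t) (x t - y t) (x t - y t) /\<^sub>R t"
        using eventually_at_right_less[of 0]
      proof eventually_elim
        case (elim t)
        interpret H: hilbert_bimodule "fib P t" by (rule fib_hilbert) (use elim in simp)
        have "x t - y t \<in> E t"
          using unit_closed[OF max_units_units[OF x]] unit_closed[OF max_units_units[OF y]] elim
          by (intro H.diff_closed) auto
        then show ?case by (simp add: H.lact_one)
      qed
    qed
  qed (use unit_form_uract[OF \<omega>] unit_form_positive[OF \<omega>] unit_form_approx[OF \<omega>] unit_form_ulact[OF \<omega>]
      unit_form_mono[OF \<omega>] in blast)+
qed

end
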